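(* Let $H$ be a daisy cube that is isomorphic to the resonance graph of a plane elementary bipartite graph with $n\ge 1$ finite faces. If $H$ has at most five maximal vertices, then exactly one of the following holds. 1. $H$ is isomorphic to $K_2$. 2. $n\ge 2$ and $H$ is isomorphic to an edge disjoint union of $K_2$ and $Q_{n-1}$ with exactly one common vertex $0^n$. 3. $H$ has exactly three maximal hypercubes $A,B,C$, with exactly one common vertex $0^n$, and there are positive integers $p,q$ such that $p+q+2=n$, $\dim(A)=p+1$, $\dim(B)=p+q$, $\dim(C)=q+1$, where $A$ and $C$ are edge disjoint, $A\cap B$ is a $p$-dimensional hypercube, and $B\cap C$ is a $q$-dimensional hypercube. 4. $H$ has exactly four maximal hypercubes $A,B,C,D$, with exactly one common vertex $0^n$, and there are positive integers $p,q$ such that $p+q+3=n$, $\dim(A)=p+1$, $\dim(B)=p+q+1$, $\dim(C)=q+1$, $\dim(D)=2$, where $A$ and $C$ are edge disjoint, $B$ and $D$ are edge disjoint, $A\cap B$ is a $p$-dimensional hypercube, $B\cap C$ is a $q$-dimensional hypercube, $A\cap D$ is an edge, and $C\cap D$ is an edge. 5. $H$ has exactly five maximal hypercubes $A,B,C,D,E$, with exactly one common vertex $0^n$, and there are positive integers $p,q$ such that $p+q+4=n$, $\dim(A)=\dim(B)=p+q+1$, $\dim(C)=p+2$, $\dim(D)=q+2$, $\dim(E)=2$, where $C$ and $D$ are edge disjoint, $E$ is edge disjoint from $A$ and from $B$, $A\cap B$ is a $(p+q)$-dimensional hypercube, $A\cap C$ is a $(p+1)$-dimensional hypercube, $A\cap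 D$ is a $q$-dimensional hypercube, $B\cap C$ is a $p$-dimensional hypercube, $B\cap D$ is a $(q+1)$-dimensional hypercube, $C\cap E$ is an edge, and $D\cap E$ is an edge. 6. $H$ has exactly five maximal hypercubes $A,B,C,D,E$, with exactly one common vertex $0^n$, and there are positive integers $p,q,r$ such that $p+q+r+3=n$, $\dim(A)=p+q+r$, $\dim(B)=p+r+1$, $\dim(C)=p+q+1$, $\dim(D)=q+r+1$, $\dim(E)=r+2$, where $C$ and $E$ are edge disjoint, $A\cap B$ is a $(p+r)$-dimensional hypercube, $A\cap C$ is a $(p+q)$-dimensional hypercube, $A\cap D$ is a $(q+r)$-dimensional hypercube, $A\cap E$ is an $r$-dimensional hypercube, $B\cap C$ is a $p$-dimensional hypercube, $B\cap D$ is an $r$-dimensional hypercube, $C\cap D$ is a $q$-dimensional hypercube, $B\cap E$ is an $(r+1)$-dimensional hypercube, and $D\cap E$ is an $(r+1)$-dimensional hypercube.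
   Context: All graphs are finite. An edge of a graph with a perfect matching is allowed if it lies in some perfect matching. A graph (with a perfect matching) is elementary if all its allowed edges form a connected subgraph. The resonance graph $R(G)$ of a plane bipartite graph $G$ has the perfect matchings of $G$ as vertices, two being adjacent if their symmetric difference is the edge set of exactly one cycle which is the periphery of a finite (bounded) face of $G$. Let $\mathcal{B}^n$ be the set of binary strings of length $n$ with the componentwise order $\le$; the hypercube $Q_n$ has vertex set $\mathcal{B}^n$, strings being adjacent if they differ in exactly one position ($Q_0$ is the one-vertex graph). A daisy cube is an induced subgraph of $Q_n$ whose vertex set is a downward closed subset of $(\mathcal{B}^n,\le)$. Its maximal vertices are the maximal elements of its vertex set under $\le$, and its minimum vertex is the all-zero string $0^n$. If a daisy cube $H$ is isomorphic to the resonance graph of a plane elementary bipartite graph with $n$ finite faces, then its isometric dimension (the least dimension of a hypercube into which it embeds isometrically) is $n$, and $H$ is regarded as a daisy cube in $Q_n$, with vertices labelled by binary strings of length $n$. A hypercube of $H$ is a subgraph isomorphic to some $Q_k$, $k$ being its dimension $\dim$; it is maximal if it is not contained in any other hypercube of $H$. "With exactly one common vertex $0^n$" means that the intersection of all the listed hypercubes is the single vertex $0^n$. Two subgraphs are edge disjoint if they have no common edge. *)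

theory Defs
  imports "HOL-Analysis.Analysis"
begin

record 'a graph =
  verts :: "'a set"
  edges :: "'a set set"

definition simple_graph :: "'a graph \<Rightarrow> bool" where
  "simple_graph G \<longleftrightarrow> finite (verts G) \<and> (\<forall>e\<in>edges G. e \<subseteq> verts G \<and> card e = 2)"

definition isomorphic :: "'a graph \<Rightarrow> 'b graph \<Rightarrow> bool" where
  "isomorphic G H \<longleftrightarrow> (\<exists>f. bij_betw f (verts G) (verts H) \<and>
     (\<forall>u\<in>verts G. \<forall>v\<in>verts G. {u, v} \<in> edges G \<longleftrightarrow> {f u, f v} \<in> edges H))"

definition subgraph :: "'a graph \<Rightarrow> 'a graph \<Rightarrow> bool" where
  "subgraph K G \<longleftrightarrow> verts K \<subseteq> verts G \<and> edges K \<subseteq> edges G \<and> (\<forall>e\<in>edges K. e \<subseteq> verts K)"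

definition induced_subgraph :: "'a graph \<Rightarrow> 'a set \<Rightarrow> 'a graph" where
  "induced_subgraph G X = \<lparr>verts = X, edges = {e \<in> edges G. e \<subseteq> X}\<rparr>"

definition graph_inter :: "'a graph \<Rightarrow> 'a graph \<Rightarrow> 'a graph" where
  "graph_inter G H = \<lparr>verts = verts G \<inter> verts H, edges = edges G \<inter> edges H\<rparr>"

definition graph_union :: "'a graph \<Rightarrow> 'a graph \<Rightarrow> 'a graph" where
  "graph_union G H = \<lparr>verts = verts G \<union> verts H, edges = edges G \<union> edges H\<rparr>"

definition edge_disjoint :: "'a graph \<Rightarrow> 'a graph \<Rightarrow> bool" where
  "edge_disjoint G H \<longleftrightarrow> edges G \<inter> edges H = {}"

definition connected_graph :: "'a graph \<Rightarrow> bool" where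
  "connected_graph G \<longleftrightarrow>
     (\<forall>u\<in>verts G. \<forall>v\<in>verts G. (u, v) \<in> {(x, y). {x, y} \<in> edges G}\<^sup>*)"

definition bipartite :: "'a graph \<Rightarrow> bool" where
  "bipartite G \<longleftrightarrow> (\<exists>A B. A \<inter> B = {} \<and> A \<union> B = verts G \<and>
     (\<forall>e\<in>edges G. e \<inter> A \<noteq> {} \<and> e \<inter> B \<noteq> {}))"

definition is_cycle_edge_set :: "'a graph \<Rightarrow> 'a set set \<Rightarrow> bool" where
  "is_cycle_edge_set G C \<longleftrightarrow> C \<subseteq> edges G \<and>
     (\<exists>vs. distinct vs \<and> length vs \<ge> 3 \<and>
        C = {{vs ! i, vs ! (Suc i mod length vs)} | i. i < length vs})"

definition K2 :: "bool graph" where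
  "K2 = \<lparr>verts = {False, True}, edges = {{False, True}}\<rparr>"

definition perfect_matching :: "'a graph \<Rightarrow> 'a set set \<Rightarrow> bool" where
  "perfect_matching G M \<longleftrightarrow> M \<subseteq> edges G \<and> (\<forall>v\<in>verts G. \<exists>!e. e \<in> M \<and> v \<in> e)"

definition allowed_edges :: "'a graph \<Rightarrow> 'a set set" where
  "allowed_edges G = {e. \<exists>M. perfect_matching G M \<and> e \<in> M}"

definition elementary :: "'a graph \<Rightarrow> bool" where
  "elementary G \<longleftrightarrow> (\<exists>M. perfect_matching G M) \<and>
     connected_graph \<lparr>verts = \<Union>(allowed_edges G), edges = allowed_edges G\<rparr>"

text \<open>The vertices of a plane graph are points of the plane, and \<open>\<gamma> e\<close> is the Jordan arc
  that draws the edge \<open>e\<close>. The interior of an arc contains neither a vertex nor a point of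
  another arc.\<close>

definition plane_graph :: "complex graph \<Rightarrow> (complex set \<Rightarrow> real \<Rightarrow> complex) \<Rightarrow> bool" where
  "plane_graph G \<gamma> \<longleftrightarrow> simple_graph G \<and>
     (\<forall>e\<in>edges G. arc (\<gamma> e) \<and> {pathstart (\<gamma> e), pathfinish (\<gamma> e)} = e \<and>
        path_image (\<gamma> e) \<inter> verts G = e) \<and>
     (\<forall>e\<in>edges G. \<forall>f\<in>edges G. e \<noteq> f \<longrightarrow> path_image (\<gamma> e) \<inter> path_image (\<gamma> f) = e \<inter> f)"

definition drawing :: "complex graph \<Rightarrow> (complex set \<Rightarrow> real \<Rightarrow> complex) \<Rightarrow> complex set" where
  "drawing G \<gamma> = verts G \<union> (\<Union>e\<in>edges G. path_image (\<gamma> e))"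

definition finite_faces ::
    "complex graph \<Rightarrow> (complex set \<Rightarrow> real \<Rightarrow> complex) \<Rightarrow> complex set set" where
  "finite_faces G \<gamma> = {F \<in> components (- drawing G \<gamma>). bounded F}"

definition is_periphery ::
    "(complex set \<Rightarrow> real \<Rightarrow> complex) \<Rightarrow> complex set set \<Rightarrow> complex set \<Rightarrow> bool" where
  "is_periphery \<gamma> C F \<longleftrightarrow> (\<Union>e\<in>C. path_image (\<gamma> e)) = frontier F"

definition resonance_graph ::
    "complex graph \<Rightarrow> (complex set \<Rightarrow> real \<Rightarrow> complex) \<Rightarrow> complex set set graph" where
  "resonance_graph G \<gamma> =
     \<lparr>verts = {M. perfect_matching G M},
      edges = {{M, N} | M N. perfect_matching G M \<and> perfect_matching G N \<and>
        is_cycle_edge_set G (sym_diff M N) \<and>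
        (\<exists>F\<in>finite_faces G \<gamma>. is_periphery \<gamma> (sym_diff M N) F)}\<rparr>"

definition binary_strings :: "nat \<Rightarrow> bool list set" where
  "binary_strings n = {s. length s = n}"

definition string_le :: "bool list \<Rightarrow> bool list \<Rightarrow> bool" where
  "string_le = list_all2 (\<le>)"

definition zero_string :: "nat \<Rightarrow> bool list" where
  "zero_string n = replicate n False"

definition hypercube :: "nat \<Rightarrow> bool list graph" where
  "hypercube n =
     \<lparr>verts = binary_strings n,
      edges = {{s, t} | s t. s \<in> binary_strings n \<and> t \<in> binary_strings n \<and>
        card {i. i < n \<and> s ! i \<noteq> t ! i} = 1}\<rparr>"

text \<open>The vertex set is required to be nonempty, since a daisy cube has a minimum vertex.\<close>

definition daisy_cube :: "nat \<Rightarrow> bool list graph \<Rightarrow> bool" where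
  "daisy_cube n H \<longleftrightarrow> (\<exists>X. X \<subseteq> binary_strings n \<and> X \<noteq> {} \<and>
     (\<forall>x\<in>X. \<forall>y\<in>binary_strings n. string_le y x \<longrightarrow> y \<in> X) \<and>
     H = induced_subgraph (hypercube n) X)"

definition maximal_vertices :: "bool list graph \<Rightarrow> bool list set" where
  "maximal_vertices H = {x \<in> verts H. \<forall>y\<in>verts H. string_le x y \<longrightarrow> y = x}"

definition has_dim :: "'a graph \<Rightarrow> nat \<Rightarrow> bool" where
  "has_dim K k \<longleftrightarrow> isomorphic K (hypercube k)"

definition hypercube_of :: "'a graph \<Rightarrow> 'a graph \<Rightarrow> bool" where
  "hypercube_of H K \<longleftrightarrow> subgraph K H \<and> (\<exists>k. has_dim K k)"

definition maximal_hypercube :: "'a graph \<Rightarrow> 'a graph \<Rightarrow> bool" where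
  "maximal_hypercube H K \<longleftrightarrow> hypercube_of H K \<and>
     (\<forall>L. hypercube_of H L \<and> subgraph K L \<longrightarrow> L = K)"

definition maximal_hypercubes_are :: "'a graph \<Rightarrow> 'a graph list \<Rightarrow> bool" where
  "maximal_hypercubes_are H Ks \<longleftrightarrow> distinct Ks \<and> set Ks = {K. maximal_hypercube H K}"

definition only_common_vertex :: "'a graph list \<Rightarrow> 'a \<Rightarrow> bool" where
  "only_common_vertex Ks v \<longleftrightarrow> (\<Inter>K\<in>set Ks. verts K) = {v}"

definition meet_in_dim :: "'a graph \<Rightarrow> 'a graph \<Rightarrow> nat \<Rightarrow> bool" where
  "meet_in_dim A B k \<longleftrightarrow> has_dim (graph_inter A B) k"

definition meet_in_edge :: "'a graph \<Rightarrow> 'a graph \<Rightarrow> bool" where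
  "meet_in_edge A B \<longleftrightarrow> isomorphic (graph_inter A B) K2"

definition structure1 :: "bool list graph \<Rightarrow> bool" where
  "structure1 H \<longleftrightarrow> isomorphic H K2"

definition structure2 :: "nat \<Rightarrow> bool list graph \<Rightarrow> bool" where
  "structure2 n H \<longleftrightarrow> n \<ge> 2 \<and>
     (\<exists>A B. subgraph A H \<and> subgraph B H \<and> H = graph_union A B \<and>
        isomorphic A K2 \<and> isomorphic B (hypercube (n - 1)) \<and>
        edge_disjoint A B \<and> only_common_vertex [A, B] (zero_string n))"

definition structure3 :: "nat \<Rightarrow> bool list graph \<Rightarrow> bool" where
  "structure3 n H \<longleftrightarrow> (\<exists>A B C.
     maximal_hypercubes_are H [A, B, C] \<and> only_common_vertex [A, B, C] (zero_string n) \<and>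
     (\<exists>p q. p \<ge> 1 \<and> q \<ge> 1 \<and> p + q + 2 = n \<and>
        has_dim A (p + 1) \<and> has_dim B (p + q) \<and> has_dim C (q + 1) \<and>
        edge_disjoint A C \<and>
        meet_in_dim A B p \<and> meet_in_dim B C q))"

definition structure4 :: "nat \<Rightarrow> bool list graph \<Rightarrow> bool" where
  "structure4 n H \<longleftrightarrow> (\<exists>A B C D.
     maximal_hypercubes_are H [A, B, C, D] \<and>
     only_common_vertex [A, B, C, D] (zero_string n) \<and>
     (\<exists>p q. p \<ge> 1 \<and> q \<ge> 1 \<and> p + q + 3 = n \<and>
        has_dim A (p + 1) \<and> has_dim B (p + q + 1) \<and> has_dim C (q + 1) \<and> has_dim D 2 \<and>
        edge_disjoint A C \<and> edge_disjoint B D \<and>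
        meet_in_dim A B p \<and> meet_in_dim B C q \<and>
        meet_in_edge A D \<and> meet_in_edge C D))"

definition structure5 :: "nat \<Rightarrow> bool list graph \<Rightarrow> bool" where
  "structure5 n H \<longleftrightarrow> (\<exists>A B C D E.
     maximal_hypercubes_are H [A, B, C, D, E] \<and>
     only_common_vertex [A, B, C, D, E] (zero_string n) \<and>
     (\<exists>p q. p \<ge> 1 \<and> q \<ge> 1 \<and> p + q + 4 = n \<and>
        has_dim A (p + q + 1) \<and> has_dim B (p + q + 1) \<and>
        has_dim C (p + 2) \<and> has_dim D (q + 2) \<and> has_dim E 2 \<and>
        edge_disjoint C D \<and> edge_disjoint E A \<and> edge_disjoint E B \<and>
        meet_in_dim A B (p + q) \<and> meet_in_dim A C (p + 1) \<and> meet_in_dim A D q \<and>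
        meet_in_dim B C p \<and> meet_in_dim B D (q + 1) \<and>
        meet_in_edge C E \<and> meet_in_edge D E))"

definition structure6 :: "nat \<Rightarrow> bool list graph \<Rightarrow> bool" where
  "structure6 n H \<longleftrightarrow> (\<exists>A B C D E.
     maximal_hypercubes_are H [A, B, C, D, E] \<and>
     only_common_vertex [A, B, C, D, E] (zero_string n) \<and>
     (\<exists>p q r. p \<ge> 1 \<and> q \<ge> 1 \<and> r \<ge> 1 \<and> p + q + r + 3 = n \<and>
        has_dim A (p + q + r) \<and> has_dim B (p + r + 1) \<and> has_dim C (p + q + 1) \<and>
        has_dim D (q + r + 1) \<and> has_dim E (r + 2) \<and>
        edge_disjoint C E \<and>
        meet_in_dim A B (p + r) \<and> meet_in_dim A C (p + q) \<and> meet_in_dim A D (q + r) \<and>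
        meet_in_dim A E r \<and> meet_in_dim B C p \<and> meet_in_dim B D r \<and> meet_in_dim C D q \<and>
        meet_in_dim B E (r + 1) \<and> meet_in_dim D E (r + 1)))"

definition exactly_one :: "bool list \<Rightarrow> bool" where
  "exactly_one Ps \<longleftrightarrow> (\<exists>!i. i < length Ps \<and> Ps ! i)"

end

theory Submission
  imports Defs "HOL-Complex_Analysis.Riemann_Mapping"
begin

text \<open>A perfect matching is described by how often its edges, directed from one colour class to
  the other, turn around a point \<open>z\<close> off the drawing. Flipping a bounded face \<open>F\<close> changes this
  turning number by \<open>1\<close> or \<open>-1\<close> if \<open>z\<close> lies in \<open>F\<close> and not at all otherwise, because the
  periphery of \<open>F\<close> is a Jordan curve with inside \<open>F\<close>. Turning numbers therefore show which faces
  have been flipped. In particular opposite edges of a square of the resonance graph flip the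
  same face (\<open>resonance_square\<close>), so that every coordinate of the daisy cube belongs to one
  face, and a set of coordinates is a vertex exactly if the corresponding cycles, all
  alternating in the matching at the minimum vertex, are pairwise disjoint (\<open>member_iff\<close>).

  Every bounded face occurs. Otherwise some point \<open>z\<close> of a bounded face sees the same turning
  number for all perfect matchings. As the graph is elementary, the turning numbers of the edges
  are then differences of a potential on the vertices (\<open>constant_turn_potential\<close>), which glues
  the logarithms of \<open>x - z\<close> along the edges to a logarithm on the whole drawing. Borsuk's
  theorem excludes this (\<open>no_potential_in_bounded_face\<close>). Hence the \<open>n\<close> coordinates correspond
  to the \<open>n\<close> bounded faces.

  Call two faces touching if their cycles meet. Touching faces are flipped in opposite senses,
  as their symmetric difference is again a single cycle, whose winding numbers have one sign
  (\<open>touch_opposite\<close>); so at most two of the cycles pass through a vertex. A weight on the edges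
  that is balanced on the \<open>n\<close> cycles is a potential difference, which bounds the number of edges
  by linear algebra (\<open>card_arcs\<close>). Every touching pair needs an edge of its own beyond a
  spanning set, so there are at most \<open>n - 1\<close> touching pairs. The touching relation is connected
  because the graph is, hence it is a tree (\<open>touch_tree\<close>).

  The daisy cube is thus the complex of independent sets of a tree on \<open>n\<close> vertices; its maximal
  vertices are the maximal independent sets, and its maximal hypercubes are the cubes below
  them. A tree with at most five maximal independent sets contains neither a path with seven
  vertices nor a long claw nor a path with six vertices and a further neighbour at the third. If it
  has at least three vertices, those of degree at least two therefore form one vertex, an edge, a
  path of three, or a path of four whose two middle vertices carry no leaf (\<open>few_max_indep_cases\<close>). Listing the maximal
  independent sets in these cases gives the structures; the path of three splits according to
  whether its middle vertex carries a leaf. The structures exclude each other by the number and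
  dimension of the maximal hypercubes and by the number of edge disjoint pairs.\<close>

section \<open>Potentials on digraphs\<close>

text \<open>Gaussian elimination: one equation is solved for one unknown and substituted into the
  others.\<close>

lemma underdetermined_system:
  fixes c :: "'j \<Rightarrow> 'i \<Rightarrow> 'a::field"
  assumes "finite J" "finite I" "card J < card I"
  shows "\<exists>x. (\<exists>i\<in>I. x i \<noteq> 0) \<and> (\<forall>j\<in>J. (\<Sum>i\<in>I. c j i * x i) = 0)"
  using assms
proof (induction J arbitrary: I c rule: finite_induct)
  case empty
  then have "I \<noteq> {}" by auto
  then show ?case by (intro exI[of _ "\<lambda>_. 1"]) auto
next
  case (insert j J)
  show ?case
  proof (cases "\<forall>i\<in>I. c j i = 0")
    case True
    have "card J < card I" using insert by simp
    then obtain x where "\<exists>i\<in>I. x i \<noteq> 0" "\<forall>j\<in>J. (\<Sum>i\<in>I. c j i * x i) = 0"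
      using insert.IH[OF insert.prems(1)] by blast
    then show ?thesis using True by (intro exI[of _ x]) simp
  next
    case False
    then obtain k where k: "k \<in> I" "c j k \<noteq> 0" by blast
    let ?I = "I - {k}"
    have "card J < card ?I" using insert k(1) by simp
    then obtain x where x: "\<exists>i\<in>?I. x i \<noteq> 0"
      "\<forall>l\<in>J. (\<Sum>i\<in>?I. (c l i - c l k * c j i / c j k) * x i) = 0"
      using insert.IH[of ?I "\<lambda>l i. c l i - c l k * c j i / c j k"] insert.prems(1) by blast
    define s where "s = (\<Sum>i\<in>?I. c j i * x i)"
    define y where "y = x(k := - s / c j k)"
    have sum_y: "(\<Sum>i\<in>I. c l i * y i) = c l k * (- s / c j k) + (\<Sum>i\<in>?I. c l i * x i)" for l
    proof -
      have "(\<Sum>i\<in>I. c l i * y i) = c l k * y k + (\<Sum>i\<in>?I. c l i * y i)"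
        using insert.prems(1) k(1) by (rule sum.remove)
      also have "(\<Sum>i\<in>?I. c l i * y i) = (\<Sum>i\<in>?I. c l i * x i)"
        by (rule sum.cong) (auto simp: y_def)
      finally show ?thesis by (simp add: y_def)
    qed
    have "(\<Sum>i\<in>I. c l i * y i) = 0" if l: "l \<in> insert j J" for l
    proof (cases "l = j")
      case True
      then show ?thesis using sum_y[of j] k(2) by (simp add: s_def)
    next
      case False
      have "(\<Sum>i\<in>?I. (c l i - c l k * c j i / c j k) * x i) =
          (\<Sum>i\<in>?I. c l i * x i) - (\<Sum>i\<in>?I. c l k / c j k * (c j i * x i))"
        unfolding sum_subtractf[symmetric] by (rule sum.cong) (auto simp: algebra_simps)
      also have "(\<Sum>i\<in>?I. c l k / c j k * (c j i * x i)) = c l k / c j k * s"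
        unfolding s_def by (rule sum_distrib_left[symmetric])
      finally show ?thesis using sum_y[of l] x(2) l False by simp
    qed
    moreover have "\<exists>i\<in>I. y i \<noteq> 0" using x(1) by (auto simp: y_def)
    ultimately show ?thesis by blast
  qed
qed

text \<open>The weight is an index of the predicate, so that a potential can be chosen as the weight
  of some walk from a root.\<close>

inductive weighted_walk :: "('a \<times> 'a) set \<Rightarrow> ('a \<Rightarrow> 'a \<Rightarrow> 'b::ab_group_add) \<Rightarrow> 'a \<Rightarrow> 'a \<Rightarrow> 'b \<Rightarrow> bool"
  for D d where
  stay: "weighted_walk D d a a 0"
| step: "weighted_walk D d a b w \<Longrightarrow> (b, c) \<in> D \<Longrightarrow> weighted_walk D d a c (w + d b c)"

lemma weighted_walk_trans:
  "weighted_walk D d b c v \<Longrightarrow> weighted_walk D d a b w \<Longrightarrow> weighted_walk D d a c (w + v)"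
proof (induction rule: weighted_walk.induct)
  case (step b c v c')
  then show ?case using weighted_walk.step[of D d a c "w + v" c'] by (simp add: add.assoc)
qed simp

lemma weighted_walk_exists: "(a, b) \<in> D\<^sup>* \<Longrightarrow> \<exists>w. weighted_walk D d a b w"
  by (induction rule: rtrancl_induct) (auto intro: weighted_walk.intros)

text \<open>Walks as lists of vertices can be cut at a repeated vertex.\<close>

fun list_weight :: "('a \<Rightarrow> 'a \<Rightarrow> 'b::ab_group_add) \<Rightarrow> 'a list \<Rightarrow> 'b" where
  "list_weight d (x # y # zs) = d x y + list_weight d (y # zs)"
| "list_weight d xs = 0"

lemma list_weight_append:
  "xs \<noteq> [] \<Longrightarrow> ys \<noteq> [] \<Longrightarrow>
    list_weight d (xs @ ys) = list_weight d xs + d (last xs) (hd ys) + list_weight d ys"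
proof (induction d xs rule: list_weight.induct)
  case ("2_2" d v)
  then show ?case by (cases ys) auto
qed (auto simp: add.assoc)

lemma list_weight_sum: "list_weight d xs = (\<Sum>i<length xs - 1. d (xs ! i) (xs ! Suc i))"
proof (induction d xs rule: list_weight.induct)
  case (1 d x y zs)
  have "(\<Sum>i<length (x # y # zs) - 1. d ((x # y # zs) ! i) ((x # y # zs) ! Suc i)) =
    d x y + (\<Sum>i<length (y # zs) - 1. d ((y # zs) ! i) ((y # zs) ! Suc i))"
    using sum.lessThan_Suc_shift[of "\<lambda>i. d ((x # y # zs) ! i) ((x # y # zs) ! Suc i)" "length zs"]
      by simp
  then show ?case using 1 by simp
qed auto

lemma weighted_walk_list:
  assumes "weighted_walk D d a b w"
  shows "\<exists>xs. successively (\<lambda>x y. (x, y) \<in> D) (xs @ [b]) \<and> hd (xs @ [b]) = a \<and>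
    w = list_weight d (xs @ [b])"
  using assms
proof (induction rule: weighted_walk.induct)
  case (stay a)
  show ?case by (intro exI[of _ "[]"]) simp
next
  case (step a b w c)
  then obtain xs where xs: "successively (\<lambda>x y. (x, y) \<in> D) (xs @ [b])" "hd (xs @ [b]) = a"
    "w = list_weight d (xs @ [b])" by blast
  have "successively (\<lambda>x y. (x, y) \<in> D) ((xs @ [b]) @ [c])"
    using xs(1) step.hyps(2) by (simp only: successively_append_iff) simp
  moreover have "hd ((xs @ [b]) @ [c]) = a" using xs(2) by (cases xs) simp_all
  moreover have "w + d b c = list_weight d ((xs @ [b]) @ [c])"
    using list_weight_append[of "xs @ [b]" "[c]" d] xs(3) by simp
  ultimately show ?case by blast
qed

text \<open>A permutation that moves points only along arcs is a union of disjoint directed cycles. In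
  a bipartite graph with a fixed perfect matching contracted, these permutations are the perfect
  matchings.\<close>

locale balanced_digraph =
  fixes A :: "'a set" and D :: "('a \<times> 'a) set" and d :: "'a \<Rightarrow> 'a \<Rightarrow> 'b::ab_group_add"
  assumes finite_A: "finite A" and D_sub: "D \<subseteq> A \<times> A" and loops: "\<And>a. d a a = 0"
    and strong: "\<And>a b. a \<in> A \<Longrightarrow> b \<in> A \<Longrightarrow> (a, b) \<in> D\<^sup>*"
    and balanced: "\<And>p. bij_betw p A A \<Longrightarrow> (\<And>a. a \<in> A \<Longrightarrow> p a \<noteq> a \<Longrightarrow> (a, p a) \<in> D) \<Longrightarrow>
      (\<Sum>a\<in>A. d a (p a)) = 0"
begin

text \<open>The permutation that shifts along the walk and fixes all other points is balanced.\<close>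

lemma simple_closed_walk_weight:
  assumes "distinct xs" "xs \<noteq> []" "successively (\<lambda>x y. (x, y) \<in> D) xs" "(last xs, hd xs) \<in> D"
  shows "list_weight d xs + d (last xs) (hd xs) = 0"
proof -
  let ?n = "length xs"
  have n: "?n > 0" using assms(2) by simp
  have arc: "(xs ! i, xs ! (Suc i mod ?n)) \<in> D" if "i < ?n" for i
  proof (cases "Suc i = ?n")
    case True
    then have "xs ! i = last xs" using assms(2) by (metis diff_Suc_1 last_conv_nth)
    then show ?thesis using assms(4) True assms(2) hd_conv_nth[of xs] by simp
  next
    case False
    then have "Suc i < ?n" using that by simp
    then show ?thesis using assms(3) by (simp add: successively_conv_nth)
  qed
  have inj: "inj_on (nth xs) {..<?n}" using inj_on_nth[OF assms(1)] by blast
  define idx where "idx = the_inv_into {..<?n} (nth xs)"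
  define p where "p a = (if a \<in> set xs then xs ! (Suc (idx a) mod ?n) else a)" for a
  have p_nth: "p (xs ! i) = xs ! (Suc i mod ?n)" if "i < ?n" for i
    using that the_inv_into_f_f[OF inj] by (simp add: p_def idx_def)
  have setA: "set xs \<subseteq> A"
  proof
    fix a assume "a \<in> set xs"
    then obtain i where i: "i < ?n" "a = xs ! i" by (metis in_set_conv_nth)
    show "a \<in> A" using arc[OF i(1)] D_sub i(2) by blast
  qed
  have "inj_on p A"
  proof (rule inj_onI)
    fix a b assume ab: "a \<in> A" "b \<in> A" "p a = p b"
    have in_set: "p c \<in> set xs \<longleftrightarrow> c \<in> set xs" for c using n by (auto simp: p_def)
    show "a = b"
    proof (cases "a \<in> set xs")
      case True
      then have "b \<in> set xs" using in_set ab(3) by metis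
      then obtain i j where ij: "i < ?n" "j < ?n" "a = xs ! i" "b = xs ! j"
        using True by (metis in_set_conv_nth)
      then have "Suc i mod ?n = Suc j mod ?n"
        using ab(3) p_nth inj_onD[OF inj, of "Suc i mod ?n" "Suc j mod ?n"] n by simp
      then have "i = j" using ij(1,2) by (auto simp: mod_Suc split: if_splits)
      then show ?thesis using ij by simp
    next
      case False
      then have "b \<notin> set xs" using in_set ab(3) by metis
      then show ?thesis using False ab(3) by (simp add: p_def)
    qed
  qed
  moreover have "p ` A \<subseteq> A" using setA n by (auto simp: p_def)
  ultimately have bij: "bij_betw p A A"
    using endo_inj_surj[OF finite_A] by (simp add: bij_betw_def)
  have "(a, p a) \<in> D" if "p a \<noteq> a" for a
  proof -
    have "a \<in> set xs"
    proof (rule ccontr)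
      assume "a \<notin> set xs"
      then have "p a = a" by (simp add: p_def)
      with that show False ..
    qed
    then obtain i where "i < ?n" "a = xs ! i" by (metis in_set_conv_nth)
    then show ?thesis using arc p_nth by simp
  qed
  then have "0 = (\<Sum>a\<in>A. d a (p a))" using balanced[OF bij] by simp
  also have "\<dots> = (\<Sum>a\<in>set xs. d a (p a))"
    using finite_A setA loops by (intro sum.mono_neutral_right) (auto simp: p_def)
  also have "\<dots> = (\<Sum>i<?n. d (xs ! i) (p (xs ! i)))"
    using sum.reindex[OF inj, of "\<lambda>a. d a (p a)"] nth_image[of ?n xs] by (simp add: lessThan_atLeast0)
  also have "\<dots> = (\<Sum>i<?n. d (xs ! i) (xs ! (Suc i mod ?n)))"
    using p_nth by (intro sum.cong) auto
  also have "\<dots> = (\<Sum>i<?n - 1. d (xs ! i) (xs ! (Suc i mod ?n))) + d (xs ! (?n - 1)) (xs ! (Suc (?n -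
    1) mod ?n))"
    using sum.lessThan_Suc[of "\<lambda>i. d (xs ! i) (xs ! (Suc i mod ?n))" "?n - 1"] unfolding
      Suc_diff_1[OF n] .
  also have "\<dots> = list_weight d xs + d (last xs) (hd xs)"
  proof -
    have "(\<Sum>i<?n - 1. d (xs ! i) (xs ! (Suc i mod ?n))) = list_weight d xs"
      unfolding list_weight_sum by (rule sum.cong) auto
    moreover have "xs ! (?n - 1) = last xs" "xs ! (Suc (?n - 1) mod ?n) = hd xs"
      using last_conv_nth[OF assms(2)] hd_conv_nth[OF assms(2)] n by auto
    ultimately show ?thesis by simp
  qed
  finally show ?thesis ..
qed

text \<open>A repeated vertex cuts a closed walk into two shorter closed walks.\<close>

lemma closed_walk_weight:
  assumes "xs \<noteq> []" "successively (\<lambda>x y. (x, y) \<in> D) xs" "(last xs, hd xs) \<in> D"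
  shows "list_weight d xs + d (last xs) (hd xs) = 0"
  using assms
proof (induction xs rule: length_induct)
  case (1 xs)
  show ?case
  proof (cases "distinct xs")
    case True
    then show ?thesis using simple_closed_walk_weight 1 by blast
  next
    case False
    then obtain p y q r where xs: "xs = p @ [y] @ q @ [y] @ r"
      using not_distinct_decomp by blast
    let ?u = "y # q" and ?v = "p @ y # r"
    have xs': "xs = p @ ?u @ y # r" using xs by simp
    have s1: "successively (\<lambda>x y. (x, y) \<in> D) ?u" "(last ?u, y) \<in> D"
      and s2: "successively (\<lambda>x y. (x, y) \<in> D) ?v"
      using "1.prems"(2) unfolding xs' by (auto simp only: successively_append_iff hd_append
        list.sel split: if_splits)
    have hl: "hd ?v = hd xs" "last ?v = last xs" unfolding xs by (cases p; simp)+
    have "list_weight d ?u + d (last ?u) y = 0"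
      using "1.IH"[rule_format, of ?u] s1 unfolding xs by simp
    moreover have "list_weight d ?v + d (last xs) (hd xs) = 0"
      using "1.IH"[rule_format, of ?v] s2 "1.prems"(3) hl unfolding xs by simp
    moreover have "list_weight d xs = list_weight d ?v + (list_weight d ?u + d (last ?u) y)"
    proof (cases "p = []")
      case True
      then show ?thesis
        using list_weight_append[of ?u "y # r" d] unfolding xs by (simp add: algebra_simps)
    next
      case False
      then show ?thesis
        using list_weight_append[of p "?u @ y # r" d] list_weight_append[of ?u "y # r" d]
          list_weight_append[of p "y # r" d] unfolding xs by (simp add: algebra_simps)
    qed
    ultimately show ?thesis by simp
  qed
qed

lemma closed_weighted_walk: "weighted_walk D d a a w \<Longrightarrow> w = 0"
proof -
  assume "weighted_walk D d a a w"
  then obtain xs where xs: "successively (\<lambda>x y. (x, y) \<in> D) (xs @ [a])" "hd (xs @ [a]) = a"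
    "w = list_weight d (xs @ [a])"
    using weighted_walk_list by metis
  show "w = 0"
  proof (cases "xs = []")
    case False
    then have "hd xs = a" "(last xs, a) \<in> D" "successively (\<lambda>x y. (x, y) \<in> D) xs"
      using xs by (auto simp: successively_append_iff)
    then show ?thesis
      using closed_walk_weight[OF False] list_weight_append[OF False, of "[a]" d] xs(3) by simp
  qed (use xs in simp)
qed

text \<open>By strong connectivity every walk can be closed up. So the weight of a walk from a fixed
  root depends only on its end.\<close>

theorem potential_exists: "\<exists>\<phi>. \<forall>(a, b)\<in>D. d a b = \<phi> b - \<phi> a"
proof (cases "A = {}")
  case False
  then obtain r where r: "r \<in> A" by blast
  define \<phi> where "\<phi> a = (SOME w. weighted_walk D d r a w)" for a
  have \<phi>: "weighted_walk D d r a (\<phi> a)" if "a \<in> A" for a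
    unfolding \<phi>_def using someI_ex[OF weighted_walk_exists[OF strong[OF r that]]] .
  have "d a b = \<phi> b - \<phi> a" if ab: "(a, b) \<in> D" for a b
  proof -
    have A: "a \<in> A" "b \<in> A" using ab D_sub by auto
    obtain v where v: "weighted_walk D d b r v" using weighted_walk_exists[OF strong[OF A(2) r]] by
      blast
    have "weighted_walk D d r b (\<phi> a + d a b)"
      using weighted_walk.step[OF \<phi>[OF A(1)] ab] .
    then have "\<phi> a + d a b + v = 0" using closed_weighted_walk weighted_walk_trans[OF v] by blast
    moreover have "\<phi> b + v = 0" using closed_weighted_walk weighted_walk_trans[OF v \<phi>[OF A(2)]] by
      blast
    ultimately show ?thesis by (metis add_diff_cancel_left' add_right_cancel)
  qed
  then show ?thesis by blast
qed (use D_sub in auto)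

end

text \<open>If balance on the cycles of a family \<open>p\<close> already forces a weight to be a potential
  difference, then the weights that are balanced on the family and orthogonal to all potential
  differences vanish. Counting equations bounds the number of arcs.\<close>

lemma card_arcs_less:
  fixes p :: "'i \<Rightarrow> 'a \<Rightarrow> 'a"
  assumes fin: "finite A" "A \<noteq> {}" "finite I" and D: "D \<subseteq> A \<times> A" "\<And>a. (a, a) \<notin> D"
    and pot: "\<And>d :: 'a \<Rightarrow> 'a \<Rightarrow> real. (\<And>a. d a a = 0) \<Longrightarrow> (\<And>i. i \<in> I \<Longrightarrow> (\<Sum>a\<in>A. d a (p i a)) = 0) \<Longrightarrow>
      \<exists>\<phi>. \<forall>(a, b)\<in>D. d a b = \<phi> b - \<phi> a"
  shows "card D < card I + card A"
proof (rule ccontr)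
  assume "\<not> card D < card I + card A"
  then have big: "card I + card A \<le> card D" by simp
  obtain r where r: "r \<in> A" using fin(2) by blast
  have finD: "finite D" using fin(1) D(1) finite_subset by blast
  \<comment> \<open>The orthogonality at the root follows from that at the other vertices.\<close>
  define J where "J = Inl ` I \<union> Inr ` (A - {r})"
  define c :: "'i + 'a \<Rightarrow> 'a \<times> 'a \<Rightarrow> real" where
    "c j e = (case j of Inl i \<Rightarrow> of_bool (p i (fst e) = snd e)
                      | Inr v \<Rightarrow> of_bool (snd e = v) - of_bool (fst e = v))" for j e
  have "card J = card I + (card A - 1)"
    unfolding J_def using fin r by (subst card_Un_disjoint) (auto simp: card_image)
  then have "card J < card D"
    using big r fin(1) by (metis add_less_cancel_left card_gt_0_iff diff_less empty_iff
      less_le_trans zero_less_one)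
  moreover have "finite J" using fin by (simp add: J_def)
  ultimately obtain x where x: "\<exists>e\<in>D. x e \<noteq> 0" "\<And>j. j \<in> J \<Longrightarrow> (\<Sum>e\<in>D. c j e * x e) = 0"
    using underdetermined_system[OF _ finD, of J c] by blast
  define d where "d a b = (if (a, b) \<in> D then x (a, b) else 0)" for a b
  have "(\<Sum>a\<in>A. d a (p i a)) = 0" if i: "i \<in> I" for i
  proof -
    have "0 = (\<Sum>e\<in>D. c (Inl i) e * x e)" using x(2)[of "Inl i"] i by (simp add: J_def)
    also have "\<dots> = (\<Sum>e\<in>A \<times> A. if e \<in> D \<and> p i (fst e) = snd e then x e else 0)"
      using fin(1) D(1) by (intro sum.mono_neutral_cong_left) (auto simp: c_def)
    also have "\<dots> = (\<Sum>a\<in>A. \<Sum>b\<in>A. if b = p i a then d a b else 0)"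
      unfolding sum.cartesian_product by (rule sum.cong) (auto simp: d_def)
    also have "\<dots> = (\<Sum>a\<in>A. d a (p i a))"
      using fin(1) D(1) by (intro sum.cong) (auto simp: sum.delta d_def)
    finally show ?thesis ..
  qed
  moreover have "d a a = 0" for a using D(2) by (simp add: d_def)
  ultimately obtain \<phi> where \<phi>: "\<forall>(a, b)\<in>D. d a b = \<phi> b - \<phi> a" using pot[of d] by blast
  define \<psi> where "\<psi> v = \<phi> v - \<phi> r" for v
  have x_eq: "x e = \<psi> (snd e) - \<psi> (fst e)" if "e \<in> D" for e
    using \<phi> that by (cases e) (auto simp: d_def \<psi>_def)
  have "(\<Sum>e\<in>D. x e * x e) = (\<Sum>e\<in>D. \<Sum>v\<in>A. \<psi> v * (c (Inr v) e * x e))"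
  proof (rule sum.cong)
    fix e assume e: "e \<in> D"
    then have "fst e \<in> A" "snd e \<in> A" using D(1) by auto
    moreover have "(\<Sum>v\<in>A. \<psi> v * (of_bool (snd e = v) - of_bool (fst e = v))) =
        (\<Sum>v\<in>A. (if snd e = v then \<psi> v else 0) - (if fst e = v then \<psi> v else 0))"
      by (rule sum.cong) auto
    ultimately have "(\<Sum>v\<in>A. \<psi> v * (of_bool (snd e = v) - of_bool (fst e = v))) = \<psi> (snd e) - \<psi> (fst
      e)"
      using fin(1) by (simp add: sum_subtractf sum.delta')
    then have "x e * x e = (\<Sum>v\<in>A. \<psi> v * (of_bool (snd e = v) - of_bool (fst e = v))) * x e"
      using x_eq[OF e] by simp
    then show "x e * x e = (\<Sum>v\<in>A. \<psi> v * (c (Inr v) e * x e))"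
      unfolding sum_distrib_right by (simp add: c_def mult.assoc)
  qed simp
  also have "\<dots> = (\<Sum>v\<in>A. \<psi> v * (\<Sum>e\<in>D. c (Inr v) e * x e))"
    by (subst sum.swap) (simp add: sum_distrib_left)
  also have "\<dots> = 0"
  proof (rule sum.neutral, rule ballI)
    fix v assume "v \<in> A"
    then show "\<psi> v * (\<Sum>e\<in>D. c (Inr v) e * x e) = 0"
      using x(2)[of "Inr v"] by (cases "v = r") (auto simp: J_def \<psi>_def)
  qed
  finally have "\<forall>e\<in>D. x e * x e = 0" using finD by (simp add: sum_nonneg_eq_0_iff)
  then show False using x(1) by auto
qed

section \<open>Cycles of a plane graph and winding numbers\<close>

locale plane_drawing =
  fixes G :: "complex graph" and \<gamma> :: "complex set \<Rightarrow> real \<Rightarrow> complex"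
  assumes plane: "plane_graph G \<gamma>"
begin

definition edge_path :: "complex \<Rightarrow> complex \<Rightarrow> real \<Rightarrow> complex" where
  "edge_path u v = (if pathstart (\<gamma> {u, v}) = u then \<gamma> {u, v} else reversepath (\<gamma> {u, v}))"

text \<open>The winding number of an open arc is a change of logarithm, divided by \<open>2 * pi * \<i>\<close>. It is
  additive along walks and reversed with the direction of the arc.\<close>

definition turn :: "complex \<Rightarrow> complex \<Rightarrow> complex \<Rightarrow> complex" where
  "turn z u v = winding_number (edge_path u v) z"

lemma finite_verts: "finite (verts G)"
  using plane by (simp add: plane_graph_def simple_graph_def)

lemma edge_subset: "e \<in> edges G \<Longrightarrow> e \<subseteq> verts G"
  using plane by (simp add: plane_graph_def simple_graph_def)

lemma edge_card: "e \<in> edges G \<Longrightarrow> card e = 2"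
  using plane by (simp add: plane_graph_def simple_graph_def)

lemma finite_edges: "finite (edges G)"
  by (rule finite_subset[of _ "Pow (verts G)"]) (use finite_verts edge_subset in auto)

lemma edge_distinct: "{u, v} \<in> edges G \<Longrightarrow> u \<noteq> v"
  using edge_card by fastforce

lemmas edge_arcs = plane[unfolded plane_graph_def, THEN conjunct2, THEN conjunct1, rule_format]

lemma arc_edge: "e \<in> edges G \<Longrightarrow> arc (\<gamma> e)"
  by (rule edge_arcs[THEN conjunct1])

lemma ends_edge: "e \<in> edges G \<Longrightarrow> {pathstart (\<gamma> e), pathfinish (\<gamma> e)} = e"
  by (rule edge_arcs[THEN conjunct2, THEN conjunct1])

lemma image_vertices: "e \<in> edges G \<Longrightarrow> path_image (\<gamma> e) \<inter> verts G = e"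
  by (rule edge_arcs[THEN conjunct2, THEN conjunct2])

lemma image_Int:
  assumes "e \<in> edges G" "f \<in> edges G" "e \<noteq> f"
  shows "path_image (\<gamma> e) \<inter> path_image (\<gamma> f) = e \<inter> f"
  using plane[unfolded plane_graph_def, THEN conjunct2, THEN conjunct2, rule_format, OF assms] .

lemma edge_path:
  assumes "{u, v} \<in> edges G"
  shows "arc (edge_path u v)" "pathstart (edge_path u v) = u" "pathfinish (edge_path u v) = v"
    "path_image (edge_path u v) = path_image (\<gamma> {u, v})" "path (edge_path u v)"
proof -
  have "{pathstart (\<gamma> {u, v}), pathfinish (\<gamma> {u, v})} = {u, v}" "u \<noteq> v"
    using ends_edge[OF assms] edge_distinct[OF assms] by auto
  then show "pathstart (edge_path u v) = u" "pathfinish (edge_path u v) = v"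
    by (auto simp: edge_path_def doubleton_eq_iff)
  show *: "arc (edge_path u v)"
    using arc_edge[OF assms] by (auto simp: edge_path_def arc_reversepath)
  then show "path (edge_path u v)" by (rule arc_imp_path)
  show "path_image (edge_path u v) = path_image (\<gamma> {u, v})"
    by (auto simp: edge_path_def)
qed

lemma image_subset_drawing: "e \<in> edges G \<Longrightarrow> path_image (\<gamma> e) \<subseteq> drawing G \<gamma>"
  by (auto simp: drawing_def)

lemma turn_commute:
  assumes "{u, v} \<in> edges G" "z \<notin> drawing G \<gamma>"
  shows "turn z v u = - turn z u v"
proof -
  have "u \<noteq> v" using edge_distinct assms(1) by blast
  then have "edge_path v u = reversepath (edge_path u v)"
    using ends_edge[OF assms(1)]
    by (auto simp: edge_path_def insert_commute doubleton_eq_iff)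
  moreover have "z \<notin> path_image (edge_path u v)"
    using edge_path(4)[OF assms(1)] image_subset_drawing[OF assms(1)] assms(2) by auto
  ultimately show ?thesis
    using edge_path(5)[OF assms(1)] by (simp add: turn_def winding_number_reversepath)
qed

text \<open>The clauses for lists with fewer than two vertices only make the function total.\<close>

fun walk_path :: "complex list \<Rightarrow> real \<Rightarrow> complex" where
  "walk_path (u # v # w # vs) = edge_path u v +++ walk_path (v # w # vs)"
| "walk_path vs = edge_path (hd vs) (last vs)"

definition walk_edges :: "complex list \<Rightarrow> complex set set" where
  "walk_edges vs = {{vs ! i, vs ! Suc i} | i. Suc i < length vs}"

lemma walk_edges_Cons: "walk_edges (u # v # vs) = insert {u, v} (walk_edges (v # vs))"
proof (intro equalityI subsetI)
  fix e assume "e \<in> walk_edges (u # v # vs)"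
  then obtain i where i: "Suc i < length (u # v # vs)" "e = {(u # v # vs) ! i, (u # v # vs) ! Suc i}"
    unfolding walk_edges_def by blast
  then show "e \<in> insert {u, v} (walk_edges (v # vs))"
    unfolding walk_edges_def by (cases i) auto
next
  fix e assume "e \<in> insert {u, v} (walk_edges (v # vs))"
  then consider "e = {u, v}" | i where "Suc i < length (v # vs)" "e = {(v # vs) ! i, (v # vs) ! Suc
    i}"
    unfolding walk_edges_def by blast
  then show "e \<in> walk_edges (u # v # vs)"
  proof cases
    case 1
    then show ?thesis unfolding walk_edges_def by (intro CollectI exI[of _ 0]) simp
  next
    case (2 i)
    then show ?thesis unfolding walk_edges_def by (intro CollectI exI[of _ "Suc i"]) simp
  qed
qed

lemma walk_edges_subset_set: "e \<in> walk_edges vs \<Longrightarrow> e \<subseteq> set vs"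
  by (auto simp: walk_edges_def)

lemma walk_path:
  assumes "distinct vs" "length vs \<ge> 2" "walk_edges vs \<subseteq> edges G"
  shows "arc (walk_path vs) \<and> pathstart (walk_path vs) = hd vs \<and>
    pathfinish (walk_path vs) = last vs \<and>
    path_image (walk_path vs) = (\<Union>e\<in>walk_edges vs. path_image (\<gamma> e)) \<and>
    (\<forall>z. z \<notin> drawing G \<gamma> \<longrightarrow> winding_number (walk_path vs) z =
       (\<Sum>i<length vs - 1. turn z (vs ! i) (vs ! Suc i)))"
  using assms
proof (induction vs rule: walk_path.induct)
  case (1 u v w vs)
  let ?vs = "v # w # vs"
  have e: "{u, v} \<in> edges G" and sub: "walk_edges ?vs \<subseteq> edges G"
    using "1.prems"(3) by (auto simp: walk_edges_Cons[of u])
  have IH: "arc (walk_path ?vs)" "pathstart (walk_path ?vs) = v"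
    "pathfinish (walk_path ?vs) = last ?vs"
    "path_image (walk_path ?vs) = (\<Union>e\<in>walk_edges ?vs. path_image (\<gamma> e))"
    "\<And>z. z \<notin> drawing G \<gamma> \<Longrightarrow> winding_number (walk_path ?vs) z =
       (\<Sum>i<length ?vs - 1. turn z (?vs ! i) (?vs ! Suc i))"
    using "1.IH" "1.prems" sub by auto
  have "path_image (edge_path u v) \<inter> path_image (walk_path ?vs) \<subseteq> {v}"
  proof
    fix x assume x: "x \<in> path_image (edge_path u v) \<inter> path_image (walk_path ?vs)"
    then obtain f where f: "f \<in> walk_edges ?vs" "x \<in> path_image (\<gamma> f)"
      using IH(4) by auto
    have "u \<notin> f" using walk_edges_subset_set[OF f(1)] "1.prems"(1) by auto
    then have "{u, v} \<noteq> f" by auto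
    then have "x \<in> {u, v} \<inter> f"
      using image_Int[OF e _ \<open>{u, v} \<noteq> f\<close>] f sub x edge_path(4)[OF e] by auto
    with \<open>u \<notin> f\<close> show "x \<in> {v}" by auto
  qed
  then have arc: "arc (edge_path u v +++ walk_path ?vs)"
    using edge_path(2,3)[OF e] IH(2) by (intro arc_join[OF edge_path(1)[OF e] IH(1)]) simp_all
  have im: "path_image (edge_path u v +++ walk_path ?vs) =
      (\<Union>e\<in>walk_edges (u # ?vs). path_image (\<gamma> e))"
    using edge_path[OF e] IH by (simp add: path_image_join walk_edges_Cons[of u])
  have "winding_number (edge_path u v +++ walk_path ?vs) z =
      (\<Sum>i<length (u # ?vs) - 1. turn z ((u # ?vs) ! i) ((u # ?vs) ! Suc i))"
    if z: "z \<notin> drawing G \<gamma>" for z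
  proof -
    have "z \<notin> path_image (edge_path u v)" "z \<notin> path_image (walk_path ?vs)"
      using z image_subset_drawing e sub edge_path(4)[OF e] IH(4) by auto
    then have "winding_number (edge_path u v +++ walk_path ?vs) z =
      turn z u v + winding_number (walk_path ?vs) z"
      unfolding turn_def
      using edge_path(3)[OF e] IH(2)
      by (intro winding_number_join edge_path(5)[OF e] arc_imp_path[OF IH(1)]) simp_all
    also have "\<dots> = turn z u v + (\<Sum>i<length ?vs - 1. turn z (?vs ! i) (?vs ! Suc i))"
      using IH(5)[OF z] by simp
    also have "\<dots> = (\<Sum>i<Suc (length ?vs - 1). turn z ((u # ?vs) ! i) ((u # ?vs) ! Suc i))"
      by (simp only: sum.lessThan_Suc_shift) simp
    finally show ?thesis by simp
  qed
  with arc im show ?case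
    using edge_path[OF e] IH by simp
next
  case ("2_3" u v)
  have e: "{u, v} \<in> edges G" using "2_3" by (auto simp: walk_edges_Cons)
  have "walk_edges [u, v] = {{u, v}}" by (auto simp: walk_edges_def)
  then show ?case using edge_path[OF e] by (simp add: turn_def)
qed auto

text \<open>Arcs of different edges meet only in common ends, so the arcs of a cycle join to a simple
  closed path.\<close>

lemma cycle_closed_path:
  assumes vs: "distinct vs" "length vs \<ge> 3"
    and C: "C = {{vs ! i, vs ! (Suc i mod length vs)} | i. i < length vs}" "C \<subseteq> edges G"
  obtains P where "simple_path P" "pathfinish P = pathstart P"
    "path_image P = (\<Union>e\<in>C. path_image (\<gamma> e))"
    "\<And>z. z \<notin> drawing G \<gamma> \<Longrightarrow>
       winding_number P z = (\<Sum>i<length vs. turn z (vs ! i) (vs ! (Suc i mod length vs)))"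
proof -
  let ?n = "length vs"
  let ?e = "{last vs, hd vs}"
  have ne: "vs \<noteq> []" using vs by (cases vs) simp_all
  have lst: "last vs = vs ! (?n - 1)" "hd vs = vs ! 0"
    using last_conv_nth[OF ne] hd_conv_nth[OF ne] by blast+
  have "{i. i < ?n} = insert (?n - 1) {i. Suc i < ?n}" using vs by auto
  then have "C = insert {vs ! (?n - 1), vs ! (Suc (?n - 1) mod ?n)}
      ((\<lambda>i. {vs ! i, vs ! (Suc i mod ?n)}) ` {i. Suc i < ?n})"
    unfolding C(1) setcompr_eq_image by simp
  also have "(\<lambda>i. {vs ! i, vs ! (Suc i mod ?n)}) ` {i. Suc i < ?n} = walk_edges vs"
    unfolding walk_edges_def setcompr_eq_image by (intro image_cong) auto
  finally have C': "C = insert ?e (walk_edges vs)"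
    using ne by (simp add: lst)
  have e: "?e \<in> edges G" and sub: "walk_edges vs \<subseteq> edges G" using C(2) C' by auto
  note W = walk_path[OF vs(1) _ sub]
  have W: "arc (walk_path vs)" "pathstart (walk_path vs) = hd vs" "pathfinish (walk_path vs) = last
    vs"
    "path_image (walk_path vs) = (\<Union>e\<in>walk_edges vs. path_image (\<gamma> e))"
    "\<And>z. z \<notin> drawing G \<gamma> \<Longrightarrow> winding_number (walk_path vs) z =
       (\<Sum>i<?n - 1. turn z (vs ! i) (vs ! Suc i))"
    using W vs by auto
  let ?P = "walk_path vs +++ edge_path (last vs) (hd vs)"
  have "?e \<notin> walk_edges vs"
  proof
    assume "?e \<in> walk_edges vs"
    then obtain i where i: "Suc i < ?n" "{vs ! i, vs ! Suc i} = {vs ! (?n - 1), vs ! 0}"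
      by (auto simp: walk_edges_def lst)
    have inj: "vs ! a = vs ! b \<longleftrightarrow> a = b" if "a < ?n" "b < ?n" for a b
      using nth_eq_iff_index_eq[OF vs(1)] that by blast
    have "vs ! Suc i = vs ! 0 \<or> vs ! i = vs ! 0 \<and> vs ! Suc i = vs ! (?n - 1)"
      using i(2) by (auto simp: doubleton_eq_iff)
    then have "Suc i = 0 \<or> i = 0 \<and> Suc i = ?n - 1"
      using inj[of "Suc i" 0] inj[of i 0] inj[of "Suc i" "?n - 1"] i(1) vs(2) by linarith
    then show False using vs i by auto
  qed
  then have "path_image (walk_path vs) \<inter> path_image (edge_path (last vs) (hd vs)) \<subseteq> ?e"
  proof -
    assume notin: "?e \<notin> walk_edges vs"
    have "path_image (\<gamma> f) \<inter> path_image (\<gamma> ?e) \<subseteq> ?e" if "f \<in> walk_edges vs" for f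
      using image_Int[OF e, of f] sub that notin by auto
    then show ?thesis unfolding edge_path(4)[OF e] W(4) by blast
  qed
  then have "simple_path ?P"
    using W edge_path[OF e]
    by (intro simple_path_join_loop[OF W(1) edge_path(1)[OF e]]) (simp_all add: insert_commute)
  moreover have "pathfinish ?P = pathstart ?P" using W edge_path[OF e] by simp
  moreover have "path_image ?P = (\<Union>e\<in>C. path_image (\<gamma> e))"
    using W edge_path[OF e] by (auto simp: path_image_join C')
  moreover have "winding_number ?P z = (\<Sum>i<?n. turn z (vs ! i) (vs ! (Suc i mod ?n)))"
    if z: "z \<notin> drawing G \<gamma>" for z
  proof -
    have "z \<notin> path_image (edge_path (last vs) (hd vs))" "z \<notin> path_image (walk_path vs)"
      using z image_subset_drawing e sub edge_path(4)[OF e] W(4) by auto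
    then have "winding_number ?P z = winding_number (walk_path vs) z + turn z (last vs) (hd vs)"
      unfolding turn_def
      using edge_path(2)[OF e] W(3)
      by (intro winding_number_join edge_path(5)[OF e] arc_imp_path[OF W(1)]) simp_all
    also have "\<dots> = (\<Sum>i<?n - 1. turn z (vs ! i) (vs ! (Suc i mod ?n))) + turn z (last vs) (hd vs)"
      using W(5)[OF z] by simp
    also have "\<dots> = (\<Sum>i<?n. turn z (vs ! i) (vs ! (Suc i mod ?n)))"
      using sum.lessThan_Suc[of "\<lambda>i. turn z (vs ! i) (vs ! (Suc i mod ?n))" "?n - 1"] ne
      by (simp add: lst)
    finally show ?thesis .
  qed
  ultimately show thesis by (rule that)
qed

lemma closed_drawing: "closed (drawing G \<gamma>)" and compact_drawing: "compact (drawing G \<gamma>)"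
proof -
  show "compact (drawing G \<gamma>)"
    unfolding drawing_def
  proof (intro compact_Un compact_UN)
    show "compact (path_image (\<gamma> e))" if "e \<in> edges G" for e
      using arc_edge[OF that] by (simp add: compact_path_image arc_imp_path)
  qed (use finite_verts finite_edges in \<open>auto simp: finite_imp_compact\<close>)
  then show "closed (drawing G \<gamma>)" by (rule compact_imp_closed)
qed

text \<open>The winding number of a simple closed path is \<open>0\<close> outside and constantly \<open>1\<close> or \<open>-1\<close>
  inside. If the path is the frontier of a face \<open>F\<close>, then \<open>F\<close> is open and closed within the side
  of the path that it meets; being bounded, it is the inside.\<close>

lemma cycle_turning:
  assumes vs: "distinct vs" "length vs \<ge> 3"
    and C: "C = {{vs ! i, vs ! (Suc i mod length vs)} | i. i < length vs}" "C \<subseteq> edges G"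
  defines "t \<equiv> \<lambda>z. \<Sum>i<length vs. turn z (vs ! i) (vs ! (Suc i mod length vs))"
  shows "\<exists>s\<in>{1, -1}. (\<forall>z. z \<notin> drawing G \<gamma> \<longrightarrow> t z \<in> {0, s}) \<and>
    (\<forall>F\<in>finite_faces G \<gamma>. is_periphery \<gamma> C F \<longrightarrow>
       (\<forall>z. z \<notin> drawing G \<gamma> \<longrightarrow> t z = (if z \<in> F then s else 0)))"
proof -
  obtain P where P: "simple_path P" "pathfinish P = pathstart P"
    "path_image P = (\<Union>e\<in>C. path_image (\<gamma> e))"
    "\<And>z. z \<notin> drawing G \<gamma> \<Longrightarrow> winding_number P z = t z"
    by (rule cycle_closed_path[OF vs C]) (rule that, simp_all add: t_def)
  obtain s where s: "s \<in> {1, -1}" "\<And>z. z \<in> inside (path_image P) \<Longrightarrow> winding_number P z = s"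
    by (rule simple_closed_path_winding_number_inside[OF P(1)]; rule that) simp_all
  have out: "winding_number P z = 0" if "z \<in> outside (path_image P)" for z
    using winding_number_zero_in_outside[OF simple_path_imp_path[OF P(1)] P(2) that] .
  have sub: "path_image P \<subseteq> drawing G \<gamma>"
    unfolding P(3) using C(2) image_subset_drawing by blast
  have cases: "z \<in> inside (path_image P) \<or> z \<in> outside (path_image P)" if "z \<notin> drawing G \<gamma>" for z
    using that sub inside_Un_outside by blast
  have inside: "F = inside (path_image P)"
    if F: "F \<in> finite_faces G \<gamma>" and per: "is_periphery \<gamma> C F" for F
  proof -
    note J = Jordan_inside_outside[OF P(1,2)]
    have Fc: "F \<in> components (- drawing G \<gamma>)" "bounded F"
      using F by (auto simp: finite_faces_def)
    have fr: "frontier F = path_image P" using per P(3) by (simp add: is_periphery_def)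
    have op: "open F" using open_components[OF _ Fc(1)] closed_drawing by blast
    have ne: "F \<noteq> {}" using Fc in_components_nonempty by blast
    have con: "connected F" using Fc in_components_connected by blast
    have dis: "F \<inter> path_image P = {}"
      using Fc(1) in_components_subset sub by blast
    have clopen: "F \<supseteq> D" if "open D" "connected D" "D \<inter> path_image P = {}" "F \<inter> D \<noteq> {}" for D
      using connected_Int_frontier[OF that(2), of F] that fr by blast
    have "F \<inter> outside (path_image P) = {}"
    proof (rule ccontr)
      assume "F \<inter> outside (path_image P) \<noteq> {}"
      then have "outside (path_image P) \<subseteq> F"
        by (intro clopen) (use J in \<open>simp_all add: outside_no_overlap\<close>)
      then show False
        using J Fc(2) bounded_subset by blast
    qed
    then have 1: "F \<subseteq> inside (path_image P)"
      using dis inside_Un_outside[of "path_image P"] by blast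
    have "inside (path_image P) \<subseteq> F"
    proof (rule clopen)
      show "F \<inter> inside (path_image P) \<noteq> {}" using 1 ne by blast
    qed (use J in \<open>simp_all add: inside_no_overlap\<close>)
    with 1 show ?thesis by blast
  qed
  then have "t z = (if z \<in> F then s else 0)"
    if "F \<in> finite_faces G \<gamma>" "is_periphery \<gamma> C F" "z \<notin> drawing G \<gamma>" for F z
  proof -
    have F: "F = inside (path_image P)" using inside that by blast
    show ?thesis
    proof (cases "z \<in> F")
      case True
      then show ?thesis using s(2) P(4)[OF that(3)] F by simp
    next
      case False
      then show ?thesis using cases[OF that(3)] out P(4)[OF that(3)] F by auto
    qed
  qed
  moreover have "t z \<in> {0, s}" if "z \<notin> drawing G \<gamma>" for z
    using cases[OF that] s out P(4)[OF that] by auto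
  ultimately show ?thesis using s(1) by (intro bexI[of _ s] conjI ballI allI impI) simp_all
qed

text \<open>An edge missing from the second set would have its uncountable arc covered by its own two
  ends.\<close>

lemma periphery_determines_edges:
  assumes "C \<subseteq> edges G" "C' \<subseteq> edges G" "is_periphery \<gamma> C F" "is_periphery \<gamma> C' F"
  shows "C = C'"
proof -
  have "C \<subseteq> C'" if sub: "C \<subseteq> edges G" "C' \<subseteq> edges G"
    and eq: "(\<Union>e\<in>C. path_image (\<gamma> e)) = (\<Union>e\<in>C'. path_image (\<gamma> e))" for C C'
  proof
    fix e assume e: "e \<in> C"
    show "e \<in> C'"
    proof (rule ccontr)
      assume ne: "e \<notin> C'"
      have eE: "e \<in> edges G" using e sub(1) by blast
      have "path_image (\<gamma> e) \<subseteq> e"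
      proof
        fix x assume x: "x \<in> path_image (\<gamma> e)"
        then obtain f where f: "f \<in> C'" "x \<in> path_image (\<gamma> f)" using e eq by blast
        then have "x \<in> path_image (\<gamma> e) \<inter> path_image (\<gamma> f)" "f \<in> edges G" "e \<noteq> f"
          using x ne sub(2) by auto
        then show "x \<in> e" using image_Int[OF eE] by simp
      qed
      moreover have "finite e" using edge_card[OF eE] card_ge_0_finite[of e] by simp
      ultimately have "finite (path_image (\<gamma> e))" by (rule finite_subset)
      moreover have "infinite (path_image (\<gamma> e))"
        using arc_image_uncountable[OF arc_edge[OF eE]] countable_finite by metis
      ultimately show False by blast
    qed
  qed
  note sub = this
  have eq: "(\<Union>e\<in>C. path_image (\<gamma> e)) = (\<Union>e\<in>C'. path_image (\<gamma> e))"
    using assms(3,4) by (simp add: is_periphery_def)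
  show ?thesis
    by (rule equalityI[OF sub[OF assms(1,2) eq] sub[OF assms(2,1) eq[symmetric]]])
qed

end

section \<open>Perfect matchings of a bipartite plane graph\<close>

lemma orbit_cycle:
  assumes "finite A" "bij_betw t A A" "a \<in> A"
  obtains m where "m > 0" "(t ^^ m) a = a" "inj_on (\<lambda>k. (t ^^ k) a) {..<m}"
proof -
  have in_A: "(t ^^ k) a \<in> A" for k
    by (induction k) (use assms bij_betwE in auto)
  have inj: "inj_on (t ^^ k) A" for k
  proof (induction k)
    case (Suc k)
    have "(t ^^ k) ` A \<subseteq> A" by (induction k) (use assms(2) bij_betwE in fastforce)+
    then show ?case
      using Suc assms(2) inj_on_subset unfolding funpow.simps by (metis comp_inj_on
        bij_betw_imp_inj_on)
  qed simp
  have ret: "(t ^^ (j - i)) a = a" if ij: "i < j" "(t ^^ i) a = (t ^^ j) a" for i j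
  proof -
    have "(t ^^ j) a = (t ^^ i) ((t ^^ (j - i)) a)"
      using ij(1) funpow_add[of i "j - i" t] by simp
    then show ?thesis using inj_onD[OF inj[of i], of "(t ^^ (j - i)) a" a] ij(2) in_A assms(3) by simp
  qed
  have "\<not> inj_on (\<lambda>k. (t ^^ k) a) {..card A}"
  proof
    assume "inj_on (\<lambda>k. (t ^^ k) a) {..card A}"
    then have "card {..card A} \<le> card A"
      using in_A assms(1) by (intro card_inj_on_le[of "\<lambda>k. (t ^^ k) a"]) auto
    then show False by simp
  qed
  then obtain i j where "i < j" "(t ^^ i) a = (t ^^ j) a"
    unfolding inj_on_def by (metis nat_neq_iff)
  then have ex: "\<exists>m. m > 0 \<and> (t ^^ m) a = a" using ret[of i j] by (intro exI[of _ "j - i"]) simp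
  define m where "m = (LEAST m. m > 0 \<and> (t ^^ m) a = a)"
  have m: "m > 0" "(t ^^ m) a = a" using LeastI_ex[OF ex] unfolding m_def by auto
  have least: "m \<le> k" if "k > 0" "(t ^^ k) a = a" for k
    unfolding m_def using that by (intro Least_le) simp
  have no: False if "i < j" "j < m" "(t ^^ i) a = (t ^^ j) a" for i j
    using least[of "j - i"] ret[OF that(1,3)] that by simp
  have "inj_on (\<lambda>k. (t ^^ k) a) {..<m}"
  proof (rule inj_onI)
    fix i j assume "i \<in> {..<m}" "j \<in> {..<m}" "(t ^^ i) a = (t ^^ j) a"
    then show "i = j" using no[of i j] no[of j i] by (cases i j rule: linorder_cases) auto
  qed
  with m show thesis by (rule that)
qed

locale plane_bipartite = plane_drawing +
  fixes A B :: "complex set"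
  assumes parts: "A \<inter> B = {}" "A \<union> B = verts G"
    and crossing: "e \<in> edges G \<Longrightarrow> e \<inter> A \<noteq> {} \<and> e \<inter> B \<noteq> {}"
begin

lemma finite_parts: "finite A" "finite B"
  using finite_verts parts(2) by (metis finite_Un)+

lemma edge_ends:
  assumes "e \<in> edges G"
  obtains a b where "a \<in> A" "b \<in> B" "e = {a, b}"
proof -
  obtain x y where e: "e = {x, y}"
    using edge_card[OF assms] by (meson card_2_iff)
  show thesis
  proof (cases "x \<in> A")
    case True
    then have "y \<in> B" using crossing[OF assms] parts(1) e by auto
    with True e show thesis by (intro that)
  next
    case False
    then have "y \<in> A" "x \<in> B" using crossing[OF assms] parts(1) e by auto
    with e show thesis by (intro that[of y x]) auto
  qed
qed

lemma edge_sides: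
  assumes "{u, v} \<in> edges G"
  shows "u \<in> A \<and> v \<in> B \<or> u \<in> B \<and> v \<in> A"
  by (rule edge_ends[OF assms]) (auto simp: doubleton_eq_iff)

text \<open>For a perfect matching, the partner of a vertex; on \<open>A\<close> this is a bijection onto \<open>B\<close>.\<close>

definition mate :: "complex set set \<Rightarrow> complex \<Rightarrow> complex" where
  "mate M a = (THE b. {a, b} \<in> M)"

lemma matching_edges: "perfect_matching G M \<Longrightarrow> e \<in> M \<Longrightarrow> e \<in> edges G"
  unfolding perfect_matching_def by blast

lemma matching_unique:
  assumes "perfect_matching G M" "e \<in> M" "f \<in> M" "v \<in> e" "v \<in> f"
  shows "e = f"
proof -
  have "v \<in> verts G" using assms matching_edges edge_subset by blast
  then have "\<exists>!e. e \<in> M \<and> v \<in> e" using assms(1) unfolding perfect_matching_def by blast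
  then show ?thesis using assms(2-) by blast
qed

lemma matching_covers:
  assumes "perfect_matching G M" "v \<in> verts G"
  obtains e where "e \<in> M" "v \<in> e"
  using assms unfolding perfect_matching_def by blast

lemma mate_eq:
  assumes "perfect_matching G M" "{a, b} \<in> M"
  shows "mate M a = b"
  unfolding mate_def
proof (rule the_equality)
  show "{a, b} \<in> M" by fact
  fix c assume "{a, c} \<in> M"
  then have "{a, c} = {a, b}" using matching_unique[OF assms(1) _ assms(2), of "{a, c}" a] by simp
  then show "c = b" by (auto simp: doubleton_eq_iff)
qed

lemma mate_edge:
  assumes "perfect_matching G M" "a \<in> A"
  shows "{a, mate M a} \<in> M" "mate M a \<in> B"
proof -
  obtain e where e: "e \<in> M" "a \<in> e"
    using matching_covers[OF assms(1), of a] assms(2) parts(2) by blast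
  obtain a' b where ab: "a' \<in> A" "b \<in> B" "e = {a', b}"
    using edge_ends matching_edges assms(1) e(1) by metis
  then have "a' = a" using e(2) assms(2) parts(1) by auto
  then have "{a, b} \<in> M" using e ab by simp
  then show "{a, mate M a} \<in> M" "mate M a \<in> B"
    using mate_eq[OF assms(1), of a b] ab by auto
qed

lemma mate_bij:
  assumes "perfect_matching G M"
  shows "bij_betw (mate M) A B"
  unfolding bij_betw_def
proof (intro conjI equalityI subsetI inj_onI)
  fix a a' assume a: "a \<in> A" "a' \<in> A" "mate M a = mate M a'"
  then have "{a, mate M a} = {a', mate M a'}"
    using matching_unique[OF assms mate_edge(1)[OF assms a(1)] mate_edge(1)[OF assms a(2)], of "mate
      M a"]
    by simp
  then show "a = a'" using a(3) by (auto simp: doubleton_eq_iff)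
next
  fix b assume "b \<in> mate M ` A"
  then show "b \<in> B" using mate_edge(2)[OF assms] by blast
next
  fix b assume b: "b \<in> B"
  obtain e where e: "e \<in> M" "b \<in> e"
    using matching_covers[OF assms, of b] b parts(2) by blast
  obtain a b' where ab: "a \<in> A" "b' \<in> B" "e = {a, b'}"
    using edge_ends matching_edges assms(1) e(1) by metis
  then have "b' = b" using e(2) b parts(1) by auto
  then have "mate M a = b" using mate_eq[OF assms, of a b] e(1) ab(3) by simp
  then show "b \<in> mate M ` A" using ab(1) by blast
qed

lemma matching_eq_image:
  assumes "perfect_matching G M"
  shows "M = (\<lambda>a. {a, mate M a}) ` A"
proof (intro equalityI subsetI)
  fix e assume e: "e \<in> M"
  obtain a b where ab: "a \<in> A" "b \<in> B" "e = {a, b}"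
    using edge_ends matching_edges assms(1) e by metis
  then have "mate M a = b" using mate_eq[OF assms, of a b] e by simp
  then show "e \<in> (\<lambda>a. {a, mate M a}) ` A" using ab by blast
qed (use mate_edge(1)[OF assms] in blast)

lemma matching_eqI:
  assumes "perfect_matching G M" "perfect_matching G N" "\<And>a. a \<in> A \<Longrightarrow> mate M a = mate N a"
  shows "M = N"
proof -
  have "(\<lambda>a. {a, mate M a}) ` A = (\<lambda>a. {a, mate N a}) ` A"
    using assms(3) by (intro image_cong) auto
  then show ?thesis using matching_eq_image assms(1,2) by metis
qed

lemma matching_of_bij:
  assumes f: "bij_betw f A B" and e: "\<And>a. a \<in> A \<Longrightarrow> {a, f a} \<in> edges G"
  defines "M \<equiv> (\<lambda>a. {a, f a}) ` A"
  shows "perfect_matching G M" "\<And>a. a \<in> A \<Longrightarrow> mate M a = f a"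
proof -
  show pm: "perfect_matching G M"
    unfolding perfect_matching_def
  proof (intro conjI ballI)
    show "M \<subseteq> edges G" using e by (auto simp: M_def)
    fix v assume "v \<in> verts G"
    then consider "v \<in> A" | "v \<in> B" using parts(2) by blast
    then show "\<exists>!e. e \<in> M \<and> v \<in> e"
    proof cases
      case 1
      have "e = {v, f v}" if "e \<in> M \<and> v \<in> e" for e
      proof -
        obtain a where a: "a \<in> A" "e = {a, f a}" using \<open>e \<in> M \<and> v \<in> e\<close> by (auto simp: M_def)
        have "f a \<in> B" using f a(1) bij_betwE by blast
        then have "v = a" using that a 1 parts(1) by auto
        then show ?thesis using a by simp
      qed
      then show ?thesis using 1 by (intro ex1I[of _ "{v, f v}"]) (auto simp: M_def)
    next
      case 2
      then obtain a where a: "a \<in> A" "f a = v" using f by (auto simp: bij_betw_def)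
      have "e = {a, v}" if "e \<in> M \<and> v \<in> e" for e
      proof -
        obtain a' where a': "a' \<in> A" "e = {a', f a'}" using \<open>e \<in> M \<and> v \<in> e\<close> by (auto simp: M_def)
        then have "v = f a'" using that 2 parts(1) by auto
        then have "a' = a" using a a' f unfolding bij_betw_def inj_on_def by blast
        then show ?thesis using a a' by simp
      qed
      then show ?thesis using a by (intro ex1I[of _ "{a, v}"]) (auto simp: M_def)
    qed
  qed
  show "mate M a = f a" if "a \<in> A" for a
    using mate_eq[OF pm, of a "f a"] that by (auto simp: M_def)
qed

lemma matching_subset_eq:
  assumes L: "perfect_matching G L" and N: "perfect_matching G N" and "L \<subseteq> N"
  shows "L = N"
proof (rule matching_eqI[OF L N])
  fix a assume "a \<in> A"
  then have "{a, mate L a} \<in> N" using mate_edge(1)[OF L] assms(3) by blast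
  then show "mate L a = mate N a" using mate_eq[OF N] by simp
qed

text \<open>All edges of the matching are directed from \<open>A\<close> to \<open>B\<close>.\<close>

definition matching_turn :: "complex \<Rightarrow> complex set set \<Rightarrow> complex" where
  "matching_turn z M = (\<Sum>a\<in>A. turn z a (mate M a))"

definition edge_turn :: "complex \<Rightarrow> complex set \<Rightarrow> complex" where
  "edge_turn z e = (\<Sum>a\<in>e \<inter> A. \<Sum>b\<in>e \<inter> B. turn z a b)"

lemma edge_turn: "a \<in> A \<Longrightarrow> b \<in> B \<Longrightarrow> edge_turn z {a, b} = turn z a b"
proof -
  assume "a \<in> A" "b \<in> B"
  then have "{a, b} \<inter> A = {a}" "{a, b} \<inter> B = {b}" using parts(1) by auto
  then show ?thesis by (simp add: edge_turn_def)
qed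

lemma matching_turn_eq:
  assumes "perfect_matching G M"
  shows "matching_turn z M = (\<Sum>e\<in>M. edge_turn z e)"
proof -
  have "inj_on (\<lambda>a. {a, mate M a}) A"
  proof (rule inj_onI)
    fix a a' assume a: "a \<in> A" "a' \<in> A" and eq: "{a, mate M a} = {a', mate M a'}"
    have "mate M a' \<noteq> a" using mate_edge(2)[OF assms a(2)] a(1) parts(1) by auto
    with eq show "a = a'" by (auto simp: doubleton_eq_iff)
  qed
  then have "(\<Sum>e\<in>M. edge_turn z e) = (\<Sum>a\<in>A. edge_turn z {a, mate M a})"
    using sum.reindex[of "\<lambda>a. {a, mate M a}" A "edge_turn z"] matching_eq_image[OF assms]
    by (simp add: o_def)
  also have "\<dots> = matching_turn z M"
    unfolding matching_turn_def using edge_turn mate_edge(2)[OF assms] by (intro sum.cong) auto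
  finally show ?thesis ..
qed

lemma finite_matching: "perfect_matching G M \<Longrightarrow> finite M"
  by (rule finite_subset[OF _ finite_edges]) (use matching_edges in auto)

text \<open>Along a cycle the edges alternate between the two matchings.\<close>

lemma cycle_alternates:
  assumes M: "perfect_matching G M" and N: "perfect_matching G N"
    and vs: "distinct vs" "length vs \<ge> 3"
    and C: "sym_diff M N = {{vs ! i, vs ! (Suc i mod length vs)} | i. i < length vs}"
    and e_def: "e = (\<lambda>i. {vs ! i, vs ! (Suc i mod length vs)})"
  shows "inj_on e {..<length vs}"
    and "\<And>i. Suc i < length vs \<Longrightarrow> e (Suc i) \<in> N \<longleftrightarrow> e i \<notin> N"
    and "\<And>i. Suc i < length vs \<Longrightarrow> vs ! Suc i \<in> A \<longleftrightarrow> vs ! i \<notin> A"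
    and "\<And>i. i < length vs \<Longrightarrow> e i \<in> M \<longleftrightarrow> e i \<notin> N"
    and "\<And>i. i < length vs \<Longrightarrow> e i \<in> edges G"
proof -
  let ?n = "length vs"
  have inj: "vs ! a = vs ! b \<longleftrightarrow> a = b" if "a < ?n" "b < ?n" for a b
    using nth_eq_iff_index_eq[OF vs(1)] that by blast
  show injE: "inj_on e {..<?n}"
  proof (rule inj_onI)
    fix i j assume i: "i \<in> {..<?n}" "j \<in> {..<?n}" and eq: "e i = e j"
    let ?i = "Suc i mod ?n" and ?j = "Suc j mod ?n"
    have "0 < ?n" using vs(2) by linarith
    then have lt: "?i < ?n" "?j < ?n" by (rule mod_less_divisor)+
    have "vs ! i = vs ! j \<and> vs ! ?i = vs ! ?j \<or> vs ! i = vs ! ?j \<and> vs ! ?i = vs ! j"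
      using eq unfolding e_def doubleton_eq_iff .
    then have "i = j \<or> i = ?j \<and> ?i = j"
      using i inj[of i j] inj[of i ?j, OF _ lt(2)] inj[of ?i j, OF lt(1)] by blast
    moreover have "\<not> (i = ?j \<and> ?i = j)"
    proof
      assume ij: "i = ?j \<and> ?i = j"
      have "?i = (if Suc i = ?n then 0 else Suc i)" "?j = (if Suc j = ?n then 0 else Suc j)"
        using i by (simp_all add: mod_Suc)
      then show False
        using ij vs(2) by (auto split: if_splits)
    qed
    ultimately show "i = j" by blast
  qed
  have sd: "e i \<in> sym_diff M N" if "i < ?n" for i
    using that unfolding C e_def by blast
  have MN: "e i \<in> M \<longleftrightarrow> e i \<notin> N" if "i < ?n" for i
    using sd[OF that] by blast
  have E: "e i \<in> edges G" if "i < ?n" for i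
    using sd[OF that] matching_edges M N by blast
  show "e i \<in> M \<longleftrightarrow> e i \<notin> N" "e i \<in> edges G" if "i < ?n" for i
    using MN[OF that] E[OF that] .
  fix i assume i: "Suc i < ?n"
  then have i': "i < ?n" by simp
  have ei: "e i = {vs ! i, vs ! Suc i}" using i by (simp add: e_def)
  have v: "vs ! Suc i \<in> e i" "vs ! Suc i \<in> e (Suc i)" by (simp add: ei) (simp add: e_def)
  have ne: "e i \<noteq> e (Suc i)" using inj_onD[OF injE, of i "Suc i"] i by auto
  show "e (Suc i) \<in> N \<longleftrightarrow> e i \<notin> N"
    using matching_unique[OF N _ _ v] matching_unique[OF M _ _ v] MN[OF i'] MN[OF i] ne by blast
  have "{vs ! i, vs ! Suc i} \<in> edges G" using E[OF i'] ei by simp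
  from edge_sides[OF this] show "vs ! Suc i \<in> A \<longleftrightarrow> vs ! i \<notin> A"
    using parts(1) by blast
qed

text \<open>Going around the cycle, the edges of one matching are passed from \<open>A\<close> to \<open>B\<close> and those of
  the other from \<open>B\<close> to \<open>A\<close>. So the turning of the cycle is the difference of the turnings of
  the matchings, up to the sign that depends on the direction.\<close>

lemma matching_turn_diff:
  assumes M: "perfect_matching G M" and N: "perfect_matching G N"
    and vs: "distinct vs" "length vs \<ge> 3"
    and C: "sym_diff M N = {{vs ! i, vs ! (Suc i mod length vs)} | i. i < length vs}"
  shows "\<exists>s\<in>{1, -1}. \<forall>z. z \<notin> drawing G \<gamma> \<longrightarrow>
    matching_turn z N - matching_turn z M =
      s * (\<Sum>i<length vs. turn z (vs ! i) (vs ! (Suc i mod length vs)))"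
proof -
  let ?n = "length vs"
  define e where "e = (\<lambda>i. {vs ! i, vs ! (Suc i mod ?n)})"
  note alt = cycle_alternates[OF M N vs C e_def]
  define s :: complex where "s = (if e 0 \<in> N \<longleftrightarrow> vs ! 0 \<in> A then 1 else -1)"
  have sign: "(e i \<in> N \<longleftrightarrow> vs ! i \<in> A) \<longleftrightarrow> (e 0 \<in> N \<longleftrightarrow> vs ! 0 \<in> A)" if "i < ?n" for i
    using that
  proof (induction i)
    case (Suc i)
    then show ?case using alt(2)[OF Suc.prems] alt(3)[OF Suc.prems] by simp
  qed simp
  have "matching_turn z N - matching_turn z M =
      s * (\<Sum>i<?n. turn z (vs ! i) (vs ! (Suc i mod ?n)))" if z: "z \<notin> drawing G \<gamma>" for z
  proof -
    let ?w = "edge_turn z"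
    have fin: "finite M" "finite N" using finite_matching M N by auto
    have "sum ?w N = sum ?w (N - M) + sum ?w (N \<inter> M)" "sum ?w M = sum ?w (M - N) + sum ?w (N \<inter> M)"
      using fin by (metis sum.Int_Diff add.commute Int_commute)+
    then have "sum ?w N - sum ?w M = sum ?w (N - M) + (\<Sum>x\<in>M - N. - ?w x)"
      by (simp add: sum_negf)
    also have "\<dots> = (\<Sum>x\<in>N - M. if x \<in> N then ?w x else - ?w x) +
        (\<Sum>x\<in>M - N. if x \<in> N then ?w x else - ?w x)"
      by (intro arg_cong2[where f = "(+)"] sum.cong) auto
    also have "\<dots> = (\<Sum>x\<in>sym_diff M N. if x \<in> N then ?w x else - ?w x)"
      using fin by (subst sum.union_disjoint[symmetric]) (auto simp: Un_commute)
    also have "sym_diff M N = e ` {..<?n}"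
      unfolding C e_def by auto
    also have "(\<Sum>x\<in>e ` {..<?n}. if x \<in> N then ?w x else - ?w x) =
        (\<Sum>i<?n. if e i \<in> N then ?w (e i) else - ?w (e i))"
      using alt(1) by (subst sum.reindex) (auto simp: o_def)
    also have "\<dots> = (\<Sum>i<?n. s * turn z (vs ! i) (vs ! (Suc i mod ?n)))"
    proof (rule sum.cong)
      fix i assume "i \<in> {..<?n}"
      then have i: "i < ?n" by simp
      let ?u = "vs ! i" and ?v = "vs ! (Suc i mod ?n)"
      have E: "{?u, ?v} \<in> edges G" using alt(5)[OF i] by (simp add: e_def)
      have "?w (e i) = (if ?u \<in> A then turn z ?u ?v else - turn z ?u ?v)"
      proof (cases "?u \<in> A")
        case True
        then have "?v \<in> B" using edge_sides[OF E] parts(1) by blast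
        then show ?thesis using True edge_turn by (simp add: e_def)
      next
        case False
        then have "?v \<in> A" "?u \<in> B" using edge_sides[OF E] by blast+
        then have "?w {?v, ?u} = turn z ?v ?u" by (rule edge_turn)
        then show ?thesis using False turn_commute[OF E z] by (simp add: e_def insert_commute)
      qed
      then show "(if e i \<in> N then ?w (e i) else - ?w (e i)) = s * turn z ?u ?v"
        using sign[OF i] by (auto simp: s_def)
    qed simp
    also have "\<dots> = s * (\<Sum>i<?n. turn z (vs ! i) (vs ! (Suc i mod ?n)))"
      by (simp add: sum_distrib_left)
    finally show ?thesis using matching_turn_eq M N by simp
  qed
  moreover have "s \<in> {1, -1}" by (simp add: s_def)
  ultimately show ?thesis by (intro bexI[of _ s] allI impI) simp_all
qed

lemma cycle_turn_diff:
  assumes M: "perfect_matching G M" and N: "perfect_matching G N"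
    and C: "is_cycle_edge_set G (sym_diff M N)"
  obtains s where "s \<in> {1, -1}"
    "\<And>z. z \<notin> drawing G \<gamma> \<Longrightarrow> matching_turn z N - matching_turn z M \<in> {0, s}"
    "\<And>F z. F \<in> finite_faces G \<gamma> \<Longrightarrow> is_periphery \<gamma> (sym_diff M N) F \<Longrightarrow> z \<notin> drawing G \<gamma> \<Longrightarrow>
       matching_turn z N - matching_turn z M = (if z \<in> F then s else 0)"
proof -
  obtain vs where vs: "distinct vs" "length vs \<ge> 3"
    and C': "sym_diff M N = {{vs ! i, vs ! (Suc i mod length vs)} | i. i < length vs}"
    "sym_diff M N \<subseteq> edges G"
    using C unfolding is_cycle_edge_set_def by blast
  define t where "t z = (\<Sum>i<length vs. turn z (vs ! i) (vs ! (Suc i mod length vs)))" for z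
  obtain s where s: "s \<in> {1, -1}"
    "\<forall>z. z \<notin> drawing G \<gamma> \<longrightarrow> t z \<in> {0, s}"
    "\<forall>F\<in>finite_faces G \<gamma>. is_periphery \<gamma> (sym_diff M N) F \<longrightarrow>
       (\<forall>z. z \<notin> drawing G \<gamma> \<longrightarrow> t z = (if z \<in> F then s else 0))"
    using cycle_turning[OF vs C'] unfolding t_def by blast
  obtain s' where s': "s' \<in> {1, -1}" "\<And>z. z \<notin> drawing G \<gamma> \<Longrightarrow>
    matching_turn z N - matching_turn z M = s' * t z"
    using matching_turn_diff[OF M N vs C'(1)] unfolding t_def[symmetric] by blast
  show thesis
  proof (rule that[of "s' * s"])
    show "s' * s \<in> {1, -1}" using s(1) s'(1) by auto
    show "matching_turn z N - matching_turn z M \<in> {0, s' * s}" if "z \<notin> drawing G \<gamma>" for z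
      using s'(2)[OF that] s(2) that by auto
    show "matching_turn z N - matching_turn z M = (if z \<in> F then s' * s else 0)"
      if "F \<in> finite_faces G \<gamma>" "is_periphery \<gamma> (sym_diff M N) F" "z \<notin> drawing G \<gamma>" for F z
      using s'(2)[OF that(3)] s(3)[rule_format, OF that] by auto
  qed
qed

text \<open>Which of the two cycle edges at a vertex belongs to \<open>L\<close> is propagated around the cycle by
  uniqueness.\<close>

lemma cycle_two_matchings:
  assumes M: "perfect_matching G M" and N: "perfect_matching G N" and L: "perfect_matching G L"
    and C: "is_cycle_edge_set G (sym_diff M N)" and sub: "L \<subseteq> M \<union> N"
  shows "L = M \<or> L = N"
proof -
  obtain vs where vs: "distinct vs" "length vs \<ge> 3"
    and C': "sym_diff M N = {{vs ! i, vs ! (Suc i mod length vs)} | i. i < length vs}"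
    using C unfolding is_cycle_edge_set_def by blast
  let ?n = "length vs"
  define e where "e = (\<lambda>i. {vs ! i, vs ! (Suc i mod ?n)})"
  note alt = cycle_alternates[OF M N vs C' e_def]
  have step: "e (Suc i) \<in> L \<longleftrightarrow> e i \<notin> L" if i: "Suc i < ?n" for i
  proof -
    have ei: "e i = {vs ! i, vs ! Suc i}" using i by (simp add: e_def)
    have v: "vs ! Suc i \<in> e i" "vs ! Suc i \<in> e (Suc i)" by (simp add: ei) (simp add: e_def)
    have ne: "e i \<noteq> e (Suc i)" using inj_onD[OF alt(1), of i "Suc i"] i by auto
    have "vs ! Suc i \<in> verts G" using alt(5)[OF i] v(2) edge_subset by blast
    then obtain f where f: "f \<in> L" "vs ! Suc i \<in> f" using matching_covers[OF L] by metis
    have "f = e i \<or> f = e (Suc i)"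
    proof (cases "e i \<in> N")
      case True
      then have "e (Suc i) \<in> M" using alt(2)[OF i] alt(4)[OF i] by blast
      then show ?thesis
        using matching_unique[OF N True _ v(1) f(2)] matching_unique[OF M _ _ v(2) f(2)] f(1) sub by
          blast
    next
      case False
      then have "e (Suc i) \<in> N" "e i \<in> M" using alt(2)[OF i] alt(4)[of i] i by auto
      then show ?thesis
        using matching_unique[OF N _ _ v(2) f(2)] matching_unique[OF M _ _ v(1) f(2)] f(1) sub by
          blast
    qed
    then show ?thesis using f(1) ne matching_unique[OF L _ _ v] by blast
  qed
  have same: "(e i \<in> L \<longleftrightarrow> e i \<in> N) \<longleftrightarrow> (e 0 \<in> L \<longleftrightarrow> e 0 \<in> N)" if "i < ?n" for i
    using that
  proof (induction i)
    case (Suc i)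
    then show ?case using alt(2)[OF Suc.prems] step[OF Suc.prems] by simp
  qed simp
  have cyc: "\<exists>i<?n. f = e i" if "f \<in> sym_diff M N" for f
    using that unfolding C' e_def by blast
  show ?thesis
  proof (cases "e 0 \<in> L \<longleftrightarrow> e 0 \<in> N")
    case True
    have "L \<subseteq> N"
    proof
      fix f assume f: "f \<in> L"
      show "f \<in> N"
      proof (rule ccontr)
        assume "f \<notin> N"
        then obtain i where "i < ?n" "f = e i" using cyc f sub by blast
        then show False using same True f \<open>f \<notin> N\<close> by blast
      qed
    qed
    then show ?thesis using matching_subset_eq[OF L N] by blast
  next
    case False
    have "L \<subseteq> M"
    proof
      fix f assume f: "f \<in> L"
      show "f \<in> M"
      proof (rule ccontr)
        assume "f \<notin> M"
        then obtain i where i: "i < ?n" "f = e i" using cyc f sub by blast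
        then show False using same[OF i(1)] False f \<open>f \<notin> M\<close> alt(4)[OF i(1)] by blast
      qed
    qed
    then show ?thesis using matching_subset_eq[OF L M] by blast
  qed
qed

text \<open>One may follow \<open>N\<close> on \<open>Q\<close> and \<open>M\<close> elsewhere if no partner is used twice; counting then
  shows that no partner is left out.\<close>

lemma matching_splice:
  assumes M: "perfect_matching G M" and N: "perfect_matching G N" and Q: "Q \<subseteq> A"
    and closed: "\<forall>a\<in>Q. \<forall>a'\<in>A. mate M a' = mate N a \<longrightarrow> a' \<in> Q"
  shows "\<exists>L. perfect_matching G L \<and> L \<subseteq> M \<union> N \<and>
    (\<forall>a\<in>A. mate L a = (if a \<in> Q then mate N a else mate M a))"
proof -
  define h where "h x = (if x \<in> Q then mate N x else mate M x)" for x
  have Mi: "inj_on (mate M) A" and Ni: "inj_on (mate N) A"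
    using mate_bij M N bij_betw_imp_inj_on by blast+
  have h_inj: "inj_on h A"
  proof (rule inj_onI)
    have mixed: False if "x \<in> A" "y \<in> A" "x \<in> Q" "y \<notin> Q" "mate N x = mate M y" for x y
      using closed that by metis
    fix x y assume "x \<in> A" "y \<in> A" "h x = h y"
    then show "x = y"
      using mixed[of x y] mixed[of y x] inj_onD[OF Mi, of x y] inj_onD[OF Ni, of x y]
      by (auto simp: h_def split: if_splits)
  qed
  have hB: "h x \<in> B" if "x \<in> A" for x
    using mate_edge(2)[OF M that] mate_edge(2)[OF N that] by (simp add: h_def)
  have "h ` A = B"
  proof (rule card_subset_eq)
    show "card (h ` A) = card B"
      using card_image[OF h_inj] bij_betw_same_card[OF mate_bij[OF M]] by simp
  qed (use finite_parts hB in auto)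
  then have bij: "bij_betw h A B" using h_inj by (simp add: bij_betw_def)
  have MN: "{x, h x} \<in> M \<union> N" if "x \<in> A" for x
    using mate_edge(1)[OF M that] mate_edge(1)[OF N that] by (simp add: h_def)
  then have E: "{x, h x} \<in> edges G" if "x \<in> A" for x
    using that matching_edges M N by blast
  show ?thesis
  proof (rule exI[of _ "(\<lambda>x. {x, h x}) ` A"], intro conjI ballI)
    show "perfect_matching G ((\<lambda>x. {x, h x}) ` A)" by (rule matching_of_bij(1)[OF bij]) (rule E)
    show "(\<lambda>x. {x, h x}) ` A \<subseteq> M \<union> N" using MN by blast
    show "mate ((\<lambda>x. {x, h x}) ` A) a = (if a \<in> Q then mate N a else mate M a)" if "a \<in> A" for a
      using matching_of_bij(2)[OF bij E that] by (simp add: h_def)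
  qed
qed

end

section \<open>Bounded faces admit no potential\<close>

context plane_drawing
begin

lemma winding_log:
  assumes e: "{u, v} \<in> edges G" and z: "z \<notin> drawing G \<gamma>"
  obtains g where "continuous_on (path_image (\<gamma> {u, v})) g"
    "\<And>x. x \<in> path_image (\<gamma> {u, v}) \<Longrightarrow> x - z = exp (g x)"
    "g v - g u = 2 * of_real pi * \<i> * turn z u v"
proof -
  let ?p = "edge_path u v"
  note p = edge_path[OF e]
  have zp: "z \<notin> path_image ?p" using p(4) z image_subset_drawing[OF e] by auto
  obtain q where q: "path q" "pathfinish q - pathstart q = 2 * of_real pi * \<i> * winding_number ?p z"
    "\<And>t. t \<in> {0..1} \<Longrightarrow> ?p t = z + exp (q t)"
    using winding_number_as_continuous_log[OF p(5) zp] by metis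
  obtain h where h: "homeomorphism {0..1} (path_image ?p) ?p h"
    using homeomorphism_arc[OF p(1)] by metis
  have him: "h ` path_image ?p = {0..1}" and hp: "\<And>t. t \<in> {0..1} \<Longrightarrow> h (?p t) = t"
    and ph: "\<And>x. x \<in> path_image ?p \<Longrightarrow> ?p (h x) = x" and hc: "continuous_on (path_image ?p) h"
    using h by (auto simp: homeomorphism_def)
  have hu: "h u = 0" "h v = 1" using hp[of 0] hp[of 1] p(2,3) by (auto simp: pathstart_def
    pathfinish_def)
  show thesis
  proof (rule that[of "q \<circ> h"])
    show "continuous_on (path_image (\<gamma> {u, v})) (q \<circ> h)"
      unfolding p(4)[symmetric] using hc him q(1)
      by (intro continuous_on_compose) (auto simp: path_def)
    show "x - z = exp ((q \<circ> h) x)" if "x \<in> path_image (\<gamma> {u, v})" for x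
    proof -
      have x: "x \<in> path_image ?p" using that p(4) by simp
      then have "h x \<in> {0..1}" using him by blast
      from q(3)[OF this] have "x = z + exp (q (h x))" using ph[OF x] by simp
      then show ?thesis by (metis add_diff_cancel_left' comp_apply)
    qed
    show "(q \<circ> h) v - (q \<circ> h) u = 2 * of_real pi * \<i> * turn z u v"
      using q(2) hu by (simp add: turn_def pathstart_def pathfinish_def)
  qed
qed

text \<open>A potential for the turning numbers around \<open>z\<close> glues the logarithms of \<open>x - z\<close> along the
  edges to a continuous logarithm on the whole drawing; by Borsuk's theorem this is impossible
  if \<open>z\<close> lies in a bounded face.\<close>

lemma no_potential_in_bounded_face:
  assumes F: "F \<in> finite_faces G \<gamma>" "z \<in> F"
    and conn: "\<And>u v. u \<in> verts G \<Longrightarrow> v \<in> verts G \<Longrightarrow> (u, v) \<in> {(x, y). {x, y} \<in> edges G}\<^sup>*"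
    and cover: "\<And>v. v \<in> verts G \<Longrightarrow> \<exists>e\<in>edges G. v \<in> e"
    and pot: "\<And>u v. {u, v} \<in> edges G \<Longrightarrow> turn z u v = \<phi> v - \<phi> u"
  shows False
proof -
  let ?K = "drawing G \<gamma>" and ?c = "2 * of_real pi * \<i>"
  have Fc: "F \<in> components (- ?K)" "bounded F" using F by (auto simp: finite_faces_def)
  have z: "z \<notin> ?K" using Fc(1) F(2) in_components_subset by blast
  have K: "?K = (\<Union>e\<in>edges G. path_image (\<gamma> e))"
  proof -
    have "verts G \<subseteq> (\<Union>e\<in>edges G. path_image (\<gamma> e))"
    proof
      fix v assume "v \<in> verts G"
      then obtain e where "e \<in> edges G" "v \<in> e" using cover by blast
      then show "v \<in> (\<Union>e\<in>edges G. path_image (\<gamma> e))" using image_vertices[of e] by blast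
    qed
    then show ?thesis by (auto simp: drawing_def)
  qed
  have nz: "u - z \<noteq> 0" if "u \<in> verts G" for u using that z by (auto simp: drawing_def)
  \<comment> \<open>The candidate for the exponential of the integration constant; it is the same at all vertices.\<close>
  define c0 where "c0 u = (u - z) * exp (- ?c * \<phi> u)" for u
  have step: "c0 u = c0 v" if e: "{u, v} \<in> edges G" for u v
  proof -
    obtain g where g: "\<And>x. x \<in> path_image (\<gamma> {u, v}) \<Longrightarrow> x - z = exp (g x)"
      "g v - g u = ?c * turn z u v"
      using winding_log[OF e z] by metis
    have "u \<in> path_image (\<gamma> {u, v})" "v \<in> path_image (\<gamma> {u, v})"
      using image_vertices[OF e] by auto
    then have "u - z = exp (g u)" "v - z = exp (g v)" using g(1) by auto
    moreover have "g u - ?c * \<phi> u = g v - ?c * \<phi> v"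
      using g(2) pot[OF e] by (simp add: algebra_simps)
    ultimately show ?thesis by (simp add: c0_def flip: exp_add)
  qed
  have const: "c0 u = c0 v" if "u \<in> verts G" "v \<in> verts G" for u v
    using conn[OF that] by (induction rule: rtrancl_induct) (auto simp: step)
  obtain c where c: "\<And>u. u \<in> verts G \<Longrightarrow> c0 u = exp c"
  proof (cases "verts G = {}")
    case False
    then obtain r where r: "r \<in> verts G" by blast
    then have "exp (Ln (c0 r)) = c0 r" using nz[OF r] by (simp add: c0_def)
    then show thesis using const[OF _ r] by (intro that[of "Ln (c0 r)"]) simp
  qed (use that in auto)
  have log_vertex: "u - z = exp (?c * \<phi> u + c)" if "u \<in> verts G" for u
  proof -
    have "(u - z) * inverse (exp (?c * \<phi> u)) = exp c"
      using c[OF that] unfolding c0_def by (simp add: exp_minus)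
    then have "u - z = exp c * exp (?c * \<phi> u)" by (simp add: field_simps)
    then show ?thesis by (simp add: exp_add mult.commute)
  qed
  have "\<exists>g. continuous_on (path_image (\<gamma> e)) g \<and> (\<forall>x\<in>path_image (\<gamma> e). x - z = exp (g x)) \<and>
      (\<forall>u\<in>e. g u = ?c * \<phi> u + c)" if e: "e \<in> edges G" for e
  proof -
    obtain u v where uv: "e = {u, v}" using edge_card[OF e] by (meson card_2_iff)
    obtain g where g: "continuous_on (path_image (\<gamma> e)) g"
      "\<And>x. x \<in> path_image (\<gamma> e) \<Longrightarrow> x - z = exp (g x)"
      "g v - g u = ?c * turn z u v"
      using winding_log[OF e[unfolded uv] z] unfolding uv by metis
    define d where "d = ?c * \<phi> u + c - g u"
    have "u \<in> verts G" "u \<in> path_image (\<gamma> e)" using image_vertices[OF e] uv by auto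
    then have "exp (g u) = exp (?c * \<phi> u + c)" using g(2) log_vertex by metis
    then have "exp d = 1" unfolding d_def exp_diff by simp
    then have "\<forall>x\<in>path_image (\<gamma> e). x - z = exp (g x + d)" using g(2) by (simp add: exp_add)
    moreover have "\<forall>w\<in>e. g w + d = ?c * \<phi> w + c"
      using g(3) pot[OF e[unfolded uv]] uv by (auto simp: d_def algebra_simps)
    moreover have "continuous_on (path_image (\<gamma> e)) (\<lambda>x. g x + d)"
      by (intro continuous_intros g(1))
    ultimately show ?thesis by blast
  qed
  then obtain g where g: "\<And>e. e \<in> edges G \<Longrightarrow> continuous_on (path_image (\<gamma> e)) (g e)"
    "\<And>e x. e \<in> edges G \<Longrightarrow> x \<in> path_image (\<gamma> e) \<Longrightarrow> x - z = exp (g e x)"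
    "\<And>e u. e \<in> edges G \<Longrightarrow> u \<in> e \<Longrightarrow> g e u = ?c * \<phi> u + c"
    by metis
  obtain L where L: "continuous_map (top_of_set ?K) euclidean L"
    "\<And>x e. e \<in> edges G \<Longrightarrow> x \<in> topspace (top_of_set ?K) \<inter> path_image (\<gamma> e) \<Longrightarrow> L x = g e x"
  proof (rule pasting_lemma_exists_closed[of "edges G" "top_of_set ?K" "\<lambda>e. path_image (\<gamma> e)"
    euclidean g])
    show "finite (edges G)" by (rule finite_edges)
    show "topspace (top_of_set ?K) \<subseteq> (\<Union>e\<in>edges G. path_image (\<gamma> e))" using K by simp
    show "closedin (top_of_set ?K) (path_image (\<gamma> e))" if "e \<in> edges G" for e
      using image_subset_drawing[OF that] arc_edge[OF that]
      by (intro closed_subset closed_path_image arc_imp_path)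
    show "continuous_map (subtopology (top_of_set ?K) (path_image (\<gamma> e))) euclidean (g e)"
      if "e \<in> edges G" for e
      using g(1)[OF that] image_subset_drawing[OF that]
      by (simp add: subtopology_subtopology Int_absorb1)
    show "g e x = g f x" if ef: "e \<in> edges G" "f \<in> edges G"
      and x: "x \<in> topspace (top_of_set ?K) \<inter> path_image (\<gamma> e) \<inter> path_image (\<gamma> f)" for e f x
    proof (cases "e = f")
      case False
      then have "x \<in> e \<inter> f" using image_Int[OF ef] x by blast
      then show ?thesis using g(3) ef by simp
    qed simp
  qed (rule that; simp)
  have Lc: "continuous_on ?K L" using L(1) by simp
  have Llog: "x - z = exp (L x)" if x: "x \<in> ?K" for x
  proof -
    obtain e where e: "e \<in> edges G" "x \<in> path_image (\<gamma> e)" using x K by blast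
    then have "L x = g e x" using L(2) x by simp
    then show ?thesis using g(2)[OF e] by simp
  qed
  have "inverse (norm (x - z)) *\<^sub>R (x - z) = exp (\<i> * of_real (Im (L x)))" if "x \<in> ?K" for x
  proof -
    have "norm (x - z) = exp (Re (L x))" using Llog[OF that] by simp
    moreover have "exp (L x) = of_real (exp (Re (L x))) * exp (\<i> * of_real (Im (L x)))"
      by (metis complex_eq exp_add exp_of_real)
    ultimately show ?thesis using Llog[OF that] by (simp add: scaleR_conv_of_real)
  qed
  moreover have "continuous_on ?K (\<lambda>x. Im (L x))" by (intro continuous_intros Lc)
  ultimately have "\<exists>a. homotopic_with_canon (\<lambda>h. True) ?K (sphere 0 1)
      (\<lambda>x. inverse (norm (x - z)) *\<^sub>R (x - z)) (\<lambda>t. a)"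
    unfolding inessential_eq_continuous_logarithm_circle by (intro exI[of _ "\<lambda>x. Im (L x)"]) simp
  moreover have "connected_component_set (- ?K) z = F"
    using Fc(1) F(2) by (metis components_iff connected_component_eq)
  ultimately show False
    using Borsuk_map_essential_bounded_component[OF compact_drawing z] Fc(2) by simp
qed

end

context plane_bipartite
begin

text \<open>Alternating between the two matchings from a vertex where they differ runs through a
  cycle. Switching to \<open>N\<close> on this cycle alone gives a perfect matching other than \<open>M\<close>, hence
  \<open>N\<close>, so there is no other cycle.\<close>

lemma cycle_of_two_matchings:
  assumes M: "perfect_matching G M" and N: "perfect_matching G N" and ne: "M \<noteq> N"
    and two: "\<And>L. perfect_matching G L \<Longrightarrow> L \<subseteq> M \<union> N \<Longrightarrow> L = M \<or> L = N"
  shows "is_cycle_edge_set G (sym_diff M N)"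
proof -
  let ?f = "mate M" and ?g = "mate N"
  note f = mate_bij[OF M] and g = mate_bij[OF N]
  have fi: "inj_on ?f A" and gi: "inj_on ?g A" using f g bij_betw_imp_inj_on by blast+
  define t where "t = (\<lambda>a. inv_into A ?f (?g a))"
  have t: "bij_betw t A A"
    using bij_betw_trans[OF g bij_betw_inv_into[OF f]] by (simp add: t_def o_def)
  have tA: "t x \<in> A" if "x \<in> A" for x using t that bij_betwE by blast
  have ft: "?f (t x) = ?g x" if "x \<in> A" for x
    using f mate_edge(2)[OF N that] by (simp add: t_def bij_betw_inv_into_right)
  obtain a0 where a0: "a0 \<in> A" "?f a0 \<noteq> ?g a0"
    using matching_eqI[OF M N] ne by blast
  obtain m where m: "m > 0" "(t ^^ m) a0 = a0" "inj_on (\<lambda>k. (t ^^ k) a0) {..<m}"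
    using orbit_cycle[OF finite_parts(1) t a0(1)] by metis
  define a where "a k = (t ^^ k) a0" for k
  have aA: "a k \<in> A" for k unfolding a_def by (induction k) (use a0(1) tA in auto)
  have a_Suc: "a (Suc k) = t (a k)" for k by (simp add: a_def)
  have a_m: "a m = a 0" using m(2) by (simp add: a_def)
  have a_inj: "a i = a j \<longleftrightarrow> i = j" if "i < m" "j < m" for i j
    using inj_onD[OF m(3), of i j] that by (auto simp: a_def)
  have f_Suc: "?f (a (Suc k)) = ?g (a k)" for k using ft[OF aA] a_Suc by simp
  have m2: "m \<ge> 2"
  proof (rule ccontr)
    assume "\<not> m \<ge> 2"
    then have "m = 1" using m(1) by simp
    then have "?f (a 0) = ?g (a 0)" using f_Suc[of 0] a_m by simp
    then show False using a0(2) by (simp add: a_def)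
  qed
  have moved: "?f (a k) \<noteq> ?g (a k)" if "k < m" for k
  proof
    assume "?f (a k) = ?g (a k)"
    then have "a (Suc k) = a k" using f_Suc[of k] inj_onD[OF fi _ aA aA, of "Suc k" k] by simp
    then show False
      using a_inj[of "Suc k" k] a_inj[of 0 k] a_m that m2 by (cases "Suc k = m") auto
  qed
  have moved_Suc: "?f (a (Suc k)) \<noteq> ?g (a (Suc k))" if "k < m" for k
    using moved[of "Suc k"] moved[of 0] a_m m(1) that by (cases "Suc k = m") auto
  define Q where "Q = a ` {..<m}"
  have a0Q: "a0 \<in> Q"
    unfolding Q_def by (rule image_eqI[of _ _ 0]) (use m(1) in \<open>simp_all add: a_def\<close>)
  have tQ: "t x \<in> Q" if x: "x \<in> Q" for x
  proof -
    obtain k where k: "k < m" "x = a k" using x unfolding Q_def by blast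
    then have "t x = a (if Suc k = m then 0 else Suc k)" using a_Suc[of k] a_m by auto
    then show ?thesis using k(1) by (auto simp: Q_def)
  qed
  have closed: "\<forall>x\<in>Q. \<forall>y\<in>A. ?f y = ?g x \<longrightarrow> y \<in> Q"
  proof (intro ballI impI)
    fix x y assume x: "x \<in> Q" and y: "y \<in> A" "?f y = ?g x"
    have xA: "x \<in> A" using x aA unfolding Q_def by blast
    have "y = t x" using inj_onD[OF fi _ y(1) tA[OF xA]] y(2) ft[OF xA] by simp
    then show "y \<in> Q" using tQ[OF x] by simp
  qed
  have QA: "Q \<subseteq> A" using aA unfolding Q_def by blast
  obtain L where L: "perfect_matching G L" "L \<subseteq> M \<union> N"
    "\<And>x. x \<in> A \<Longrightarrow> mate L x = (if x \<in> Q then ?g x else ?f x)"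
    using matching_splice[OF M N QA closed] by blast
  have "L \<noteq> M" using L(3)[OF a0(1)] a0Q a0(2) by auto
  then have "L = N" using two[OF L(1,2)] by blast
  then have off: "?f x = ?g x" if "x \<in> A" "x \<notin> Q" for x
    using L(3)[OF that(1)] that(2) by simp
  \<comment> \<open>The cycle alternates between the orbit in \<open>A\<close> and its partners under \<open>N\<close>.\<close>
  define w where "w j = (if even j then a (j div 2) else ?g (a (j div 2)))" for j
  define vs where "vs = map w [0..<2 * m]"
  have len: "length vs = 2 * m" by (simp add: vs_def)
  have w: "w (2 * k) = a k" "w (Suc (2 * k)) = ?g (a k)" for k by (simp_all add: w_def)
  have nth: "vs ! j = w j" if "j < 2 * m" for j using that by (simp add: vs_def)
  have cases2: "\<exists>k<m. j = 2 * k \<or> j = Suc (2 * k)" if "j < 2 * m" for j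
    using that by (intro exI[of _ "j div 2"]) auto
  have "inj_on w {0..<2 * m}"
  proof (rule inj_onI)
    fix i j assume ij: "i \<in> {0..<2 * m}" "j \<in> {0..<2 * m}" "w i = w j"
    obtain k l where kl: "k < m" "i = 2 * k \<or> i = Suc (2 * k)" "l < m" "j = 2 * l \<or> j = Suc (2 * l)"
      using cases2[of i] cases2[of j] ij(1,2) unfolding atLeastLessThan_iff by metis
    have "a k \<noteq> ?g (a l)" "a l \<noteq> ?g (a k)"
      using aA[of k] aA[of l] mate_edge(2)[OF N aA, of k] mate_edge(2)[OF N aA, of l] parts(1) by auto
    then show "i = j"
      using kl ij(3) w a_inj[OF kl(1,3)] inj_onD[OF gi _ aA aA, of k l] by auto
  qed
  then have dist: "distinct vs" by (simp add: vs_def distinct_map)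
  have e_even: "{vs ! (2 * k), vs ! (Suc (2 * k) mod (2 * m))} = {a k, ?g (a k)}" if "k < m" for k
    using that by (simp add: nth w)
  have e_odd: "{vs ! Suc (2 * k), vs ! (Suc (Suc (2 * k)) mod (2 * m))} =
      {a (Suc k), ?f (a (Suc k))}" if k: "k < m" for k
  proof (cases "Suc k = m")
    case True
    then have "Suc (Suc (2 * k)) = 2 * m" by simp
    then have "Suc (Suc (2 * k)) mod (2 * m) = 2 * 0" by simp
    moreover have "vs ! (2 * 0) = a 0" using nth[of "2 * 0"] w(1)[of 0] m(1) by simp
    moreover have "vs ! Suc (2 * k) = ?f (a (Suc k))" using nth w(2) f_Suc k by simp
    ultimately show ?thesis using True a_m by (metis insert_commute)
  next
    case False
    then have "Suc (Suc (2 * k)) mod (2 * m) = 2 * Suc k" using k by simp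
    moreover have "vs ! (2 * Suc k) = a (Suc k)" using nth[of "2 * Suc k"] w(1)[of "Suc k"] k False
      by simp
    moreover have "vs ! Suc (2 * k) = ?f (a (Suc k))" using nth w(2) f_Suc k by simp
    ultimately show ?thesis by (metis insert_commute)
  qed
  have "sym_diff M N = {{vs ! i, vs ! (Suc i mod length vs)} | i. i < length vs}"
    (is "_ = ?C")
  proof (intro equalityI subsetI)
    fix e assume "e \<in> sym_diff M N"
    then consider "e \<in> M" "e \<notin> N" | "e \<in> N" "e \<notin> M" by blast
    then show "e \<in> ?C"
    proof cases
      case 1
      then obtain x where x: "x \<in> A" "e = {x, ?f x}" using matching_eq_image[OF M] by blast
      then have "?f x \<noteq> ?g x" using 1(2) mate_edge(1)[OF N x(1)] by auto
      then have "x \<in> Q" using off[OF x(1)] by blast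
      then obtain k where k: "k < m" "x = a k" unfolding Q_def by blast
      obtain l where l: "l < m" "x = a (Suc l)"
      proof (cases k)
        case 0
        then show thesis using that[of "m - 1"] k a_m m(1) by simp
      next
        case (Suc l)
        then show thesis using that[of l] k by simp
      qed
      then have "e = {vs ! Suc (2 * l), vs ! (Suc (Suc (2 * l)) mod length vs)}"
        using e_odd[OF l(1)] x(2) len by simp
      moreover have "Suc (2 * l) < length vs" using l(1) len by simp
      ultimately show ?thesis by blast
    next
      case 2
      then obtain x where x: "x \<in> A" "e = {x, ?g x}" using matching_eq_image[OF N] by blast
      then have "?f x \<noteq> ?g x" using 2(2) mate_edge(1)[OF M x(1)] by auto
      then have "x \<in> Q" using off[OF x(1)] by blast
      then obtain k where k: "k < m" "x = a k" unfolding Q_def by blast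
      then have "e = {vs ! (2 * k), vs ! (Suc (2 * k) mod length vs)}"
        using e_even[OF k(1)] x(2) len by simp
      moreover have "2 * k < length vs" using k(1) len by simp
      ultimately show ?thesis by blast
    qed
  next
    fix e assume "e \<in> ?C"
    then obtain j where j: "j < 2 * m" "e = {vs ! j, vs ! (Suc j mod (2 * m))}" using len by auto
    then obtain k where k: "k < m" "j = 2 * k \<or> j = Suc (2 * k)" using cases2 by blast
    from k(2) show "e \<in> sym_diff M N"
    proof
      assume "j = 2 * k"
      then have e: "e = {a k, ?g (a k)}" using e_even[OF k(1)] j(2) by simp
      have "e \<in> N" using mate_edge(1)[OF N aA] e by simp
      moreover have "e \<notin> M" using mate_eq[OF M, of "a k" "?g (a k)"] moved[OF k(1)] e by auto
      ultimately show ?thesis by blast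
    next
      assume "j = Suc (2 * k)"
      then have e: "e = {a (Suc k), ?f (a (Suc k))}" using e_odd[OF k(1)] j(2) by simp
      have "e \<in> M" using mate_edge(1)[OF M aA] e by simp
      moreover have "e \<notin> N"
        using mate_eq[OF N, of "a (Suc k)" "?f (a (Suc k))"] moved_Suc[OF k(1)] e by auto
      ultimately show ?thesis by blast
    qed
  qed
  moreover have "sym_diff M N \<subseteq> edges G" using matching_edges M N by blast
  moreover have "length vs \<ge> 3" using len m2 by simp
  ultimately show ?thesis unfolding is_cycle_edge_set_def using dist by blast
qed

end

section \<open>Trees with few maximal independent sets\<close>

text \<open>Each vertex but the root has an edge to a vertex nearer to the root, and different
  vertices have different such edges.\<close>

lemma connected_card_edges:
  assumes fin: "finite V" "finite E"
    and conn: "\<And>u v. u \<in> V \<Longrightarrow> v \<in> V \<Longrightarrow> (u, v) \<in> {(x, y). {x, y} \<in> E}\<^sup>*"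
  shows "card V \<le> Suc (card E)"
proof (cases "V = {}")
  case False
  then obtain r where r: "r \<in> V" by blast
  let ?R = "{(x, y). {x, y} \<in> E}"
  define dist where "dist v = (LEAST n. (r, v) \<in> ?R ^^ n)" for v
  have dist: "(r, v) \<in> ?R ^^ dist v" if "(r, v) \<in> ?R\<^sup>*" for v
    unfolding dist_def using that by (meson LeastI_ex rtrancl_power)
  have parent: "\<exists>u. {u, v} \<in> E \<and> dist u < dist v" if v: "v \<in> V - {r}" for v
  proof -
    have v': "(r, v) \<in> ?R ^^ dist v" using dist conn[OF r] v by blast
    then obtain k where k: "dist v = Suc k" using v by (cases "dist v") auto
    then obtain u where u: "(r, u) \<in> ?R ^^ k" "{u, v} \<in> E" using v' by auto
    then have "dist u \<le> k" unfolding dist_def by (simp add: Least_le)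
    with k u show ?thesis by (intro exI[of _ u]) simp
  qed
  then obtain par where par: "\<And>v. v \<in> V - {r} \<Longrightarrow> {par v, v} \<in> E \<and> dist (par v) < dist v"
    by metis
  have "inj_on (\<lambda>v. {par v, v}) (V - {r})"
  proof (rule inj_onI)
    fix v w assume vw: "v \<in> V - {r}" "w \<in> V - {r}" "{par v, v} = {par w, w}"
    show "v = w"
    proof (rule ccontr)
      assume "v \<noteq> w"
      then have "par v = w" "par w = v" using vw(3) by (auto simp: doubleton_eq_iff)
      then show False using par[OF vw(1)] par[OF vw(2)] by simp
    qed
  qed
  then have "card (V - {r}) \<le> card E"
    using par fin(2) by (intro card_inj_on_le[of "\<lambda>v. {par v, v}"]) auto
  then show ?thesis using fin(1) r by simp
qed simp

text \<open>Connectedness is stated for sets closed under adjacency, acyclicity as every edge being a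
  bridge: both forms are used directly.\<close>

locale tree_graph =
  fixes V :: "'a set" and adj :: "'a \<Rightarrow> 'a \<Rightarrow> bool"
  assumes finite_V: "finite V" and V_nonempty: "V \<noteq> {}"
    and adj_sym: "adj u v \<Longrightarrow> adj v u" and adj_irrefl: "\<not> adj u u" and adj_V: "adj u v \<Longrightarrow> u \<in> V"
    and closed_eq_V: "S \<subseteq> V \<Longrightarrow> S \<noteq> {} \<Longrightarrow> (\<And>u v. u \<in> S \<Longrightarrow> adj u v \<Longrightarrow> v \<in> S) \<Longrightarrow> S = V"
    and bridge: "adj u v \<Longrightarrow> (u, v) \<notin> {(x, y). adj x y \<and> {x, y} \<noteq> {u, v}}\<^sup>*"
begin

abbreviation without :: "'a \<Rightarrow> 'a \<Rightarrow> ('a \<times> 'a) set" where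
  "without u v \<equiv> {(x, y). adj x y \<and> {x, y} \<noteq> {u, v}}"

lemma bridge': "adj u v \<Longrightarrow> (v, u) \<notin> (without u v)\<^sup>*"
  using bridge[OF adj_sym, of u v] by (simp add: insert_commute)

text \<open>Walks that never turn back at once. In a tree they are paths.\<close>

fun straight :: "'a list \<Rightarrow> bool" where
  "straight (x # y # z # xs) \<longleftrightarrow> adj x y \<and> x \<noteq> z \<and> straight (y # z # xs)"
| "straight [x, y] \<longleftrightarrow> adj x y"
| "straight xs \<longleftrightarrow> True"

text \<open>A straight walk never recrosses its first edge: the part beyond the second edge avoids the
  second vertex, because the second edge is a bridge.\<close>

lemma straight_reaches:
  "straight (u # v # xs) \<Longrightarrow> (v, last (v # xs)) \<in> (without u v)\<^sup>*"
proof (induction xs arbitrary: u v)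
  case (Cons w xs)
  have uv: "adj u v" "u \<noteq> w" and s: "straight (v # w # xs)" using Cons.prems by auto
  have vw: "adj v w" using s by (cases xs) auto
  have "(w, x) \<in> (without u v)\<^sup>* \<and> x \<noteq> v" if "(w, x) \<in> (without v w)\<^sup>*" for x
    using that
  proof (induction rule: rtrancl_induct)
    case base
    then show ?case using vw adj_irrefl by auto
  next
    case (step y z)
    have "(w, z) \<in> (without v w)\<^sup>*" using step.hyps by (rule rtrancl_into_rtrancl)
    then have z: "z \<noteq> v" using bridge'[OF vw] by auto
    have "adj y z" "{y, z} \<noteq> {u, v}" using step.hyps(2) step.IH z by (auto simp: doubleton_eq_iff)
    then have yz: "(y, z) \<in> without u v" by simp
    show ?case using rtrancl_into_rtrancl[OF conjunct1[OF step.IH] yz] z by (rule conjI)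
  qed
  then have "(w, last (w # xs)) \<in> (without u v)\<^sup>*" using Cons.IH[OF s] by blast
  moreover have "(v, w) \<in> without u v" using vw uv adj_irrefl by (auto simp: doubleton_eq_iff)
  ultimately show ?case by (simp add: converse_rtrancl_into_rtrancl)
qed simp

lemma straight_last_neq: "straight (u # v # xs) \<Longrightarrow> last (v # xs) \<noteq> u"
proof
  assume s: "straight (u # v # xs)" and "last (v # xs) = u"
  moreover have "adj u v" using s by (cases xs) auto
  ultimately show False using straight_reaches[OF s] bridge' by simp
qed

lemma straight_last_nonadj:
  assumes s: "straight (u # v # w # xs)"
  shows "\<not> adj u (last (w # xs))"
proof
  let ?l = "last (w # xs)"
  assume "adj u ?l"
  have uv: "adj u v" and s': "straight (v # w # xs)" using s by auto
  have "?l \<noteq> v" "?l \<noteq> u" using straight_last_neq[OF s'] straight_last_neq[OF s] by auto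
  then have "(?l, u) \<in> without u v" using adj_sym[OF \<open>adj u ?l\<close>] by (auto simp: doubleton_eq_iff)
  moreover have "(v, ?l) \<in> (without u v)\<^sup>*" using straight_reaches[OF s] by simp
  ultimately have "(v, u) \<in> (without u v)\<^sup>*" by (rule rtrancl_into_rtrancl[rotated])
  then show False using bridge'[OF uv] by blast
qed

text \<open>Both directions are recorded, as the simplifier does not know that adjacency is
  symmetric.\<close>

definition apart :: "'a \<Rightarrow> 'a \<Rightarrow> bool" where
  "apart u v \<longleftrightarrow> u \<noteq> v \<and> \<not> adj u v \<and> \<not> adj v u"

lemma straight3: "straight [a, b, c] \<Longrightarrow> apart a c"
  using straight_last_neq[of a b "[c]"] straight_last_nonadj[of a b c "[]"] adj_sym[of c a]
  by (auto simp: apart_def)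

lemma straight4: "straight [a, b, c, d] \<Longrightarrow> apart a d"
  using straight_last_neq[of a b "[c, d]"] straight_last_nonadj[of a b c "[d]"] adj_sym[of d a]
  by (auto simp: apart_def)

lemma straight5: "straight [a, b, c, d, e] \<Longrightarrow> apart a e"
  using straight_last_neq[of a b "[c, d, e]"] straight_last_nonadj[of a b c "[d, e]"] adj_sym[of e a]
  by (auto simp: apart_def)

lemma straight6: "straight [a, b, c, d, e, f] \<Longrightarrow> apart a f"
  using straight_last_neq[of a b "[c, d, e, f]"] straight_last_nonadj[of a b c "[d, e, f]"]
    adj_sym[of f a]
  by (auto simp: apart_def)

lemma straight7: "straight [a, b, c, d, e, f, g] \<Longrightarrow> apart a g"
  using straight_last_neq[of a b "[c, d, e, f, g]"] straight_last_nonadj[of a b c "[d, e, f, g]"]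
    adj_sym[of g a]
  by (auto simp: apart_def)

definition indep :: "'a set \<Rightarrow> bool" where
  "indep S \<longleftrightarrow> S \<subseteq> V \<and> (\<forall>u\<in>S. \<forall>v\<in>S. \<not> adj u v)"

definition max_indep :: "'a set \<Rightarrow> bool" where
  "max_indep S \<longleftrightarrow> indep S \<and> (\<forall>v\<in>V - S. \<exists>u\<in>S. adj u v)"

lemma finite_max_indep: "finite {S. max_indep S}"
  by (rule finite_subset[of _ "Pow V"]) (use finite_V in \<open>auto simp: max_indep_def indep_def\<close>)

lemma max_indep_extends:
  assumes "indep S"
  obtains T where "S \<subseteq> T" "max_indep T"
proof -
  let ?C = "{T. indep T \<and> S \<subseteq> T}"
  have "finite ?C"
    by (rule finite_subset[of _ "Pow V"]) (use finite_V in \<open>auto simp: indep_def\<close>)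
  moreover have "S \<in> ?C" using assms by simp
  ultimately obtain T where T: "T \<in> ?C" "\<And>T'. T' \<in> ?C \<Longrightarrow> T \<subseteq> T' \<Longrightarrow> T' = T"
    using finite_has_maximal2[of ?C S] by metis
  have "\<exists>u\<in>T. adj u v" if v: "v \<in> V - T" for v
  proof (rule ccontr)
    assume no: "\<not> (\<exists>u\<in>T. adj u v)"
    then have "indep (insert v T)"
      using T(1) v adj_irrefl adj_sym unfolding indep_def by blast
    then have "insert v T = T" using T by blast
    then show False using v by blast
  qed
  then show thesis using T(1) by (intro that[of T]) (auto simp: max_indep_def)
qed

definition clash :: "'a set \<Rightarrow> 'a set \<Rightarrow> bool" where
  "clash S T \<longleftrightarrow> (\<exists>u\<in>S. \<exists>v\<in>T. adj u v)"

text \<open>Extending the sets to maximal independent ones keeps them different, since two clashing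
  sets have no common independent superset.\<close>

lemma clashing_family:
  assumes "\<And>S. S \<in> set Ss \<Longrightarrow> indep S" "sorted_wrt clash Ss"
  shows "length Ss \<le> card {S. max_indep S}"
proof -
  have "\<exists>T. S \<subseteq> T \<and> max_indep T" if "S \<in> set Ss" for S
    by (rule max_indep_extends[OF assms(1)[OF that]]) blast
  then obtain ext where ext: "\<And>S. S \<in> set Ss \<Longrightarrow> S \<subseteq> ext S \<and> max_indep (ext S)"
    by metis
  have neq: "ext S \<noteq> ext T" if "S \<in> set Ss" "T \<in> set Ss" "clash S T" for S T
    using ext[OF that(1)] ext[OF that(2)] that(3) unfolding clash_def max_indep_def indep_def by blast
  have "distinct (map ext Ss)"
    unfolding distinct_conv_nth
  proof (intro allI impI)
    fix i j assume ij: "i < length (map ext Ss)" "j < length (map ext Ss)" "i \<noteq> j"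
    have *: "ext (Ss ! i) \<noteq> ext (Ss ! j)" if "i < j" "j < length Ss" for i j
      using neq[of "Ss ! i" "Ss ! j"] sorted_wrt_nth_less[OF assms(2) that] that by simp
    from ij show "map ext Ss ! i \<noteq> map ext Ss ! j"
      using *[of i j] *[of j i] by (cases "i < j") auto
  qed
  then have "length Ss = card (set (map ext Ss))" using distinct_card[of "map ext Ss"] by simp
  also have "\<dots> \<le> card {S. max_indep S}"
    using ext by (intro card_mono finite_max_indep) auto
  finally show ?thesis .
qed

text \<open>Six of the seven maximal independent sets of a path with seven vertices are listed.\<close>

lemma no_long_path:
  assumes few: "card {S. max_indep S} \<le> 5"
  shows "\<not> straight [a, b, c, d, e, f, g]"
proof
  assume s: "straight [a, b, c, d, e, f, g]"
  then have E: "adj a b" "adj b c" "adj c d" "adj d e" "adj e f" "adj f g" by auto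
  note E' = E E[THEN adj_sym]
  have inV: "a \<in> V" "b \<in> V" "c \<in> V" "d \<in> V" "e \<in> V" "f \<in> V" "g \<in> V" using E' adj_V by blast+
  have "apart a c" "apart b d" "apart c e" "apart d f" "apart e g"
    using s E'
      straight3[of a b c] straight3[of b c d] straight3[of c d e] straight3[of d e f] straight3[of e
        f g] by auto
  moreover have "apart a d" "apart b e" "apart c f" "apart d g"
    using s E'
      straight4[of a b c d] straight4[of b c d e] straight4[of c d e f] straight4[of d e f g] by auto
  moreover have "apart a e" "apart b f" "apart c g"
    using s E'
      straight5[of a b c d e] straight5[of b c d e f] straight5[of c d e f g] by auto
  moreover have "apart a f" "apart b g"
    using s E'
      straight6[of a b c d e f] straight6[of b c d e f g] by auto
  moreover have "apart a g"
    using s E'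
      straight7[of a b c d e f g] by auto
  ultimately have "indep {a, c, e, g}" "indep {a, c, f}" "indep {a, d, f}" "indep {a, d, g}"
    "indep {b, d, f}" "indep {b, d, g}"
    using inV adj_irrefl by (simp_all add: indep_def apart_def)
  moreover have "sorted_wrt clash [{a, c, e, g}, {a, c, f}, {a, d, f}, {a, d, g}, {b, d, f}, {b, d,
    g}]"
    using E' by (simp add: clash_def)
  ultimately have "length [{a, c, e, g}, {a, c, f}, {a, d, f}, {a, d, g}, {b, d, f}, {b, d, g}]
      \<le> card {S. max_indep S}"
    by (intro clashing_family) auto
  then show False using few by simp
qed

text \<open>The six sets are the maximal independent sets of the path with a further neighbour \<open>l\<close> of
  \<open>x\<close>, two with \<open>x\<close> and four with \<open>l\<close>.\<close>

lemma no_branched_path: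
  assumes few: "card {S. max_indep S} \<le> 5" and s: "straight [a, u, x, y, v, b]"
    and l: "adj x l" "l \<noteq> u" "l \<noteq> y"
  shows False
proof -
  have E: "adj a u" "adj u x" "adj x y" "adj y v" "adj v b" "adj x l" using s l by auto
  note E' = E E[THEN adj_sym]
  have inV: "a \<in> V" "u \<in> V" "x \<in> V" "y \<in> V" "v \<in> V" "b \<in> V" "l \<in> V" using E' adj_V by blast+
  have "apart x a" "apart x v" "apart b y" "apart l u" "apart l y" "apart u y"
    using s l E'
      straight3[of x u a] straight3[of x y v] straight3[of b v y] straight3[of l x u] straight3[of l
        x y] straight3[of u x y] by auto
  moreover have "apart x b" "apart a l" "apart a y" "apart v l" "apart v u"
    using s l E'
      straight4[of x y v b] straight4[of a u x l] straight4[of a u x y] straight4[of v y x l]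
        straight4[of v y x u] by auto
  moreover have "apart a v" "apart b l" "apart b u"
    using s l E'
      straight5[of a u x y v] straight5[of b v y x l] straight5[of b v y x u] by auto
  moreover have "apart a b"
    using s l E'
      straight6[of a u x y v b] by auto
  ultimately have "indep {x, a, v}" "indep {x, a, b}" "indep {l, a, y, b}" "indep {l, u, y, b}"
    "indep {l, a, v}" "indep {l, u, v}"
    using inV adj_irrefl by (simp_all add: indep_def apart_def)
  moreover have "sorted_wrt clash [{x, a, v}, {x, a, b}, {l, a, y, b}, {l, u, y, b}, {l, a, v}, {l,
    u, v}]"
    using E' by (simp add: clash_def)
  ultimately have "length [{x, a, v}, {x, a, b}, {l, a, y, b}, {l, u, y, b}, {l, a, v}, {l, u, v}]
      \<le> card {S. max_indep S}"
    by (intro clashing_family) auto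
  then show False using few by simp
qed

text \<open>Choosing one end from each of three independent edges gives eight sets, of which six are
  listed.\<close>

lemma no_long_claw:
  assumes few: "card {S. max_indep S} \<le> 5"
    and c: "adj c u" "adj c v" "adj c w" "u \<noteq> v" "u \<noteq> w" "v \<noteq> w"
    and l: "adj u u'" "adj v v'" "adj w w'" "u' \<noteq> c" "v' \<noteq> c" "w' \<noteq> c"
  shows False
proof -
  note E' = c(1-3) l(1-3) c(1-3)[THEN adj_sym] l(1-3)[THEN adj_sym]
  have inV: "u \<in> V" "v \<in> V" "w \<in> V" "u' \<in> V" "v' \<in> V" "w' \<in> V" using E' adj_V by blast+
  have "apart u v" "apart u w" "apart v w"
    using c l E'
      straight3[of u c v] straight3[of u c w] straight3[of v c w] by auto
  moreover have "apart u v'" "apart u w'" "apart v u'" "apart v w'" "apart w u'" "apart w v'"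
    using c l E'
      straight4[of u c v v'] straight4[of u c w w'] straight4[of v c u u'] straight4[of v c w w']
        straight4[of w c u u'] straight4[of w c v v'] by auto
  moreover have "apart u' v'" "apart u' w'" "apart v' w'"
    using c l E'
      straight5[of u' u c v v'] straight5[of u' u c w w'] straight5[of v' v c w w'] by auto
  ultimately have "indep {u, v, w}" "indep {u, v, w'}" "indep {u, v', w}" "indep {u, v', w'}"
    "indep {u', v, w}" "indep {u', v, w'}"
    using inV adj_irrefl by (simp_all add: indep_def apart_def)
  moreover have "sorted_wrt clash [{u, v, w}, {u, v, w'}, {u, v', w}, {u, v', w'}, {u', v, w}, {u',
    v, w'}]"
    using E' by (simp add: clash_def)
  ultimately have "length [{u, v, w}, {u, v, w'}, {u, v', w}, {u, v', w'}, {u', v, w}, {u', v, w'}]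
      \<le> card {S. max_indep S}"
    by (intro clashing_family) auto
  then show False using few by simp
qed

text \<open>The vertices of degree at least two; the other vertices of a tree with an edge are its
  leaves.\<close>

definition inner :: "'a set" where
  "inner = {v. \<exists>a b. a \<noteq> b \<and> adj v a \<and> adj v b}"

definition leaves :: "'a \<Rightarrow> 'a set" where
  "leaves u = {l. adj u l \<and> l \<notin> inner}"

lemma inner_subset: "inner \<subseteq> V" using adj_V by (auto simp: inner_def)

lemma other_neighbour: "u \<in> inner \<Longrightarrow> \<exists>b. adj u b \<and> b \<noteq> a"
  by (auto simp: inner_def)

lemma leaves_subset: "leaves u \<subseteq> V" using adj_V adj_sym by (auto simp: leaves_def)

lemma leaf_neighbour_unique: "l \<in> leaves u \<Longrightarrow> adj l w \<Longrightarrow> w = u"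
  using adj_sym by (fastforce simp: leaves_def inner_def)

lemma leaves_disjoint: "u \<noteq> v \<Longrightarrow> leaves u \<inter> leaves v = {}"
  using leaf_neighbour_unique adj_sym by (fastforce simp: leaves_def)

lemma leaves_Int_inner: "leaves u \<inter> inner = {}" by (auto simp: leaves_def)

lemma neighbour_exists:
  assumes "v \<in> V" "card V \<ge> 2"
  obtains w where "adj v w"
proof (rule ccontr)
  assume "\<not> thesis"
  then have "{v} = V" using assms(1) that by (intro closed_eq_V) auto
  then show False using assms(2) by (metis card.empty card_insert_disjoint empty_iff finite.emptyI
        Suc_1 not_less_eq_eq order_refl One_nat_def)
qed

lemma leaf_neighbour_inner:
  assumes big: "card V \<ge> 3" and l: "l \<in> V" "l \<notin> inner" "adj l u"
  shows "u \<in> inner"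
proof (rule ccontr)
  assume u: "u \<notin> inner"
  have "{l, u} = V"
  proof (rule closed_eq_V)
    show "{l, u} \<subseteq> V" using l adj_V adj_sym by blast
    show "y \<in> {l, u}" if "x \<in> {l, u}" "adj x y" for x y
      using that l u adj_sym[OF l(3)] by (auto simp: inner_def)
  qed simp
  moreover have "card {l, u} \<le> 2" by (simp add: card_insert_if)
  ultimately show False using big by simp
qed

lemma V_decomposition:
  assumes big: "card V \<ge> 3"
  shows "V = inner \<union> (\<Union>u\<in>inner. leaves u)"
proof (intro equalityI subsetI)
  fix v assume v: "v \<in> V"
  show "v \<in> inner \<union> (\<Union>u\<in>inner. leaves u)"
  proof (cases "v \<in> inner")
    case False
    obtain w where w: "adj v w" using neighbour_exists[OF v] big by auto
    then have "w \<in> inner" using leaf_neighbour_inner[OF big v False] by blast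
    moreover have "v \<in> leaves w" using w False adj_sym by (auto simp: leaves_def)
    ultimately show ?thesis by blast
  qed simp
qed (use inner_subset leaves_subset in auto)

lemma inner_nonempty: "card V \<ge> 3 \<Longrightarrow> inner \<noteq> {}"
  using V_decomposition V_nonempty by auto

text \<open>With its leaves, a set of inner vertices that is closed within \<open>inner\<close> is closed in the
  whole tree.\<close>

lemma inner_closed:
  assumes big: "card V \<ge> 3" and W: "W \<subseteq> inner" "W \<noteq> {}"
    and cl: "\<And>u v. u \<in> W \<Longrightarrow> v \<in> inner \<Longrightarrow> adj u v \<Longrightarrow> v \<in> W"
  shows "inner = W"
proof -
  have "W \<union> (\<Union>u\<in>W. leaves u) = V"
  proof (rule closed_eq_V)
    show "W \<union> (\<Union>u\<in>W. leaves u) \<subseteq> V" using W inner_subset leaves_subset by blast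
    fix u v assume u: "u \<in> W \<union> (\<Union>u\<in>W. leaves u)" and uv: "adj u v"
    show "v \<in> W \<union> (\<Union>u\<in>W. leaves u)"
    proof (cases "u \<in> W")
      case True
      then show ?thesis using cl[OF True _ uv] uv by (cases "v \<in> inner") (auto simp: leaves_def)
    next
      case False
      then obtain w where w: "w \<in> W" "u \<in> leaves w" using u by blast
      then show ?thesis using leaf_neighbour_unique[OF w(2) uv] by blast
    qed
  qed (use W in blast)
  then show ?thesis using leaves_Int_inner inner_subset W(1) by blast
qed

text \<open>A leaf is added exactly if its neighbour is not chosen.\<close>

definition completion :: "'a set \<Rightarrow> 'a set" where
  "completion J = J \<union> (\<Union>u\<in>inner - J. leaves u)"

lemma completion_inj: "inj_on completion (Pow inner)"
proof (rule inj_onI)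
  have trace: "completion J \<inter> inner = J" if "J \<in> Pow inner" for J
    using that by (auto simp: completion_def leaves_def)
  fix J J' assume J: "J \<in> Pow inner" and J': "J' \<in> Pow inner" and eq: "completion J = completion J'"
  have "J = completion J \<inter> inner" by (rule trace[OF J, symmetric])
  also have "\<dots> = completion J' \<inter> inner" unfolding eq ..
  also have "\<dots> = J'" by (rule trace[OF J'])
  finally show "J = J'" .
qed

text \<open>In a maximal independent set a leaf is present exactly if its neighbour is absent, so the
  set is determined by its inner vertices. The last condition says that the inner vertices left
  out have a leaf or a chosen neighbour.\<close>

lemma max_indep_iff:
  assumes big: "card V \<ge> 3"
  shows "{S. max_indep S} = completion ` {J. J \<subseteq> inner \<and> (\<forall>u\<in>J. \<forall>v\<in>J. \<not> adj u v) \<and>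
    (\<forall>u\<in>inner - J. leaves u \<noteq> {} \<or> (\<exists>w\<in>J. adj w u))}" (is "_ = completion ` ?J")
proof (intro equalityI subsetI)
  fix S assume "S \<in> {S. max_indep S}"
  then have S: "indep S" "\<And>v. v \<in> V \<Longrightarrow> v \<notin> S \<Longrightarrow> \<exists>u\<in>S. adj u v" by (auto simp: max_indep_def)
  let ?K = "S \<inter> inner"
  have leaf: "l \<in> S \<longleftrightarrow> u \<notin> S" if lu: "l \<in> leaves u" for l u
  proof
    assume "l \<in> S"
    then show "u \<notin> S" using S(1) lu by (auto simp: indep_def leaves_def)
  next
    assume u: "u \<notin> S"
    show "l \<in> S"
    proof (rule ccontr)
      assume "l \<notin> S"
      then obtain w where w: "w \<in> S" "adj w l" using S(2)[of l] leaves_subset[of u] lu by blast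
      then have "w = u" using leaf_neighbour_unique[OF lu] adj_sym by blast
      then show False using w(1) u by simp
    qed
  qed
  have "S = completion ?K"
  proof (intro equalityI subsetI)
    fix x assume x: "x \<in> S"
    then have "x \<in> V" using S(1) unfolding indep_def by blast
    then have "x \<in> inner \<union> (\<Union>u\<in>inner. leaves u)"
      using V_decomposition[OF big] by simp
    then show "x \<in> completion ?K" using x leaf by (auto simp: completion_def)
  next
    fix x assume "x \<in> completion ?K"
    then show "x \<in> S" using leaf by (auto simp: completion_def)
  qed
  moreover have "leaves u \<noteq> {} \<or> (\<exists>w\<in>?K. adj w u)" if u: "u \<in> inner - ?K" for u
  proof -
    obtain w where w: "w \<in> S" "adj w u" using S(2)[of u] u inner_subset by blast
    show ?thesis
    proof (cases "w \<in> inner")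
      case False
      then have "w \<in> leaves u" using w adj_sym by (auto simp: leaves_def)
      then show ?thesis by blast
    qed (use w in blast)
  qed
  ultimately show "S \<in> completion ` ?J"
    using S(1) by (intro image_eqI[of _ _ ?K]) (auto simp: indep_def)
next
  fix S assume "S \<in> completion ` ?J"
  then obtain J where J: "S = completion J" "J \<subseteq> inner" "\<And>u v. u \<in> J \<Longrightarrow> v \<in> J \<Longrightarrow> \<not> adj u v"
    "\<And>u. u \<in> inner - J \<Longrightarrow> leaves u \<noteq> {} \<or> (\<exists>w\<in>J. adj w u)" by blast
  have "indep S"
    unfolding indep_def
  proof (intro conjI ballI)
    show "S \<subseteq> V" unfolding J(1) completion_def using J(2) inner_subset leaves_subset by blast
    fix x y assume xy: "x \<in> S" "y \<in> S"
    have lf: "\<not> adj l z" if "l \<in> leaves u" "u \<in> inner - J" "z \<in> S" for l u z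
    proof
      assume "adj l z"
      then have "z = u" using leaf_neighbour_unique[OF that(1)] by simp
      then have "z \<in> inner" "z \<notin> J" using that(2) by auto
      then show False using that(3) leaves_Int_inner unfolding J(1) completion_def by blast
    qed
    show "\<not> adj x y"
      using xy J(3) lf adj_sym unfolding J(1) completion_def by blast
  qed
  moreover have "\<exists>u\<in>S. adj u v" if v: "v \<in> V" "v \<notin> S" for v
  proof (cases "v \<in> inner")
    case True
    then have "v \<in> inner - J" using v(2) J(1) by (auto simp: completion_def)
    with J(4)[OF this] show ?thesis
      unfolding J(1) completion_def using adj_sym by (auto simp: leaves_def)
  next
    case False
    then obtain u where u: "u \<in> inner" "v \<in> leaves u" using v(1) V_decomposition[OF big] by blast
    then have "u \<in> J" using v(2) unfolding J(1) completion_def by blast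
    then show ?thesis using u(2) unfolding J(1) completion_def leaves_def by blast
  qed
  ultimately show "S \<in> {S. max_indep S}" by (auto simp: max_indep_def)
qed

text \<open>A path of four inner vertices extends to a path with six vertices. The forbidden
  configurations then forbid further neighbours of its middle vertices and further inner
  neighbours of its ends. If there is only a path of three inner vertices, its middle vertex has
  no third inner neighbour, as there is no long claw.\<close>

theorem few_max_indep_cases:
  assumes few: "card {S. max_indep S} \<le> 5" and big: "card V \<ge> 3"
  obtains (star) c where "inner = {c}"
  | (double_star) u v where "inner = {u, v}" "adj u v"
  | (triple) u c v where "inner = {u, c, v}" "adj u c" "adj c v" "apart u v"
  | (quadruple) u x y v where "inner = {u, x, y, v}" "adj u x" "adj x y" "adj y v"
      "apart u y" "apart u v" "apart x v" "leaves x = {}" "leaves y = {}"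
proof -
  have path4: thesis
    if s: "straight [u, x, y, v]" and inn: "u \<in> inner" "x \<in> inner" "y \<in> inner" "v \<in> inner" for u x y v
  proof -
    have E: "adj u x" "adj x y" "adj y v" "u \<noteq> y" "x \<noteq> v" using s by auto
    note E' = E(1-3)[THEN adj_sym]
    obtain a where a: "adj u a" "a \<noteq> x" using other_neighbour inn by blast
    obtain b where b: "adj v b" "b \<noteq> y" using other_neighbour inn by blast
    have s1: "straight [a, u, x, y, v, b]" and s2: "straight [b, v, y, x, u, a]"
      using E E' a b adj_sym by auto
    have nx: "l = u \<or> l = y" if "adj x l" for l using no_branched_path[OF few s1 that] by blast
    have ny: "l = v \<or> l = x" if "adj y l" for l using no_branched_path[OF few s2 that] by blast
    have nu: "w = x" if "w \<in> inner" "adj u w" for w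
    proof (rule ccontr)
      assume "w \<noteq> x"
      obtain w' where "adj w w'" "w' \<noteq> u" using other_neighbour[OF \<open>w \<in> inner\<close>] by blast
      then have "straight [w', w, u, x, y, v, b]" using that(2) \<open>w \<noteq> x\<close> E b adj_sym by auto
      then show False using no_long_path[OF few] by blast
    qed
    have nv: "w = y" if "w \<in> inner" "adj v w" for w
    proof (rule ccontr)
      assume "w \<noteq> y"
      obtain w' where "adj w w'" "w' \<noteq> v" using other_neighbour[OF \<open>w \<in> inner\<close>] by blast
      then have "straight [w', w, v, y, x, u, a]" using that(2) \<open>w \<noteq> y\<close> E E' a adj_sym by auto
      then show False using no_long_path[OF few] by blast
    qed
    have "inner = {u, x, y, v}"
    proof (rule inner_closed[OF big])
      show "{u, x, y, v} \<subseteq> inner" using inn by simp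
      fix p q assume "p \<in> {u, x, y, v}" "q \<in> inner" "adj p q"
      then show "q \<in> {u, x, y, v}" using nx[of q] ny[of q] nu[of q] nv[of q] by blast
    qed simp
    moreover have "leaves x = {}" "leaves y = {}" using nx ny inn by (auto simp: leaves_def)
    moreover have "apart u y" "apart x v" using E straight3[of u x y] straight3[of x y v] by simp_all
    moreover have "apart u v" using s by (rule straight4)
    ultimately show thesis using E(1-3) by (metis quadruple)
  qed
  have path3: thesis
    if E: "adj u c" "adj c v" "u \<noteq> v" and inn: "u \<in> inner" "c \<in> inner" "v \<in> inner" for u c v
  proof (cases "\<exists>w\<in>inner. adj u w \<and> w \<noteq> c")
    case True
    then obtain w where "w \<in> inner" "adj u w" "w \<noteq> c" by blast
    then show thesis using path4[of w u c v] E inn adj_sym[of u w] by simp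
  next
    case nu: False
    show thesis
    proof (cases "\<exists>w\<in>inner. adj v w \<and> w \<noteq> c")
      case True
      then obtain w where "w \<in> inner" "adj v w" "w \<noteq> c" by blast
      then show thesis using path4[of w v c u] E inn adj_sym[of v w] adj_sym[of u c] adj_sym[of c v]
        by auto
    next
      case nv: False
      have nc: "w = u \<or> w = v" if "w \<in> inner" "adj c w" for w
      proof (rule ccontr)
        assume w: "\<not> (w = u \<or> w = v)"
        obtain u' where "adj u u'" "u' \<noteq> c" using other_neighbour inn by blast
        moreover obtain v' where "adj v v'" "v' \<noteq> c" using other_neighbour inn by blast
        moreover obtain w' where "adj w w'" "w' \<noteq> c" using other_neighbour[OF \<open>w \<in> inner\<close>] by blast
        ultimately show False
          using no_long_claw[OF few adj_sym[OF E(1)] E(2) that(2) E(3)] w by metis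
      qed
      have "inner = {u, c, v}"
      proof (rule inner_closed[OF big])
        show "{u, c, v} \<subseteq> inner" using inn by simp
        fix p q assume "p \<in> {u, c, v}" "q \<in> inner" "adj p q"
        then show "q \<in> {u, c, v}" using nu nv nc[of q] by blast
      qed simp
      moreover have "apart u v" using straight3[of u c v] E by simp
      ultimately show thesis using E(1,2) by (metis triple)
    qed
  qed
  obtain c where c: "c \<in> inner" using inner_nonempty[OF big] by blast
  show thesis
  proof (cases "\<exists>u\<in>inner. adj c u")
    case False
    have "inner = {c}" by (rule inner_closed[OF big]) (use False c in auto)
    then show thesis by (rule star)
  next
    case True
    then obtain u where u: "u \<in> inner" "adj c u" by blast
    show thesis
    proof (cases "\<exists>w\<in>inner. adj c w \<and> w \<noteq> u \<or> adj u w \<and> w \<noteq> c")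
      case True
      then consider w where "w \<in> inner" "adj c w" "w \<noteq> u" | w where "w \<in> inner" "adj u w" "w \<noteq> c"
        by blast
      then show thesis
      proof cases
        case (1 w)
        then show thesis by (intro path3[of u c w]) (use c u adj_sym in simp_all)
      next
        case (2 w)
        then show thesis by (intro path3[of c u w]) (use c u in simp_all)
      qed
    next
      case False
      have "inner = {c, u}"
      proof (rule inner_closed[OF big])
        show "{c, u} \<subseteq> inner" using c u by simp
        fix p q assume "p \<in> {c, u}" "q \<in> inner" "adj p q"
        then show "q \<in> {c, u}" using False by blast
      qed simp
      then show thesis using double_star[of c u] u(2) by metis
    qed
  qed
qed

end

section \<open>Hypercubes in a daisy cube\<close>

text \<open>Binary strings are handled as the sets of positions of their ones.\<close>

definition string_of :: "nat \<Rightarrow> nat set \<Rightarrow> bool list" where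
  "string_of n S = map (\<lambda>i. i \<in> S) [0..<n]"

definition ones :: "bool list \<Rightarrow> nat set" where
  "ones s = {i. i < length s \<and> s ! i}"

lemma length_string_of [simp]: "length (string_of n S) = n"
  by (simp add: string_of_def)

lemma nth_string_of [simp]: "i < n \<Longrightarrow> string_of n S ! i \<longleftrightarrow> i \<in> S"
  by (simp add: string_of_def)

lemma ones_string_of [simp]: "S \<subseteq> {..<n} \<Longrightarrow> ones (string_of n S) = S"
  by (auto simp: ones_def)

lemma ones_subset: "ones s \<subseteq> {..<length s}"
  by (auto simp: ones_def)

lemma string_of_ones [simp]: "string_of (length s) (ones s) = s"
  by (rule nth_equalityI) (auto simp: ones_def)

lemma string_of_mem: "string_of n S \<in> binary_strings n"
  by (simp add: binary_strings_def)

lemma string_of_inj: "S \<subseteq> {..<n} \<Longrightarrow> T \<subseteq> {..<n} \<Longrightarrow> string_of n S = string_of n T \<longleftrightarrow> S = T"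
  by (metis ones_string_of)

lemma inj_string_of: "inj_on (string_of n) (Pow {..<n})"
  by (rule inj_onI) (auto simp: string_of_inj)

lemma binary_strings_eq: "binary_strings n = string_of n ` Pow {..<n}"
proof (intro equalityI subsetI)
  fix s assume "s \<in> binary_strings n"
  then have "s = string_of n (ones s)" "ones s \<in> Pow {..<n}"
    using ones_subset[of s] by (auto simp: binary_strings_def)
  then show "s \<in> string_of n ` Pow {..<n}" by blast
qed (auto simp: binary_strings_def)

lemma card_binary_strings: "card (binary_strings n) = 2 ^ n"
  unfolding binary_strings_eq using card_image[OF inj_string_of, of n] by (simp add: card_Pow)

lemma string_le_iff:
  "S \<subseteq> {..<n} \<Longrightarrow> T \<subseteq> {..<n} \<Longrightarrow> string_le (string_of n S) (string_of n T) \<longleftrightarrow> S \<subseteq> T"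
  by (auto simp: string_le_def list_all2_conv_all_nth)

lemma zero_string_eq: "zero_string n = string_of n {}"
  by (rule nth_equalityI) (auto simp: zero_string_def)

lemma hypercube_edge_iff:
  assumes S: "S \<subseteq> {..<n}" and T: "T \<subseteq> {..<n}"
  shows "{string_of n S, string_of n T} \<in> edges (hypercube n) \<longleftrightarrow> card (sym_diff S T) = 1"
proof -
  have *: "{i. i < n \<and> string_of n S ! i \<noteq> string_of n T ! i} = sym_diff S T"
    "{i. i < n \<and> string_of n T ! i \<noteq> string_of n S ! i} = sym_diff S T"
    using S T by auto
  have "{string_of n S, string_of n T} \<in> edges (hypercube n) \<longleftrightarrow>
      (\<exists>s t. {string_of n S, string_of n T} = {s, t} \<and> s \<in> binary_strings n \<and> t \<in> binary_strings n \<and>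
        card {i. i < n \<and> s ! i \<noteq> t ! i} = 1)"
    unfolding hypercube_def by simp
  also have "\<dots> \<longleftrightarrow> card (sym_diff S T) = 1"
  proof
    assume "\<exists>s t. {string_of n S, string_of n T} = {s, t} \<and> s \<in> binary_strings n \<and> t \<in>
      binary_strings n \<and>
        card {i. i < n \<and> s ! i \<noteq> t ! i} = 1"
    then obtain s t where st: "{string_of n S, string_of n T} = {s, t}"
      "card {i. i < n \<and> s ! i \<noteq> t ! i} = 1" by blast
    from st(1) consider "s = string_of n S" "t = string_of n T" | "s = string_of n T" "t = string_of
      n S"
      unfolding doubleton_eq_iff by blast
    then show "card (sym_diff S T) = 1"
    proof cases
      case 1
      show ?thesis using st(2) unfolding 1 *(1) .
    next
      case 2
      show ?thesis using st(2) unfolding 2 *(2) .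
    qed
  next
    assume one: "card (sym_diff S T) = 1"
    show "\<exists>s t. {string_of n S, string_of n T} = {s, t} \<and> s \<in> binary_strings n \<and> t \<in> binary_strings
      n \<and>
        card {i. i < n \<and> s ! i \<noteq> t ! i} = 1"
      by (rule exI[of _ "string_of n S"], rule exI[of _ "string_of n T"])
        (intro conjI refl string_of_mem, unfold *(1), rule one)
  qed
  finally show ?thesis .
qed

lemma hypercube_edge_cases:
  assumes "e \<in> edges (hypercube n)"
  obtains S T where "S \<subseteq> {..<n}" "T \<subseteq> {..<n}" "e = {string_of n S, string_of n T}"
    "card (sym_diff S T) = 1"
proof -
  obtain s t where st: "e = {s, t}" "s \<in> binary_strings n" "t \<in> binary_strings n"
    using assms by (auto simp: hypercube_def)
  then obtain S T where "S \<subseteq> {..<n}" "T \<subseteq> {..<n}" "s = string_of n S" "t = string_of n T"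
    unfolding binary_strings_eq by blast
  then show thesis
    using hypercube_edge_iff[of S n T] st(1) assms by (intro that[of S T]) simp_all
qed

lemma verts_hypercube [simp]: "verts (hypercube n) = binary_strings n"
  by (simp add: hypercube_def)

lemma isomorphic_trans:
  assumes "isomorphic G H" "isomorphic H K"
  shows "isomorphic G K"
proof -
  obtain f where f: "bij_betw f (verts G) (verts H)"
    "\<And>u v. u \<in> verts G \<Longrightarrow> v \<in> verts G \<Longrightarrow> {u, v} \<in> edges G \<longleftrightarrow> {f u, f v} \<in> edges H"
    using assms(1) unfolding isomorphic_def by blast
  obtain g where g: "bij_betw g (verts H) (verts K)"
    "\<And>u v. u \<in> verts H \<Longrightarrow> v \<in> verts H \<Longrightarrow> {u, v} \<in> edges H \<longleftrightarrow> {g u, g v} \<in> edges K"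
    using assms(2) unfolding isomorphic_def by blast
  have "bij_betw (g \<circ> f) (verts G) (verts K)" using f(1) g(1) by (rule bij_betw_trans)
  moreover have "f u \<in> verts H" if "u \<in> verts G" for u using f(1) that bij_betwE by blast
  ultimately show ?thesis unfolding isomorphic_def using f(2) g(2) by (intro exI[of _ "g \<circ> f"]) auto
qed

lemma isomorphic_sym:
  assumes "isomorphic G H"
  shows "isomorphic H G"
proof -
  obtain f where f: "bij_betw f (verts G) (verts H)"
    "\<And>u v. u \<in> verts G \<Longrightarrow> v \<in> verts G \<Longrightarrow> {u, v} \<in> edges G \<longleftrightarrow> {f u, f v} \<in> edges H"
    using assms(1) unfolding isomorphic_def by blast
  let ?g = "inv_into (verts G) f"
  have g: "bij_betw ?g (verts H) (verts G)" using f(1) by (rule bij_betw_inv_into)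
  have "?g u \<in> verts G" "f (?g u) = u" if "u \<in> verts H" for u
    using g that bij_betwE bij_betw_inv_into_right[OF f(1) that] by blast+
  then show ?thesis unfolding isomorphic_def using f(2) g by (intro exI[of _ ?g]) auto
qed

lemma isomorphic_hypercube_one: "isomorphic (hypercube 1) K2"
proof -
  have "bij_betw (\<lambda>s. s ! 0) (verts (hypercube 1)) (verts K2)"
    by (rule bij_betwI[of _ _ _ "\<lambda>b. [b]"])
      (auto simp: binary_strings_def K2_def length_Suc_conv)
  moreover have "{u, v} \<in> edges (hypercube 1) \<longleftrightarrow> {u ! 0, v ! 0} \<in> edges K2"
    if uv: "u \<in> verts (hypercube 1)" "v \<in> verts (hypercube 1)" for u v
  proof -
    obtain S T where ST: "S \<subseteq> {..<1}" "T \<subseteq> {..<1}" "u = string_of 1 S" "v = string_of 1 T"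
      using uv unfolding verts_hypercube binary_strings_eq by blast
    have cases: "S = {} \<or> S = {0}" "T = {} \<or> T = {0}" using ST(1,2) by auto
    have "{u, v} \<in> edges (hypercube 1) \<longleftrightarrow> card (sym_diff S T) = 1"
      using ST hypercube_edge_iff by metis
    also have "\<dots> \<longleftrightarrow> (0 \<in> S \<longleftrightarrow> 0 \<notin> T)" using cases by auto
    also have "\<dots> \<longleftrightarrow> {u ! 0, v ! 0} \<in> edges K2" by (auto simp: ST K2_def doubleton_eq_iff)
    finally show ?thesis .
  qed
  ultimately show ?thesis unfolding isomorphic_def by blast
qed

lemma has_dim_card_verts:
  assumes "has_dim K k"
  shows "card (verts K) = 2 ^ k" "finite (verts K)"
proof -
  obtain f where f: "bij_betw f (verts K) (binary_strings k)"
    using assms unfolding has_dim_def isomorphic_def by auto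
  show "card (verts K) = 2 ^ k" using bij_betw_same_card[OF f] card_binary_strings by simp
  then show "finite (verts K)" by (metis card.infinite power_not_zero zero_neq_numeral)
qed

lemma has_dim_pos_edge:
  assumes "has_dim K k" "k \<ge> 1"
  shows "edges K \<noteq> {}"
proof -
  obtain f where f: "bij_betw f (verts K) (binary_strings k)"
    "\<And>u v. u \<in> verts K \<Longrightarrow> v \<in> verts K \<Longrightarrow> {u, v} \<in> edges K \<longleftrightarrow> {f u, f v} \<in> edges (hypercube k)"
    using assms(1) unfolding has_dim_def isomorphic_def by auto
  obtain u v where uv: "u \<in> verts K" "v \<in> verts K" "f u = string_of k {}" "f v = string_of k {0}"
    using f(1) string_of_mem unfolding bij_betw_def by (metis imageE)
  have "{f u, f v} \<in> edges (hypercube k)"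
    using hypercube_edge_iff[of "{}" k "{0}"] assms(2) uv by auto
  then show ?thesis using f(2)[OF uv(1,2)] by blast
qed

lemma sym_diff_insert: "x \<notin> B \<Longrightarrow> sym_diff P (insert x B) = sym_diff (sym_diff P B) {x}"
  by auto

lemma sym_diff_insert2:
  "x \<notin> B \<Longrightarrow> y \<notin> B \<Longrightarrow> sym_diff P (insert x (insert y B)) = sym_diff (sym_diff P B) {x, y}"
  by auto

text \<open>Two vertices of a hypercube at distance two have only two common neighbours.\<close>

lemma square_completion:
  assumes ab: "a \<noteq> b" and "Q \<noteq> P"
    and a: "card (sym_diff Q (sym_diff P {a})) = 1" and b: "card (sym_diff Q (sym_diff P {b})) = 1"
  shows "Q = sym_diff P {a, b}"
proof -
  obtain c where c: "sym_diff Q (sym_diff P {a}) = {c}" using a by (metis card_1_singletonE)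
  obtain d where d: "sym_diff Q (sym_diff P {b}) = {d}" using b by (metis card_1_singletonE)
  have Qc: "x \<in> Q \<longleftrightarrow> ((x \<in> P \<longleftrightarrow> x \<noteq> a) \<longleftrightarrow> x \<noteq> c)" for x using c by blast
  have Qd: "x \<in> Q \<longleftrightarrow> ((x \<in> P \<longleftrightarrow> x \<noteq> b) \<longleftrightarrow> x \<noteq> d)" for x using d by blast
  have "c \<noteq> a" using Qc assms(2) by blast
  moreover have "c = b" using Qc[of b] Qd[of b] Qc[of a] Qd[of a] ab calculation by metis
  ultimately show ?thesis using Qc ab by blast
qed

text \<open>A subgraph isomorphic to a hypercube moves in fixed coordinate directions: opposite edges
  of a square change the same coordinate.\<close>

lemma cube_directions:
  fixes \<phi> :: "nat set \<Rightarrow> 'a set"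
  assumes inj: "inj_on \<phi> (Pow {..<k})"
    and adj: "\<And>S T. S \<subseteq> {..<k} \<Longrightarrow> T \<subseteq> {..<k} \<Longrightarrow> card (sym_diff S T) = 1 \<Longrightarrow>
      card (sym_diff (\<phi> S) (\<phi> T)) = 1"
  shows "\<exists>d. \<forall>T. T \<subseteq> {..<k} \<longrightarrow> \<phi> T = sym_diff (\<phi> {}) (d ` T)"
proof -
  have "\<exists>x. sym_diff (\<phi> {}) (\<phi> {i}) = {x}" if "i < k" for i
  proof -
    have "sym_diff {} {i} = {i}" by auto
    then have "card (sym_diff (\<phi> {}) (\<phi> {i})) = 1" using adj[of "{}" "{i}"] that by simp
    then show ?thesis by (metis card_1_singletonE)
  qed
  then obtain d where d: "\<And>i. i < k \<Longrightarrow> sym_diff (\<phi> {}) (\<phi> {i}) = {d i}" by metis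
  have d1: "\<phi> {i} = sym_diff (\<phi> {}) {d i}" if "i < k" for i using d[OF that] by blast
  have d_inj: "inj_on d {..<k}"
  proof (rule inj_onI)
    fix i j assume ij: "i \<in> {..<k}" "j \<in> {..<k}" "d i = d j"
    then have "\<phi> {i} = \<phi> {j}" using d1 by simp
    then show "i = j" using inj_onD[OF inj, of "{i}" "{j}"] ij by auto
  qed
  have "\<phi> T = sym_diff (\<phi> {}) (d ` T)" if "T \<subseteq> {..<k}" for T
    using that
  proof (induction "card T" arbitrary: T rule: less_induct)
    case less
    have fin: "finite T" using less.prems finite_subset by blast
    consider "T = {}" | i where "T = {i}" | i j where "i \<in> T" "j \<in> T" "i \<noteq> j" by blast
    then show ?case
    proof cases
      case 1
      then show ?thesis by simp
    next
      case (2 i)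
      then show ?thesis using d1 less.prems by simp
    next
      case (3 i j)
      let ?R = "T - {i, j}"
      have k: "i < k" "j < k" using 3 less.prems by auto
      have lt: "card (T - {i}) < card T" "card (T - {j}) < card T"
        by (rule card_Diff1_less[OF fin 3(1)], rule card_Diff1_less[OF fin 3(2)])
      have "card ?R < card T" using 3 fin by (intro psubset_card_mono) auto
      then have R: "\<phi> ?R = sym_diff (\<phi> {}) (d ` ?R)" using less by blast
      have Ti: "\<phi> (T - {i}) = sym_diff (\<phi> {}) (d ` (T - {i}))"
        and Tj: "\<phi> (T - {j}) = sym_diff (\<phi> {}) (d ` (T - {j}))"
        using less.hyps[OF lt(1)] less.hyps[OF lt(2)] less.prems by blast+
      have nd: "d i \<notin> d ` ?R" "d j \<notin> d ` ?R" "d i \<noteq> d j"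
        using inj_onD[OF d_inj] k less.prems 3(3) by blast+
      have im: "d ` (T - {i}) = insert (d j) (d ` ?R)" "d ` (T - {j}) = insert (d i) (d ` ?R)"
        "d ` T = insert (d i) (insert (d j) (d ` ?R))"
        using 3 by blast+
      have Pi: "\<phi> (T - {i}) = sym_diff (\<phi> ?R) {d j}"
        unfolding Ti R im(1) by (rule sym_diff_insert[OF nd(2)])
      have Pj: "\<phi> (T - {j}) = sym_diff (\<phi> ?R) {d i}"
        unfolding Tj R im(2) by (rule sym_diff_insert[OF nd(1)])
      have one: "card (sym_diff T (T - {l})) = 1" if "l \<in> T" for l
      proof -
        have "sym_diff T (T - {l}) = {l}" using that by blast
        then show ?thesis by simp
      qed
      have sub: "T - {i} \<subseteq> {..<k}" "T - {j} \<subseteq> {..<k}" "?R \<subseteq> {..<k}" using less.prems by auto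
      have "\<phi> T = sym_diff (\<phi> ?R) {d i, d j}"
      proof (rule square_completion[OF nd(3)])
        show "\<phi> T \<noteq> \<phi> ?R" using inj_onD[OF inj, of T ?R] less.prems sub(3) 3 by auto
        show "card (sym_diff (\<phi> T) (sym_diff (\<phi> ?R) {d i})) = 1"
          using adj[OF less.prems sub(2) one[OF 3(2)]] unfolding Pj .
        show "card (sym_diff (\<phi> T) (sym_diff (\<phi> ?R) {d j})) = 1"
          using adj[OF less.prems sub(1) one[OF 3(1)]] unfolding Pi .
      qed
      then show ?thesis unfolding R im(3) sym_diff_insert2[OF nd(1,2)] .
    qed
  qed
  then show ?thesis by (intro exI[of _ d] allI impI)
qed

definition cube :: "nat \<Rightarrow> nat set \<Rightarrow> bool list graph" where
  "cube n S = induced_subgraph (hypercube n) (string_of n ` Pow S)"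

lemma verts_cube: "verts (cube n S) = string_of n ` Pow S"
  by (simp add: cube_def induced_subgraph_def)

lemma edges_cube: "edges (cube n S) = {e \<in> edges (hypercube n). e \<subseteq> string_of n ` Pow S}"
  by (simp add: cube_def induced_subgraph_def)

lemma string_image_Int:
  assumes "\<A> \<subseteq> Pow {..<n}" "\<B> \<subseteq> Pow {..<n}"
  shows "string_of n ` \<A> \<inter> string_of n ` \<B> = string_of n ` (\<A> \<inter> \<B>)"
  using inj_on_image_Int[OF inj_string_of assms] by simp

lemma cube_Int:
  assumes "S \<subseteq> {..<n}" "T \<subseteq> {..<n}"
  shows "graph_inter (cube n S) (cube n T) = cube n (S \<inter> T)"
proof -
  have "string_of n ` Pow S \<inter> string_of n ` Pow T = string_of n ` Pow (S \<inter> T)"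
    using string_image_Int[of "Pow S" n "Pow T"] assms by (simp add: Pow_Int_eq Pow_mono)
  then show ?thesis
    unfolding graph_inter_def cube_def induced_subgraph_def by auto
qed

lemma cube_inj: "S \<subseteq> {..<n} \<Longrightarrow> T \<subseteq> {..<n} \<Longrightarrow> cube n S = cube n T \<Longrightarrow> S = T"
proof -
  assume S: "S \<subseteq> {..<n}" and T: "T \<subseteq> {..<n}" and "cube n S = cube n T"
  then have "string_of n ` Pow S = string_of n ` Pow T" by (metis verts_cube)
  then have "Pow S = Pow T"
    using inj_on_image_eq_iff[OF inj_string_of, of "Pow S" n "Pow T"] S T by (simp add: Pow_mono)
  then show "S = T" by blast
qed

lemma has_dim_cube:
  assumes S: "S \<subseteq> {..<n}"
  shows "has_dim (cube n S) (card S)"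
proof -
  let ?k = "card S"
  have fin: "finite S" using S finite_subset by blast
  then obtain h where h: "bij_betw h S {..<?k}"
    using ex_bij_betw_finite_nat[of S] by (auto simp: lessThan_atLeast0)
  have hi: "inj_on h S" and hS: "h ` S = {..<?k}" using h by (auto simp: bij_betw_def)
  define f where "f s = string_of ?k (h ` ones s)" for s
  have f_str: "f (string_of n T) = string_of ?k (h ` T)" if "T \<subseteq> S" for T
    using that S by (simp add: f_def)
  have hT: "h ` T \<subseteq> {..<?k}" if "T \<subseteq> S" for T using that hS by blast
  have "bij_betw f (verts (cube n S)) (verts (hypercube ?k))"
    unfolding bij_betw_def
  proof
    show "inj_on f (verts (cube n S))"
    proof (rule inj_onI)
      fix s t assume "s \<in> verts (cube n S)" "t \<in> verts (cube n S)" and eq: "f s = f t"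
      then obtain T U where TU: "T \<subseteq> S" "U \<subseteq> S" "s = string_of n T" "t = string_of n U"
        by (auto simp: verts_cube)
      then have "h ` T = h ` U" using eq f_str string_of_inj hT by metis
      then have "T = U" using inj_on_image_eq_iff[OF hi TU(1,2)] by simp
      then show "s = t" using TU by simp
    qed
    show "f ` verts (cube n S) = verts (hypercube ?k)"
    proof
      show "f ` verts (cube n S) \<subseteq> verts (hypercube ?k)"
        by (auto simp: f_def string_of_mem)
      show "verts (hypercube ?k) \<subseteq> f ` verts (cube n S)"
      proof
        fix s assume "s \<in> verts (hypercube ?k)"
        then obtain U where U: "U \<subseteq> {..<?k}" "s = string_of ?k U" by (auto simp: binary_strings_eq)
        then obtain T where "T \<subseteq> S" "U = h ` T" using hS by (metis subset_image_iff)
        then have "s = f (string_of n T)" "string_of n T \<in> verts (cube n S)"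
          using U f_str by (auto simp: verts_cube)
        then show "s \<in> f ` verts (cube n S)" by blast
      qed
    qed
  qed
  moreover have "{u, v} \<in> edges (cube n S) \<longleftrightarrow> {f u, f v} \<in> edges (hypercube ?k)"
    if uv: "u \<in> verts (cube n S)" "v \<in> verts (cube n S)" for u v
  proof -
    obtain T U where TU: "T \<subseteq> S" "U \<subseteq> S" "u = string_of n T" "v = string_of n U"
      using uv unfolding verts_cube by blast
    have "{u, v} \<in> edges (cube n S) \<longleftrightarrow> {u, v} \<in> edges (hypercube n)"
      using uv by (simp add: edges_cube verts_cube)
    also have "\<dots> \<longleftrightarrow> card (sym_diff T U) = 1"
      unfolding TU(3,4) using TU(1,2) S by (intro hypercube_edge_iff) auto
    also have "card (sym_diff T U) = card (h ` sym_diff T U)"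
      using hi TU(1,2) by (intro card_image[symmetric]) (auto intro: inj_on_subset)
    also have "h ` sym_diff T U = sym_diff (h ` T) (h ` U)"
      using inj_on_image_set_diff[OF hi, of T U] inj_on_image_set_diff[OF hi, of U T] TU(1,2)
      by (simp add: image_Un subset_trans[OF Diff_subset])
    also have "card (sym_diff (h ` T) (h ` U)) = 1 \<longleftrightarrow> {f u, f v} \<in> edges (hypercube ?k)"
      unfolding TU(3,4) f_str[OF TU(1)] f_str[OF TU(2)]
      using hypercube_edge_iff hT TU(1,2) by metis
    finally show ?thesis .
  qed
  ultimately show ?thesis unfolding has_dim_def isomorphic_def by blast
qed

lemma cube_K2: "i < n \<Longrightarrow> isomorphic (cube n {i}) K2"
  using has_dim_cube[of "{i}" n] isomorphic_hypercube_one isomorphic_trans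
  by (auto simp: has_dim_def)

lemma meet_in_dim_cube:
  "S \<subseteq> {..<n} \<Longrightarrow> T \<subseteq> {..<n} \<Longrightarrow> card (S \<inter> T) = k \<Longrightarrow> meet_in_dim (cube n S) (cube n T) k"
  using has_dim_cube[of "S \<inter> T" n] by (auto simp: meet_in_dim_def cube_Int)

lemma meet_in_edge_cube:
  assumes "S \<subseteq> {..<n}" "T \<subseteq> {..<n}" "card (S \<inter> T) = 1"
  shows "meet_in_edge (cube n S) (cube n T)"
proof -
  obtain i where i: "S \<inter> T = {i}" using assms(3) by (rule card_1_singletonE)
  then have "i < n" using assms by auto
  then show ?thesis unfolding meet_in_edge_def cube_Int[OF assms(1,2)] i by (rule cube_K2)
qed

lemma edge_disjoint_cube:
  assumes "S \<subseteq> {..<n}" "T \<subseteq> {..<n}" "S \<inter> T = {}"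
  shows "edge_disjoint (cube n S) (cube n T)"
proof -
  have "edges (cube n {}) = {}"
  proof (rule ccontr)
    assume "edges (cube n {}) \<noteq> {}"
    then obtain e where e: "e \<in> edges (hypercube n)" "e \<subseteq> {string_of n {}}" by (auto simp: edges_cube)
    obtain S T where ST: "S \<subseteq> {..<n}" "T \<subseteq> {..<n}" "e = {string_of n S, string_of n T}"
      "card (sym_diff S T) = 1"
      by (rule hypercube_edge_cases[OF e(1)])
    then have "S = T" using e(2) string_of_inj by (metis insert_subset singletonD)
    then show False using ST(4) by simp
  qed
  moreover have "edges (cube n S) \<inter> edges (cube n T) = edges (graph_inter (cube n S) (cube n T))"
    by (simp add: graph_inter_def)
  ultimately show ?thesis using cube_Int[OF assms(1,2)] assms(3) by (simp add: edge_disjoint_def)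
qed

lemma subgraph_cube_mono:
  assumes "S \<subseteq> T" "subgraph K (cube n S)"
  shows "subgraph K (cube n T)"
proof -
  have sub: "string_of n ` Pow S \<subseteq> string_of n ` Pow T" using assms(1) by (intro image_mono Pow_mono)
  have K: "verts K \<subseteq> string_of n ` Pow S" "edges K \<subseteq> edges (cube n S)" "\<forall>e\<in>edges K. e \<subseteq> verts K"
    using assms(2) unfolding subgraph_def verts_cube by simp_all
  have "edges (cube n S) \<subseteq> edges (cube n T)"
    unfolding edges_cube using sub by (intro Collect_mono impI conjI) (elim conjE; assumption |
      blast)+
  then show ?thesis
    unfolding subgraph_def verts_cube using K sub by (intro conjI subset_trans[OF K(1) sub]
      subset_trans[OF K(2)])
qed

text \<open>A daisy cube, given by the downward closed family of the supports of its vertices.\<close>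

locale set_daisy =
  fixes n :: nat and \<X> :: "nat set set" and H :: "bool list graph"
  assumes X_sub: "\<And>S. S \<in> \<X> \<Longrightarrow> S \<subseteq> {..<n}" and X_empty: "{} \<in> \<X>"
    and X_down: "\<And>S T. S \<in> \<X> \<Longrightarrow> T \<subseteq> S \<Longrightarrow> T \<in> \<X>"
    and H_eq: "H = induced_subgraph (hypercube n) (string_of n ` \<X>)"
begin

lemma verts_H: "verts H = string_of n ` \<X>"
  by (simp add: H_eq induced_subgraph_def)

lemma edges_H: "edges H = {e \<in> edges (hypercube n). e \<subseteq> string_of n ` \<X>}"
  by (simp add: H_eq induced_subgraph_def)

lemma finite_X: "finite \<X>"
  by (rule finite_subset[of _ "Pow {..<n}"]) (use X_sub in auto)

definition tops :: "nat set set" where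
  "tops = {S \<in> \<X>. \<forall>T\<in>\<X>. S \<subseteq> T \<longrightarrow> T = S}"

lemma tops_sub: "S \<in> tops \<Longrightarrow> S \<subseteq> {..<n}" using X_sub by (simp add: tops_def)

lemma below_top:
  assumes "S \<in> \<X>"
  obtains T where "T \<in> tops" "S \<subseteq> T"
proof -
  obtain T where T: "T \<in> \<X>" "S \<subseteq> T" "\<forall>T'\<in>\<X>. T \<subseteq> T' \<longrightarrow> T = T'"
    using finite_has_maximal2[OF finite_X assms] by (elim bexE conjE)
  then have "T \<in> tops" unfolding tops_def by auto
  then show thesis using T(2) by (rule that)
qed

lemma maximal_vertices_eq: "maximal_vertices H = string_of n ` tops"
  unfolding maximal_vertices_def verts_H tops_def
  using X_sub by (auto simp: string_le_iff string_of_inj image_iff)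

lemma card_maximal_vertices: "card (maximal_vertices H) = card tops"
  unfolding maximal_vertices_eq
  by (rule card_image, rule inj_on_subset[OF inj_string_of]) (use tops_sub in auto)

lemma cube_subgraph: "S \<in> \<X> \<Longrightarrow> subgraph (cube n S) H"
  using X_down unfolding subgraph_def by (auto simp: verts_cube verts_H edges_cube edges_H)

lemma cube_hypercube_of: "S \<in> \<X> \<Longrightarrow> hypercube_of H (cube n S)"
  using cube_subgraph has_dim_cube X_sub unfolding hypercube_of_def by blast

text \<open>Moving from the vertex \<open>\<phi> {}\<close> in exactly those directions that it does not contain yet
  leads to a vertex of the hypercube above all others.\<close>

lemma hypercube_within_cube:
  assumes "hypercube_of H K"
  obtains S where "S \<in> \<X>" "subgraph K (cube n S)"
proof -
  obtain k where K: "subgraph K H" "has_dim K k" using assms by (auto simp: hypercube_of_def)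
  obtain f where f: "bij_betw f (binary_strings k) (verts K)"
    "\<And>u v. u \<in> binary_strings k \<Longrightarrow> v \<in> binary_strings k \<Longrightarrow>
      {u, v} \<in> edges (hypercube k) \<longleftrightarrow> {f u, f v} \<in> edges K"
    using isomorphic_sym[OF K(2)[unfolded has_dim_def]] unfolding isomorphic_def by auto
  define \<phi> where "\<phi> T = ones (f (string_of k T))" for T
  have fX: "\<exists>S\<in>\<X>. f (string_of k T) = string_of n S" for T
    using f(1) string_of_mem[of k T] K(1) unfolding subgraph_def verts_H bij_betw_def by blast
  have \<phi>: "\<phi> T \<in> \<X>" "string_of n (\<phi> T) = f (string_of k T)" for T
    using fX[of T] X_sub unfolding \<phi>_def by auto
  have "inj_on \<phi> (Pow {..<k})"
  proof (rule inj_onI)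
    fix S T assume ST: "S \<in> Pow {..<k}" "T \<in> Pow {..<k}" "\<phi> S = \<phi> T"
    then have "f (string_of k S) = f (string_of k T)" using \<phi>(2) by metis
    then have "string_of k S = string_of k T"
      using f(1) string_of_mem unfolding bij_betw_def inj_on_def by blast
    then show "S = T" using ST string_of_inj by auto
  qed
  moreover have "card (sym_diff (\<phi> S) (\<phi> T)) = 1"
    if "S \<subseteq> {..<k}" "T \<subseteq> {..<k}" "card (sym_diff S T) = 1" for S T
  proof -
    have "{f (string_of k S), f (string_of k T)} \<in> edges K"
      using f(2) string_of_mem hypercube_edge_iff that by blast
    then have "{string_of n (\<phi> S), string_of n (\<phi> T)} \<in> edges (hypercube n)"
      using K(1) \<phi>(2) unfolding subgraph_def edges_H by auto
    then show ?thesis using hypercube_edge_iff X_sub \<phi>(1) by blast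
  qed
  ultimately have "\<exists>d. \<forall>T. T \<subseteq> {..<k} \<longrightarrow> \<phi> T = sym_diff (\<phi> {}) (d ` T)"
    by (rule cube_directions)
  then obtain d where d': "\<forall>T. T \<subseteq> {..<k} \<longrightarrow> \<phi> T = sym_diff (\<phi> {}) (d ` T)" ..
  have d: "\<phi> T = sym_diff (\<phi> {}) (d ` T)" if "T \<subseteq> {..<k}" for T
    by (rule d'[rule_format, OF that])
  \<comment> \<open>The coordinates along which the cube increases from its vertex \<open>\<phi> {}\<close>.\<close>
  define U where "U = {i \<in> {..<k}. d i \<notin> \<phi> {}}"
  have "\<phi> T \<subseteq> \<phi> U" if "T \<subseteq> {..<k}" for T
  proof -
    have "U \<subseteq> {..<k}" by (auto simp: U_def)
    then have "\<phi> U = sym_diff (\<phi> {}) (d ` U)" by (rule d)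
    then show ?thesis using that unfolding d[OF that] by (auto simp: U_def)
  qed
  note below = this
  have "verts K \<subseteq> string_of n ` Pow (\<phi> U)"
  proof
    fix s assume "s \<in> verts K"
    then obtain t where t: "t \<in> binary_strings k" "s = f t" using f(1) unfolding bij_betw_def by blast
    then obtain T where T: "T \<subseteq> {..<k}" "t = string_of k T" unfolding binary_strings_eq by blast
    then have "s = string_of n (\<phi> T)" using \<phi>(2) t(2) by simp
    then show "s \<in> string_of n ` Pow (\<phi> U)" using below[OF T(1)] by blast
  qed
  then have "subgraph K (cube n (\<phi> U))"
    using K(1) unfolding subgraph_def verts_cube edges_cube edges_H by blast
  with \<phi>(1) show thesis by (rule that)
qed

lemma maximal_hypercube_iff: "{K. maximal_hypercube H K} = cube n ` tops"
proof (intro equalityI subsetI)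
  fix K assume "K \<in> {K. maximal_hypercube H K}"
  then have K: "hypercube_of H K" "\<And>L. hypercube_of H L \<Longrightarrow> subgraph K L \<Longrightarrow> L = K"
    by (auto simp: maximal_hypercube_def)
  obtain S where S: "S \<in> \<X>" "subgraph K (cube n S)" by (rule hypercube_within_cube[OF K(1)])
  obtain T where T: "T \<in> tops" "S \<subseteq> T" by (rule below_top[OF S(1)])
  have "subgraph K (cube n T)"
    using subgraph_cube_mono[OF T(2) S(2)] .
  then have "cube n T = K" using K(2) cube_hypercube_of T(1) by (auto simp: tops_def)
  then show "K \<in> cube n ` tops" using T(1) by blast
next
  fix K assume "K \<in> cube n ` tops"
  then obtain S where S: "S \<in> tops" "K = cube n S" by blast
  have "L = K" if L: "hypercube_of H L" "subgraph K L" for L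
  proof -
    obtain T where T: "T \<in> \<X>" "subgraph L (cube n T)" by (rule hypercube_within_cube[OF L(1)])
    have sub: "verts K \<subseteq> verts L" "verts L \<subseteq> verts (cube n T)" "edges K \<subseteq> edges L"
      "edges L \<subseteq> edges (cube n T)"
      using L(2) T(2) unfolding subgraph_def by simp_all
    have "string_of n S \<in> verts K" unfolding S(2) verts_cube by (rule imageI) simp
    then have "string_of n S \<in> string_of n ` Pow T" using sub(1,2) unfolding verts_cube by blast
    then have "S \<subseteq> T" using string_of_inj X_sub[OF T(1)] tops_sub[OF S(1)] by auto
    then have "T = S" using S(1) T(1) by (auto simp: tops_def)
    then have TK: "cube n T = K" using S(2) by simp
    have "verts L = verts K" "edges L = edges K"
      by (rule subset_antisym[OF sub(2)[unfolded TK] sub(1)], rule subset_antisym[OF sub(4)[unfolded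
        TK] sub(3)])
    then show ?thesis by (simp add: graph.equality)
  qed
  then show "K \<in> {K. maximal_hypercube H K}"
    using S cube_hypercube_of by (auto simp: maximal_hypercube_def tops_def)
qed

lemma maximal_hypercubes_areI:
  assumes "distinct Ss" "set Ss = tops"
  shows "maximal_hypercubes_are H (map (cube n) Ss)"
proof -
  have "inj_on (cube n) (set Ss)"
    unfolding assms(2) by (intro inj_onI) (rule cube_inj[OF tops_sub tops_sub])
  then show ?thesis
    unfolding maximal_hypercubes_are_def maximal_hypercube_iff using assms by (simp add: distinct_map)
qed

lemma only_common_vertexI:
  assumes "Ss \<noteq> []" "\<And>S. S \<in> set Ss \<Longrightarrow> S \<subseteq> {..<n}" "\<Inter>(set Ss) = {}"
  shows "only_common_vertex (map (cube n) Ss) (zero_string n)"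
proof -
  have "(\<Inter>K\<in>set (map (cube n) Ss). verts K) = {string_of n {}}"
  proof (intro equalityI subsetI)
    fix s assume s: "s \<in> (\<Inter>K\<in>set (map (cube n) Ss). verts K)"
    have "ones s \<subseteq> S \<and> s = string_of n (ones s)" if "S \<in> set Ss" for S
    proof -
      have "s \<in> string_of n ` Pow S" using s that by (auto simp: verts_cube)
      then obtain T where "T \<subseteq> S" "s = string_of n T" by blast
      then show ?thesis using assms(2)[OF that] by auto
    qed
    moreover obtain S where "S \<in> set Ss" using assms(1) by (cases Ss) auto
    ultimately show "s \<in> {string_of n {}}" using assms(3) by (metis Inter_greatest singletonI
      subset_empty)
  qed (auto simp: verts_cube)
  then show ?thesis by (simp add: only_common_vertex_def zero_string_eq)
qed

end

section \<open>The structure of the daisy cube of a tree\<close>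

lemma exactly_oneI:
  assumes "k < 6" "[a, b, c, d, e, f] ! k"
    and "\<And>i. i < 6 \<Longrightarrow> [a, b, c, d, e, f] ! i \<Longrightarrow> i = k"
  shows "exactly_one [a, b, c, d, e, f]"
  unfolding exactly_one_def
proof (rule ex1I[of _ k])
  show "k < length [a, b, c, d, e, f] \<and> [a, b, c, d, e, f] ! k" using assms(1,2) by simp
  fix i assume i: "i < length [a, b, c, d, e, f] \<and> [a, b, c, d, e, f] ! i"
  then have "i < 6" by simp
  then show "i = k" using i assms(3) by blast
qed

lemma less_6: "(i::nat) < 6 \<Longrightarrow> i = 0 \<or> i = 1 \<or> i = 2 \<or> i = 3 \<or> i = 4 \<or> i = 5"
  by linarith

lemma meet_not_edge_disjoint: "meet_in_dim A B k \<Longrightarrow> k \<ge> 1 \<Longrightarrow> \<not> edge_disjoint A B"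
  using has_dim_pos_edge by (fastforce simp: meet_in_dim_def edge_disjoint_def graph_inter_def)

lemma edge_disjoint_sym: "edge_disjoint A B \<Longrightarrow> edge_disjoint B A"
  by (auto simp: edge_disjoint_def)

text \<open>The number of maximal hypercubes tells the last four structures apart, up to the last
  two.\<close>

lemma maximal_hypercubes_card:
  "maximal_hypercubes_are H Ks \<Longrightarrow> card {K. maximal_hypercube H K} = length Ks"
  unfolding maximal_hypercubes_are_def using distinct_card by metis

text \<open>In the fifth structure one hypercube is edge disjoint from two others; in the sixth only
  one pair is edge disjoint.\<close>

lemma structure5_not_6:
  assumes "structure5 n H"
  shows "\<not> structure6 n H"
proof
  assume "structure6 n H"
  then obtain A B C D E where six: "maximal_hypercubes_are H [A, B, C, D, E]"
    "\<not> edge_disjoint A B" "\<not> edge_disjoint A C" "\<not> edge_disjoint A D" "\<not> edge_disjoint A E"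
    "\<not> edge_disjoint B C" "\<not> edge_disjoint B D" "\<not> edge_disjoint C D" "\<not> edge_disjoint B E"
    "\<not> edge_disjoint D E"
    unfolding structure6_def by (elim exE conjE) (simp add: meet_not_edge_disjoint)
  have one: "{K, L} = {C, E}"
    if "K \<in> {K. maximal_hypercube H K}" "L \<in> {K. maximal_hypercube H K}" "K \<noteq> L" "edge_disjoint K L"
      for K L
  proof -
    have "K \<in> set [A, B, C, D, E]" "L \<in> set [A, B, C, D, E]"
      using that(1,2) six(1) unfolding maximal_hypercubes_are_def by simp_all
    then show ?thesis
      using that(3,4) edge_disjoint_sym[OF that(4)] six(2-) by (elim set_ConsD[THEN disjE]) auto
  qed
  obtain A' B' C' D' E' where five: "maximal_hypercubes_are H [A', B', C', D', E']"
    "edge_disjoint E' A'" "edge_disjoint E' B'"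
    using assms unfolding structure5_def by blast
  then have mem: "A' \<in> {K. maximal_hypercube H K}" "B' \<in> {K. maximal_hypercube H K}"
    "E' \<in> {K. maximal_hypercube H K}" and ne: "E' \<noteq> A'" "E' \<noteq> B'" "A' \<noteq> B'"
    unfolding maximal_hypercubes_are_def by auto
  have "{E', A'} = {E', B'}"
    using one[OF mem(3,1) ne(1) five(2)] one[OF mem(3,2) ne(2) five(3)] by simp
  then show False using ne by (auto simp: doubleton_eq_iff)
qed

context set_daisy
begin

lemma structure2_excluded:
  assumes mh: "maximal_hypercubes_are H Ks"
    and dims: "\<And>K. K \<in> set Ks \<Longrightarrow> \<exists>d. has_dim K d \<and> d + 2 \<le> n"
  shows "\<not> structure2 n H"
proof
  assume "structure2 n H"
  then obtain B where n: "n \<ge> 2" and B: "subgraph B H" "isomorphic B (hypercube (n - 1))"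
    unfolding structure2_def by blast
  then have "hypercube_of H B" by (auto simp: hypercube_of_def has_dim_def)
  then obtain S where S: "S \<in> \<X>" "subgraph B (cube n S)" by (rule hypercube_within_cube)
  obtain T where T: "T \<in> tops" "S \<subseteq> T" by (rule below_top[OF S(1)])
  have "subgraph B (cube n T)" by (rule subgraph_cube_mono[OF T(2) S(2)])
  moreover have "cube n T \<in> set Ks"
    using mh maximal_hypercube_iff T(1) unfolding maximal_hypercubes_are_def by auto
  then obtain d where d: "has_dim (cube n T) d" "d + 2 \<le> n" using dims by blast
  ultimately have "card (verts B) \<le> card (verts (cube n T))"
    using has_dim_card_verts(2) by (intro card_mono) (auto simp: subgraph_def)
  then have "(2::nat) ^ (n - 1) \<le> 2 ^ d"
    using has_dim_card_verts(1) B(2) d(1) by (metis has_dim_def)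
  then show False using d(2) n by simp
qed

end

text \<open>The daisy cube whose vertices are the independent sets of a tree.\<close>

locale tree_daisy = tree_graph "{..<n}" adj + set_daisy n "{S. indep S}" H
  for n :: nat and adj and H
begin

lemma n_pos: "n \<ge> 1" using V_nonempty by (cases n) auto

lemma tops_eq: "tops = {S. max_indep S}"
proof (intro equalityI subsetI)
  fix S assume S: "S \<in> tops"
  then obtain T where "S \<subseteq> T" "max_indep T" using max_indep_extends[of S] by (auto simp: tops_def)
  then show "S \<in> {S. max_indep S}" using S by (auto simp: tops_def max_indep_def)
next
  fix S assume "S \<in> {S. max_indep S}"
  then have S: "indep S" "\<And>v. v < n \<Longrightarrow> v \<notin> S \<Longrightarrow> \<exists>u\<in>S. adj u v" by (auto simp: max_indep_def)
  have "T = S" if "indep T" "S \<subseteq> T" for T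
    using that S(2) unfolding indep_def by blast
  then show "S \<in> tops" using S(1) by (auto simp: tops_def)
qed

lemma single_indep: "v < n \<Longrightarrow> indep {v}"
  using adj_irrefl by (auto simp: indep_def)

lemma structure1_iff: "structure1 H \<longleftrightarrow> n = 1"
proof
  assume "n = 1"
  have "{S. indep S} = Pow {0}"
    using single_indep[of 0] \<open>n = 1\<close> X_sub X_empty by (auto simp: indep_def subset_singleton_iff)
  then have "H = cube n {0}" unfolding H_eq cube_def by simp
  then show "structure1 H" using cube_K2[of 0 n] \<open>n = 1\<close> by (simp add: structure1_def)
next
  assume "structure1 H"
  then obtain f where "bij_betw f (verts H) {False, True}"
    unfolding structure1_def isomorphic_def K2_def by auto
  then have "card (verts H) = 2" using bij_betw_same_card by fastforce
  moreover have "card (verts H) = card {S. indep S}"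
    unfolding verts_H by (rule card_image, rule inj_on_subset[OF inj_string_of]) (use X_sub in auto)
  ultimately have two: "card {S. indep S} = 2" by simp
  show "n = 1"
  proof (rule ccontr)
    assume "n \<noteq> 1"
    then have n2: "1 < n" using n_pos by simp
    have "card {{}, {0}, {1::nat}} \<le> card {S. indep S}"
      using single_indep[of 0] single_indep[of 1] n2 X_empty finite_X by (intro card_mono) auto
    then show False using two by simp
  qed
qed

text \<open>An edge of the daisy cube at \<open>{c}\<close> can only lead to the empty set, since every other
  vertex is adjacent to \<open>c\<close>.\<close>

lemma star_structure2:
  assumes n: "n \<ge> 2" and c: "c < n"
    and star: "\<And>x y. adj x y \<longleftrightarrow> x < n \<and> y < n \<and> x \<noteq> y \<and> (x = c \<or> y = c)"
  shows "structure2 n H"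
proof -
  let ?L = "{..<n} - {c}"
  have X: "{S. indep S} = Pow {c} \<union> Pow ?L"
  proof (intro equalityI subsetI)
    fix S assume "S \<in> {S. indep S}"
    then show "S \<in> Pow {c} \<union> Pow ?L" using c unfolding indep_def star by auto
  next
    fix S assume "S \<in> Pow {c} \<union> Pow ?L"
    then show "S \<in> {S. indep S}" using c unfolding indep_def star by auto
  qed
  have in_X: "{c} \<in> {S. indep S}" "?L \<in> {S. indep S}" unfolding X by auto
  have V: "verts H = verts (cube n {c}) \<union> verts (cube n ?L)"
    unfolding verts_H X verts_cube by blast
  have "edges H \<subseteq> edges (cube n {c}) \<union> edges (cube n ?L)"
  proof
    fix e assume e: "e \<in> edges H"
    then have eh: "e \<in> edges (hypercube n)" and es: "e \<subseteq> string_of n ` (Pow {c} \<union> Pow ?L)"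
      unfolding edges_H X by auto
    obtain S T where ST: "S \<subseteq> {..<n}" "T \<subseteq> {..<n}" "e = {string_of n S, string_of n T}"
      "card (sym_diff S T) = 1"
      by (rule hypercube_edge_cases[OF eh])
    have sub: "\<U> \<subseteq> Pow {..<n}" if "\<U> \<subseteq> Pow {c} \<union> Pow ?L" for \<U> using that c by auto
    have mem: "U \<in> Pow {c} \<union> Pow ?L" if U: "U \<subseteq> {..<n}" "string_of n U \<in> e" for U
    proof -
      obtain W where W: "W \<in> Pow {c} \<union> Pow ?L" "string_of n U = string_of n W" using es U(2) by blast
      then have "W \<subseteq> {..<n}" using c by auto
      then show ?thesis using W string_of_inj[OF U(1)] by auto
    qed
    have S: "S \<in> Pow {c} \<union> Pow ?L" and T: "T \<in> Pow {c} \<union> Pow ?L" using mem ST by auto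
    have no: "\<not> (c \<in> U \<and> W \<subseteq> ?L \<and> W \<noteq> {} \<and> U = {c} \<and> card (sym_diff U W) = 1)" for U W
    proof
      assume *: "c \<in> U \<and> W \<subseteq> ?L \<and> W \<noteq> {} \<and> U = {c} \<and> card (sym_diff U W) = 1"
      then have one: "card (sym_diff U W) = 1" and U: "U = {c}" and W: "W \<subseteq> ?L" "W \<noteq> {}" by blast+
      obtain w where w: "w \<in> W" using W(2) by blast
      obtain x where x: "sym_diff U W = {x}" using one by (rule card_1_singletonE)
      have "c \<in> sym_diff U W" "w \<in> sym_diff U W" "w \<noteq> c" using U W(1) w by auto
      then show False unfolding x by simp
    qed
    have "S \<subseteq> {c} \<and> T \<subseteq> {c} \<or> S \<subseteq> ?L \<and> T \<subseteq> ?L"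
    proof -
      have "sym_diff T S = sym_diff S T" by blast
      then have "card (sym_diff T S) = 1" using ST(4) by simp
      have SL: "S \<subseteq> {c} \<or> S \<subseteq> ?L" and TL: "T \<subseteq> {c} \<or> T \<subseteq> ?L" using S T by auto
      have dich: "U = {} \<or> U = {c}" if "U \<subseteq> {c}" for U using that by (simp add: subset_singleton_iff)
      show ?thesis
        using no[of S T] no[of T S] SL TL ST(4) \<open>card (sym_diff T S) = 1\<close> dich[of S] dich[of T] by
          auto
    qed
    then show "e \<in> edges (cube n {c}) \<union> edges (cube n ?L)"
      using eh unfolding edges_cube ST(3) by blast
  qed
  moreover have "edges (cube n {c}) \<subseteq> edges H" "edges (cube n ?L) \<subseteq> edges H"
    using cube_subgraph[OF in_X(1)] cube_subgraph[OF in_X(2)] by (simp_all add: subgraph_def)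
  ultimately have E: "edges H = edges (cube n {c}) \<union> edges (cube n ?L)" by blast
  have "H = graph_union (cube n {c}) (cube n ?L)"
    unfolding graph_union_def by (rule graph.equality) (simp_all add: V E)
  moreover have "isomorphic (cube n ?L) (hypercube (n - 1))"
    using has_dim_cube[of ?L n] c by (simp add: has_dim_def)
  moreover have "edge_disjoint (cube n {c}) (cube n ?L)"
    using c by (intro edge_disjoint_cube) auto
  moreover have "only_common_vertex [cube n {c}, cube n ?L] (zero_string n)"
  proof -
    have "only_common_vertex (map (cube n) [{c}, ?L]) (zero_string n)"
      by (rule only_common_vertexI) (use c in auto)
    then show ?thesis by simp
  qed
  ultimately show ?thesis
    unfolding structure2_def using n cube_subgraph in_X cube_K2[OF c] by blast
qed

end

text \<open>In each of the last four structures every maximal hypercube has dimension at most \<open>n - 2\<close>,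
  whereas the second structure contains a hypercube of dimension \<open>n - 1\<close>.\<close>

lemma structure3_hypercubes:
  assumes "structure3 n H"
  shows "\<exists>Ks. length Ks = 3 \<and> maximal_hypercubes_are H Ks \<and> (\<forall>K\<in>set Ks. \<exists>d. has_dim K d \<and> d + 2 \<le> n)"
proof -
  obtain A B C p q where mh: "maximal_hypercubes_are H [A, B, C]"
    and par: "p \<ge> 1" "q \<ge> 1" "p + q + 2 = n"
    and dims: "has_dim A (p + 1)" "has_dim B (p + q)" "has_dim C (q + 1)"
    using assms unfolding structure3_def by blast
  have a: "\<exists>d. has_dim A d \<and> d + 2 \<le> n" by (rule exI[of _ "p + 1"]) (use par dims in simp)
  have b: "\<exists>d. has_dim B d \<and> d + 2 \<le> n" by (rule exI[of _ "p + q"]) (use par dims in simp)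
  have c: "\<exists>d. has_dim C d \<and> d + 2 \<le> n" by (rule exI[of _ "q + 1"]) (use par dims in simp)
  show ?thesis by (rule exI[of _ "[A, B, C]"]) (use mh a b c in simp)
qed

lemma structure4_hypercubes:
  assumes "structure4 n H"
  shows "\<exists>Ks. length Ks = 4 \<and> maximal_hypercubes_are H Ks \<and> (\<forall>K\<in>set Ks. \<exists>d. has_dim K d \<and> d + 2 \<le> n)"
proof -
  obtain A B C D p q where mh: "maximal_hypercubes_are H [A, B, C, D]"
    and par: "p \<ge> 1" "q \<ge> 1" "p + q + 3 = n"
    and dims: "has_dim A (p + 1)" "has_dim B (p + q + 1)" "has_dim C (q + 1)" "has_dim D (2)"
    using assms unfolding structure4_def by blast
  have a: "\<exists>d. has_dim A d \<and> d + 2 \<le> n" by (rule exI[of _ "p + 1"]) (use par dims in simp)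
  have b: "\<exists>d. has_dim B d \<and> d + 2 \<le> n" by (rule exI[of _ "p + q + 1"]) (use par dims in simp)
  have c: "\<exists>d. has_dim C d \<and> d + 2 \<le> n" by (rule exI[of _ "q + 1"]) (use par dims in simp)
  have d: "\<exists>d. has_dim D d \<and> d + 2 \<le> n" by (rule exI[of _ "2"]) (use par dims in simp)
  show ?thesis by (rule exI[of _ "[A, B, C, D]"]) (use mh a b c d in simp)
qed

lemma structure5_hypercubes:
  assumes "structure5 n H"
  shows "\<exists>Ks. length Ks = 5 \<and> maximal_hypercubes_are H Ks \<and> (\<forall>K\<in>set Ks. \<exists>d. has_dim K d \<and> d + 2 \<le> n)"
proof -
  obtain A B C D E p q where mh: "maximal_hypercubes_are H [A, B, C, D, E]"
    and par: "p \<ge> 1" "q \<ge> 1" "p + q + 4 = n"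
    and dims: "has_dim A (p + q + 1)" "has_dim B (p + q + 1)" "has_dim C (p + 2)" "has_dim D (q +
      2)" "has_dim E (2)"
    using assms unfolding structure5_def by blast
  have a: "\<exists>d. has_dim A d \<and> d + 2 \<le> n" by (rule exI[of _ "p + q + 1"]) (use par dims in simp)
  have b: "\<exists>d. has_dim B d \<and> d + 2 \<le> n" by (rule exI[of _ "p + q + 1"]) (use par dims in simp)
  have c: "\<exists>d. has_dim C d \<and> d + 2 \<le> n" by (rule exI[of _ "p + 2"]) (use par dims in simp)
  have d: "\<exists>d. has_dim D d \<and> d + 2 \<le> n" by (rule exI[of _ "q + 2"]) (use par dims in simp)
  have e: "\<exists>d. has_dim E d \<and> d + 2 \<le> n" by (rule exI[of _ "2"]) (use par dims in simp)
  show ?thesis by (rule exI[of _ "[A, B, C, D, E]"]) (use mh a b c d e in simp)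
qed

lemma structure6_hypercubes:
  assumes "structure6 n H"
  shows "\<exists>Ks. length Ks = 5 \<and> maximal_hypercubes_are H Ks \<and> (\<forall>K\<in>set Ks. \<exists>d. has_dim K d \<and> d + 2 \<le> n)"
proof -
  obtain A B C D E p q r where mh: "maximal_hypercubes_are H [A, B, C, D, E]"
    and par: "p \<ge> 1" "q \<ge> 1" "r \<ge> 1" "p + q + r + 3 = n"
    and dims: "has_dim A (p + q + r)" "has_dim B (p + r + 1)" "has_dim C (p + q + 1)" "has_dim D (q
      + r + 1)" "has_dim E (r + 2)"
    using assms unfolding structure6_def by blast
  have a: "\<exists>d. has_dim A d \<and> d + 2 \<le> n" by (rule exI[of _ "p + q + r"]) (use par dims in simp)
  have b: "\<exists>d. has_dim B d \<and> d + 2 \<le> n" by (rule exI[of _ "p + r + 1"]) (use par dims in simp)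
  have c: "\<exists>d. has_dim C d \<and> d + 2 \<le> n" by (rule exI[of _ "p + q + 1"]) (use par dims in simp)
  have d: "\<exists>d. has_dim D d \<and> d + 2 \<le> n" by (rule exI[of _ "q + r + 1"]) (use par dims in simp)
  have e: "\<exists>d. has_dim E d \<and> d + 2 \<le> n" by (rule exI[of _ "r + 2"]) (use par dims in simp)
  show ?thesis by (rule exI[of _ "[A, B, C, D, E]"]) (use mh a b c d e in simp)
qed

context set_daisy
begin

lemma structure3I:
  assumes tops: "distinct [a, b, c]" "set [a, b, c] = tops" and common: "a \<inter> b \<inter> c = {}"
    and par: "p \<ge> 1" "q \<ge> 1" "p + q + 2 = n"
    and dims: "card a = p + 1" "card b = p + q" "card c = q + 1"
    and disjoint: "a \<inter> c = {}"
    and meet: "card (a \<inter> b) = p" "card (b \<inter> c) = q"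
  shows "structure3 n H"
proof -
  have sub: "a \<subseteq> {..<n}" "b \<subseteq> {..<n}" "c \<subseteq> {..<n}"
    using tops_sub tops(2) by auto
  have mh: "maximal_hypercubes_are H [cube n a, cube n b, cube n c]"
    using maximal_hypercubes_areI[OF tops] by simp
  have oc: "only_common_vertex [cube n a, cube n b, cube n c] (zero_string n)"
  proof -
    have "only_common_vertex (map (cube n) [a, b, c]) (zero_string n)"
      by (rule only_common_vertexI) (use sub common in auto)
    then show ?thesis by simp
  qed
  have hd: "has_dim (cube n a) (p + 1)" "has_dim (cube n b) (p + q)" "has_dim (cube n c) (q + 1)"
    using has_dim_cube[OF sub(1)] has_dim_cube[OF sub(2)] has_dim_cube[OF sub(3)] unfolding dims .
  have ed: "edge_disjoint (cube n a) (cube n c)"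
    by (rule edge_disjoint_cube; rule sub disjoint)+
  have md: "meet_in_dim (cube n a) (cube n b) (p)" "meet_in_dim (cube n b) (cube n c) (q)"
    by (rule meet_in_dim_cube; rule sub meet)+
  show ?thesis
    unfolding structure3_def
    by (rule exI[of _ "cube n a"], rule exI[of _ "cube n b"], rule exI[of _ "cube n c"],
      intro conjI, rule mh, rule oc, rule exI[of _ p], rule exI[of _ q], intro conjI) (rule par hd
        ed md)+
qed

lemma structure4I:
  assumes tops: "distinct [a, b, c, d]" "set [a, b, c, d] = tops" and common: "a \<inter> b \<inter> c \<inter> d = {}"
    and par: "p \<ge> 1" "q \<ge> 1" "p + q + 3 = n"
    and dims: "card a = p + 1" "card b = p + q + 1" "card c = q + 1" "card d = 2"
    and disjoint: "a \<inter> c = {}" "b \<inter> d = {}"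
    and meet: "card (a \<inter> b) = p" "card (b \<inter> c) = q"
    and edge: "card (a \<inter> d) = 1" "card (c \<inter> d) = 1"
  shows "structure4 n H"
proof -
  have sub: "a \<subseteq> {..<n}" "b \<subseteq> {..<n}" "c \<subseteq> {..<n}" "d \<subseteq> {..<n}"
    using tops_sub tops(2) by auto
  have mh: "maximal_hypercubes_are H [cube n a, cube n b, cube n c, cube n d]"
    using maximal_hypercubes_areI[OF tops] by simp
  have oc: "only_common_vertex [cube n a, cube n b, cube n c, cube n d] (zero_string n)"
  proof -
    have "only_common_vertex (map (cube n) [a, b, c, d]) (zero_string n)"
      by (rule only_common_vertexI) (use sub common in auto)
    then show ?thesis by simp
  qed
  have hd: "has_dim (cube n a) (p + 1)" "has_dim (cube n b) (p + q + 1)" "has_dim (cube n c) (q +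
    1)" "has_dim (cube n d) (2)"
    using has_dim_cube[OF sub(1)] has_dim_cube[OF sub(2)] has_dim_cube[OF sub(3)] has_dim_cube[OF
      sub(4)] unfolding dims .
  have ed: "edge_disjoint (cube n a) (cube n c)" "edge_disjoint (cube n b) (cube n d)"
    by (rule edge_disjoint_cube; rule sub disjoint)+
  have md: "meet_in_dim (cube n a) (cube n b) (p)" "meet_in_dim (cube n b) (cube n c) (q)"
    by (rule meet_in_dim_cube; rule sub meet)+
  have me: "meet_in_edge (cube n a) (cube n d)" "meet_in_edge (cube n c) (cube n d)"
    by (rule meet_in_edge_cube; rule sub edge)+
  show ?thesis
    unfolding structure4_def
    by (rule exI[of _ "cube n a"], rule exI[of _ "cube n b"], rule exI[of _ "cube n c"], rule exI[of
      _ "cube n d"],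
      intro conjI, rule mh, rule oc, rule exI[of _ p], rule exI[of _ q], intro conjI) (rule par hd
        ed md me)+
qed

lemma structure5I:
  assumes tops: "distinct [a, b, c, d, e]" "set [a, b, c, d, e] = tops" and common: "a \<inter> b \<inter> c \<inter> d \<inter>
    e = {}"
    and par: "p \<ge> 1" "q \<ge> 1" "p + q + 4 = n"
    and dims: "card a = p + q + 1" "card b = p + q + 1" "card c = p + 2" "card d = q + 2" "card e = 2"
    and disjoint: "c \<inter> d = {}" "e \<inter> a = {}" "e \<inter> b = {}"
    and meet: "card (a \<inter> b) = p + q" "card (a \<inter> c) = p + 1" "card (a \<inter> d) = q" "card (b \<inter> c) = p"
      "card (b \<inter> d) = q + 1"
    and edge: "card (c \<inter> e) = 1" "card (d \<inter> e) = 1"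
  shows "structure5 n H"
proof -
  have sub: "a \<subseteq> {..<n}" "b \<subseteq> {..<n}" "c \<subseteq> {..<n}" "d \<subseteq> {..<n}" "e \<subseteq> {..<n}"
    using tops_sub tops(2) by auto
  have mh: "maximal_hypercubes_are H [cube n a, cube n b, cube n c, cube n d, cube n e]"
    using maximal_hypercubes_areI[OF tops] by simp
  have oc: "only_common_vertex [cube n a, cube n b, cube n c, cube n d, cube n e] (zero_string n)"
  proof -
    have "only_common_vertex (map (cube n) [a, b, c, d, e]) (zero_string n)"
      by (rule only_common_vertexI) (use sub common in auto)
    then show ?thesis by simp
  qed
  have hd: "has_dim (cube n a) (p + q + 1)" "has_dim (cube n b) (p + q + 1)" "has_dim (cube n c) (p
    + 2)" "has_dim (cube n d) (q + 2)" "has_dim (cube n e) (2)"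
    using has_dim_cube[OF sub(1)] has_dim_cube[OF sub(2)] has_dim_cube[OF sub(3)] has_dim_cube[OF
      sub(4)] has_dim_cube[OF sub(5)] unfolding dims .
  have ed: "edge_disjoint (cube n c) (cube n d)" "edge_disjoint (cube n e) (cube n a)"
    "edge_disjoint (cube n e) (cube n b)"
    by (rule edge_disjoint_cube; rule sub disjoint)+
  have md: "meet_in_dim (cube n a) (cube n b) (p + q)" "meet_in_dim (cube n a) (cube n c) (p + 1)"
    "meet_in_dim (cube n a) (cube n d) (q)" "meet_in_dim (cube n b) (cube n c) (p)" "meet_in_dim
    (cube n b) (cube n d) (q + 1)"
    by (rule meet_in_dim_cube; rule sub meet)+
  have me: "meet_in_edge (cube n c) (cube n e)" "meet_in_edge (cube n d) (cube n e)"
    by (rule meet_in_edge_cube; rule sub edge)+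
  show ?thesis
    unfolding structure5_def
    by (rule exI[of _ "cube n a"], rule exI[of _ "cube n b"], rule exI[of _ "cube n c"], rule exI[of
      _ "cube n d"], rule exI[of _ "cube n e"],
      intro conjI, rule mh, rule oc, rule exI[of _ p], rule exI[of _ q], intro conjI) (rule par hd
        ed md me)+
qed

lemma structure6I:
  assumes tops: "distinct [a, b, c, d, e]" "set [a, b, c, d, e] = tops" and common: "a \<inter> b \<inter> c \<inter> d \<inter>
    e = {}"
    and par: "p \<ge> 1" "q \<ge> 1" "r \<ge> 1" "p + q + r + 3 = n"
    and dims: "card a = p + q + r" "card b = p + r + 1" "card c = p + q + 1" "card d = q + r + 1"
      "card e = r + 2"
    and disjoint: "c \<inter> e = {}"
    and meet: "card (a \<inter> b) = p + r" "card (a \<inter> c) = p + q" "card (a \<inter> d) = q + r" "card (a \<inter> e) =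
      r" "card (b \<inter> c) = p" "card (b \<inter> d) = r" "card (c \<inter> d) = q" "card (b \<inter> e) = r + 1" "card (d \<inter>
        e) = r + 1"
  shows "structure6 n H"
proof -
  have sub: "a \<subseteq> {..<n}" "b \<subseteq> {..<n}" "c \<subseteq> {..<n}" "d \<subseteq> {..<n}" "e \<subseteq> {..<n}"
    using tops_sub tops(2) by auto
  have mh: "maximal_hypercubes_are H [cube n a, cube n b, cube n c, cube n d, cube n e]"
    using maximal_hypercubes_areI[OF tops] by simp
  have oc: "only_common_vertex [cube n a, cube n b, cube n c, cube n d, cube n e] (zero_string n)"
  proof -
    have "only_common_vertex (map (cube n) [a, b, c, d, e]) (zero_string n)"
      by (rule only_common_vertexI) (use sub common in auto)
    then show ?thesis by simp
  qed
  have hd: "has_dim (cube n a) (p + q + r)" "has_dim (cube n b) (p + r + 1)" "has_dim (cube n c) (p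
    + q + 1)" "has_dim (cube n d) (q + r + 1)" "has_dim (cube n e) (r + 2)"
    using has_dim_cube[OF sub(1)] has_dim_cube[OF sub(2)] has_dim_cube[OF sub(3)] has_dim_cube[OF
      sub(4)] has_dim_cube[OF sub(5)] unfolding dims .
  have ed: "edge_disjoint (cube n c) (cube n e)"
    by (rule edge_disjoint_cube; rule sub disjoint)+
  have md: "meet_in_dim (cube n a) (cube n b) (p + r)" "meet_in_dim (cube n a) (cube n c) (p + q)"
    "meet_in_dim (cube n a) (cube n d) (q + r)" "meet_in_dim (cube n a) (cube n e) (r)" "meet_in_dim
    (cube n b) (cube n c) (p)" "meet_in_dim (cube n b) (cube n d) (r)" "meet_in_dim (cube n c) (cube
      n d) (q)" "meet_in_dim (cube n b) (cube n e) (r + 1)" "meet_in_dim (cube n d) (cube n e) (r +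
        1)"
    by (rule meet_in_dim_cube; rule sub meet)+
  show ?thesis
    unfolding structure6_def
    by (rule exI[of _ "cube n a"], rule exI[of _ "cube n b"], rule exI[of _ "cube n c"], rule exI[of
      _ "cube n d"], rule exI[of _ "cube n e"],
      intro conjI, rule mh, rule oc, rule exI[of _ p], rule exI[of _ q], rule exI[of _ r], intro
        conjI) (rule par hd ed md)+
qed

end

context tree_daisy
begin

lemma double_star_structure3:
  assumes big: "n \<ge> 3" and U: "inner = {u, v}"
    and adj: "adj u v"
  shows "structure3 n H"
proof -
  have big': "card {..<n} \<ge> 3" using big by simp
  have na: "\<not> adj x x" for x by (rule adj_irrefl)
  have neq: "u \<noteq> v"
    using adj na by (auto simp: apart_def)
  note adj' = adj adj[THEN adj_sym]
  have out: "u \<notin> leaves u" "u \<notin> leaves v" "v \<notin> leaves u" "v \<notin> leaves v"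
    using U leaves_Int_inner by blast+
  have lt: "u < n" "v < n"
    using U inner_subset by auto
  have sub: "leaves u \<subseteq> {..<n}" "leaves v \<subseteq> {..<n}"
    using leaves_subset by blast+
  have fin: "finite (leaves u)" "finite (leaves v)"
    using sub finite_subset by blast+
  have disj: "leaves u \<inter> leaves v = {}"
    using neq by (auto intro!: leaves_disjoint)
  have ne_u: "leaves u \<noteq> {}"
  proof -
    obtain b where b: "adj u b" "b \<noteq> v" using other_neighbour[of u v] U by blast
    then have "b \<notin> inner" using U na by auto
    then show ?thesis using b(1) by (auto simp: leaves_def)
  qed
  have ne_v: "leaves v \<noteq> {}"
  proof -
    obtain b where b: "adj v b" "b \<noteq> u" using other_neighbour[of v u] U by blast
    then have "b \<notin> inner" using U na by auto
    then show ?thesis using b(1) by (auto simp: leaves_def)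
  qed
  have V: "{..<n} = {u, v} \<union> (leaves u \<union> leaves v)"
    using V_decomposition[OF big'] U by auto
  have cards: "card (leaves u \<union> leaves v) = card (leaves u) + card (leaves v)"
    using fin disj by (simp_all add: card_Un_disjoint Int_Un_distrib Int_Un_distrib2)
  have "card {..<n} = card {u, v} + card (leaves u \<union> leaves v)"
    unfolding V by (rule card_Un_disjoint) (use fin out in auto)
  then have n: "card (leaves u) + card (leaves v) + 2 = n" using cards neq by simp
  have "{J. J \<subseteq> inner \<and> (\<forall>u\<in>J. \<forall>v\<in>J. \<not> adj u v) \<and>
      (\<forall>u\<in>inner - J. leaves u \<noteq> {} \<or> (\<exists>w\<in>J. adj w u))} = {{v}, {}, {u}}" (is "?J = _")
  proof (intro equalityI subsetI)
    fix J assume "J \<in> ?J"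
    then have J: "J \<subseteq> inner" "\<And>x y. x \<in> J \<Longrightarrow> y \<in> J \<Longrightarrow> \<not> adj x y"
      "\<And>x. x \<in> inner \<Longrightarrow> x \<notin> J \<Longrightarrow> leaves x \<noteq> {} \<or> (\<exists>w\<in>J. adj w x)" by blast+
    have c1: "\<not> (u \<in> J \<and> v \<in> J)" using J(2)[of u v] adj by blast
    obtain b0 b1 where b: "b0 \<longleftrightarrow> u \<in> J" "b1 \<longleftrightarrow> v \<in> J" by blast
    have Je: "J = (if b0 then {u} else {}) \<union> (if b1 then {v} else {})"
      using J(1) unfolding b U by auto
    have "\<not> (b0 \<and> b1)" using c1 b by blast+
    then show "J \<in> {{v}, {}, {u}}"
      unfolding Je by (cases b0; cases b1) (simp_all add: insert_commute)
  next
    fix J assume "J \<in> {{v}, {}, {u}}"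
    then show "J \<in> ?J"
      unfolding U using ne_u ne_v na neq adj' by auto
  qed
  then have tops: "tops = {completion {v}, completion {}, completion {u}}"
    unfolding tops_eq max_indep_iff[OF big'] by simp
  have m1: "completion {v} = insert v (leaves u)"
    unfolding completion_def U using neq by auto
  have m2: "completion {} = leaves u \<union> leaves v"
    unfolding completion_def U using neq by auto
  have m3: "completion {u} = insert u (leaves v)"
    unfolding completion_def U using neq by auto
  have "distinct [{v}, {}, {u}]" using neq by (auto simp: doubleton_eq_iff)
  moreover have "inj_on completion (set [{v}, {}, {u}])"
    by (rule inj_on_subset[OF completion_inj]) (simp add: U)
  ultimately have dist: "distinct (map completion [{v}, {}, {u}])"
    unfolding distinct_map by (rule conjI)
  show ?thesis
  proof (rule structure3I)
    show "distinct [insert v (leaves u), leaves u \<union> leaves v, insert u (leaves v)]" using dist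
      unfolding list.map m1 m2 m3 .
    show "set [insert v (leaves u), leaves u \<union> leaves v, insert u (leaves v)] = tops" unfolding tops
      m1 m2 m3 by simp
    show "(insert v (leaves u)) \<inter> (leaves u \<union> leaves v) \<inter> (insert u (leaves v)) = {}" using neq out
      disj by auto
    show "1 \<le> card (leaves u)" using fin ne_u ne_v by (simp add: Suc_le_eq card_gt_0_iff)
    show "1 \<le> card (leaves v)" using fin ne_u ne_v by (simp add: Suc_le_eq card_gt_0_iff)
    show "card (leaves u) + card (leaves v) + 2 = n" using n by simp
    show "card (insert v (leaves u)) = card (leaves u) + 1" using fin out neq cards by simp
    show "card (leaves u \<union> leaves v) = card (leaves u) + card (leaves v)" using fin out neq cards by
      simp
    show "card (insert u (leaves v)) = card (leaves v) + 1" using fin out neq cards by simp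
    show "(insert v (leaves u)) \<inter> (insert u (leaves v)) = {}" using neq out disj by auto
    have "(insert v (leaves u)) \<inter> (leaves u \<union> leaves v) = leaves u" using neq out disj by auto
    then show "card ((insert v (leaves u)) \<inter> (leaves u \<union> leaves v)) = card (leaves u)" using fin out
      neq cards by simp
    have "(leaves u \<union> leaves v) \<inter> (insert u (leaves v)) = leaves v" using neq out disj by auto
    then show "card ((leaves u \<union> leaves v) \<inter> (insert u (leaves v))) = card (leaves v)" using fin out
      neq cards by simp
  qed
qed

lemma bare_triple_structure4:
  assumes big: "n \<ge> 3" and U: "inner = {u, c, v}"
    and adj: "adj u c" "adj c v"
    and ap: "apart u v"
    and none: "leaves c = {}"
  shows "structure4 n H"
proof -
  have big': "card {..<n} \<ge> 3" using big by simp
  have na: "\<not> adj x x" for x by (rule adj_irrefl)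
  have neq: "u \<noteq> c" "u \<noteq> v" "c \<noteq> v"
    using adj na ap by (auto simp: apart_def)
  note adj' = adj adj[THEN adj_sym]
  have nadj: "\<not> adj u v" "\<not> adj v u"
    using ap by (simp_all add: apart_def)
  have out: "u \<notin> leaves u" "u \<notin> leaves c" "u \<notin> leaves v" "c \<notin> leaves u" "c \<notin> leaves c" "c \<notin> leaves
    v" "v \<notin> leaves u" "v \<notin> leaves c" "v \<notin> leaves v"
    using U leaves_Int_inner by blast+
  have lt: "u < n" "c < n" "v < n"
    using U inner_subset by auto
  have sub: "leaves u \<subseteq> {..<n}" "leaves v \<subseteq> {..<n}"
    using leaves_subset by blast+
  have fin: "finite (leaves u)" "finite (leaves v)"
    using sub finite_subset by blast+
  have disj: "leaves u \<inter> leaves v = {}"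
    using neq by (auto intro!: leaves_disjoint)
  have ne_u: "leaves u \<noteq> {}"
  proof -
    obtain b where b: "adj u b" "b \<noteq> c" using other_neighbour[of u c] U by blast
    then have "b \<notin> inner" using U na nadj by auto
    then show ?thesis using b(1) by (auto simp: leaves_def)
  qed
  have ne_v: "leaves v \<noteq> {}"
  proof -
    obtain b where b: "adj v b" "b \<noteq> c" using other_neighbour[of v c] U by blast
    then have "b \<notin> inner" using U na nadj by auto
    then show ?thesis using b(1) by (auto simp: leaves_def)
  qed
  have V: "{..<n} = {u, c, v} \<union> (leaves u \<union> leaves v)"
    using V_decomposition[OF big'] U none by auto
  have cards: "card (leaves u \<union> leaves v) = card (leaves u) + card (leaves v)"
    using fin disj by (simp_all add: card_Un_disjoint Int_Un_distrib Int_Un_distrib2)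
  have "card {..<n} = card {u, c, v} + card (leaves u \<union> leaves v)"
    unfolding V by (rule card_Un_disjoint) (use fin out in auto)
  then have n: "card (leaves u) + card (leaves v) + 3 = n" using cards neq by simp
  have "{J. J \<subseteq> inner \<and> (\<forall>u\<in>J. \<forall>v\<in>J. \<not> adj u v) \<and>
      (\<forall>u\<in>inner - J. leaves u \<noteq> {} \<or> (\<exists>w\<in>J. adj w u))} = {{v}, {c}, {u}, {u, v}}" (is "?J = _")
  proof (intro equalityI subsetI)
    fix J assume "J \<in> ?J"
    then have J: "J \<subseteq> inner" "\<And>x y. x \<in> J \<Longrightarrow> y \<in> J \<Longrightarrow> \<not> adj x y"
      "\<And>x. x \<in> inner \<Longrightarrow> x \<notin> J \<Longrightarrow> leaves x \<noteq> {} \<or> (\<exists>w\<in>J. adj w x)" by blast+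
    have c1: "\<not> (u \<in> J \<and> c \<in> J)" using J(2)[of u c] adj by blast
    have c2: "\<not> (c \<in> J \<and> v \<in> J)" using J(2)[of c v] adj by blast
    have c3: "c \<in> J \<or> u \<in> J \<or> v \<in> J"
      using J(1) J(3)[of c] none nadj na unfolding U by blast
    obtain b0 b1 b2 where b: "b0 \<longleftrightarrow> u \<in> J" "b1 \<longleftrightarrow> c \<in> J" "b2 \<longleftrightarrow> v \<in> J" by blast
    have Je: "J = (if b0 then {u} else {}) \<union> (if b1 then {c} else {}) \<union> (if b2 then {v} else {})"
      using J(1) unfolding b U by auto
    have "\<not> (b0 \<and> b1)" "\<not> (b1 \<and> b2)" "b1 \<or> b0 \<or> b2" using c1 c2 c3 b by blast+
    then show "J \<in> {{v}, {c}, {u}, {u, v}}"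
      unfolding Je by (cases b0; cases b1; cases b2) (simp_all add: insert_commute)
  next
    fix J assume "J \<in> {{v}, {c}, {u}, {u, v}}"
    then show "J \<in> ?J"
      unfolding U using ne_u ne_v na neq adj' nadj by auto
  qed
  then have tops: "tops = {completion {v}, completion {c}, completion {u}, completion {u, v}}"
    unfolding tops_eq max_indep_iff[OF big'] by simp
  have m1: "completion {v} = insert v (leaves u)"
    unfolding completion_def U using neq none by auto
  have m2: "completion {c} = insert c (leaves u \<union> leaves v)"
    unfolding completion_def U using neq none by auto
  have m3: "completion {u} = insert u (leaves v)"
    unfolding completion_def U using neq none by auto
  have m4: "completion {u, v} = {u, v}"
    unfolding completion_def U using neq none by auto
  have "distinct [{v}, {c}, {u}, {u, v}]" using neq by (auto simp: doubleton_eq_iff)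
  moreover have "inj_on completion (set [{v}, {c}, {u}, {u, v}])"
    by (rule inj_on_subset[OF completion_inj]) (simp add: U)
  ultimately have dist: "distinct (map completion [{v}, {c}, {u}, {u, v}])"
    unfolding distinct_map by (rule conjI)
  show ?thesis
  proof (rule structure4I)
    show "distinct [insert v (leaves u), insert c (leaves u \<union> leaves v), insert u (leaves v), {u,
      v}]" using dist unfolding list.map m1 m2 m3 m4 .
    show "set [insert v (leaves u), insert c (leaves u \<union> leaves v), insert u (leaves v), {u, v}] =
      tops" unfolding tops m1 m2 m3 m4 by simp
    show "(insert v (leaves u)) \<inter> (insert c (leaves u \<union> leaves v)) \<inter> (insert u (leaves v)) \<inter> ({u,
      v}) = {}" using neq out disj by auto
    show "1 \<le> card (leaves u)" using fin ne_u ne_v by (simp add: Suc_le_eq card_gt_0_iff)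
    show "1 \<le> card (leaves v)" using fin ne_u ne_v by (simp add: Suc_le_eq card_gt_0_iff)
    show "card (leaves u) + card (leaves v) + 3 = n" using n by simp
    show "card (insert v (leaves u)) = card (leaves u) + 1" using fin out neq cards by simp
    show "card (insert c (leaves u \<union> leaves v)) = card (leaves u) + card (leaves v) + 1" using fin
      out neq cards by simp
    show "card (insert u (leaves v)) = card (leaves v) + 1" using fin out neq cards by simp
    show "card ({u, v}) = 2" using fin out neq cards by simp
    show "(insert v (leaves u)) \<inter> (insert u (leaves v)) = {}" using neq out disj by auto
    show "(insert c (leaves u \<union> leaves v)) \<inter> ({u, v}) = {}" using neq out disj by auto
    have "(insert v (leaves u)) \<inter> (insert c (leaves u \<union> leaves v)) = leaves u" using neq out disj by
      auto
    then show "card ((insert v (leaves u)) \<inter> (insert c (leaves u \<union> leaves v))) = card (leaves u)"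
      using fin out neq cards by simp
    have "(insert c (leaves u \<union> leaves v)) \<inter> (insert u (leaves v)) = leaves v" using neq out disj by
      auto
    then show "card ((insert c (leaves u \<union> leaves v)) \<inter> (insert u (leaves v))) = card (leaves v)"
      using fin out neq cards by simp
    have "(insert v (leaves u)) \<inter> ({u, v}) = {v}" using neq out disj by auto
    then show "card ((insert v (leaves u)) \<inter> ({u, v})) = 1" using fin out neq cards by simp
    have "(insert u (leaves v)) \<inter> ({u, v}) = {u}" using neq out disj by auto
    then show "card ((insert u (leaves v)) \<inter> ({u, v})) = 1" using fin out neq cards by simp
  qed
qed

lemma triple_structure6:
  assumes big: "n \<ge> 3" and U: "inner = {u, c, v}"
    and adj: "adj u c" "adj c v"
    and ap: "apart u v"
    and some: "leaves c \<noteq> {}"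
  shows "structure6 n H"
proof -
  have big': "card {..<n} \<ge> 3" using big by simp
  have na: "\<not> adj x x" for x by (rule adj_irrefl)
  have neq: "u \<noteq> c" "u \<noteq> v" "c \<noteq> v"
    using adj na ap by (auto simp: apart_def)
  note adj' = adj adj[THEN adj_sym]
  have nadj: "\<not> adj u v" "\<not> adj v u"
    using ap by (simp_all add: apart_def)
  have out: "u \<notin> leaves u" "u \<notin> leaves c" "u \<notin> leaves v" "c \<notin> leaves u" "c \<notin> leaves c" "c \<notin> leaves
    v" "v \<notin> leaves u" "v \<notin> leaves c" "v \<notin> leaves v"
    using U leaves_Int_inner by blast+
  have lt: "u < n" "c < n" "v < n"
    using U inner_subset by auto
  have sub: "leaves u \<subseteq> {..<n}" "leaves c \<subseteq> {..<n}" "leaves v \<subseteq> {..<n}"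
    using leaves_subset by blast+
  have fin: "finite (leaves u)" "finite (leaves c)" "finite (leaves v)"
    using sub finite_subset by blast+
  have disj: "leaves u \<inter> leaves c = {}" "leaves u \<inter> leaves v = {}" "leaves c \<inter> leaves v = {}"
    using neq by (auto intro!: leaves_disjoint)
  have ne_u: "leaves u \<noteq> {}"
  proof -
    obtain b where b: "adj u b" "b \<noteq> c" using other_neighbour[of u c] U by blast
    then have "b \<notin> inner" using U na nadj by auto
    then show ?thesis using b(1) by (auto simp: leaves_def)
  qed
  have ne_v: "leaves v \<noteq> {}"
  proof -
    obtain b where b: "adj v b" "b \<noteq> c" using other_neighbour[of v c] U by blast
    then have "b \<notin> inner" using U na nadj by auto
    then show ?thesis using b(1) by (auto simp: leaves_def)
  qed
  have V: "{..<n} = {u, c, v} \<union> (leaves u \<union> leaves c \<union> leaves v)"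
    using V_decomposition[OF big'] U by auto
  have cards: "card (leaves u \<union> leaves c) = card (leaves u) + card (leaves c)" "card (leaves u \<union>
    leaves v) = card (leaves u) + card (leaves v)" "card (leaves c \<union> leaves v) = card (leaves c) +
      card (leaves v)" "card (leaves u \<union> leaves c \<union> leaves v) = card (leaves u) + card (leaves c) +
        card (leaves v)"
    using fin disj by (simp_all add: card_Un_disjoint Int_Un_distrib Int_Un_distrib2)
  have "card {..<n} = card {u, c, v} + card (leaves u \<union> leaves c \<union> leaves v)"
    unfolding V by (rule card_Un_disjoint) (use fin out in auto)
  then have n: "card (leaves u) + card (leaves v) + card (leaves c) + 3 = n" using cards neq by simp
  have "{J. J \<subseteq> inner \<and> (\<forall>u\<in>J. \<forall>v\<in>J. \<not> adj u v) \<and>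
      (\<forall>u\<in>inner - J. leaves u \<noteq> {} \<or> (\<exists>w\<in>J. adj w u))} = {{}, {v}, {c}, {u}, {u, v}}" (is "?J = _")
  proof (intro equalityI subsetI)
    fix J assume "J \<in> ?J"
    then have J: "J \<subseteq> inner" "\<And>x y. x \<in> J \<Longrightarrow> y \<in> J \<Longrightarrow> \<not> adj x y"
      "\<And>x. x \<in> inner \<Longrightarrow> x \<notin> J \<Longrightarrow> leaves x \<noteq> {} \<or> (\<exists>w\<in>J. adj w x)" by blast+
    have c1: "\<not> (u \<in> J \<and> c \<in> J)" using J(2)[of u c] adj by blast
    have c2: "\<not> (c \<in> J \<and> v \<in> J)" using J(2)[of c v] adj by blast
    obtain b0 b1 b2 where b: "b0 \<longleftrightarrow> u \<in> J" "b1 \<longleftrightarrow> c \<in> J" "b2 \<longleftrightarrow> v \<in> J" by blast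
    have Je: "J = (if b0 then {u} else {}) \<union> (if b1 then {c} else {}) \<union> (if b2 then {v} else {})"
      using J(1) unfolding b U by auto
    have "\<not> (b0 \<and> b1)" "\<not> (b1 \<and> b2)" using c1 c2 b by blast+
    then show "J \<in> {{}, {v}, {c}, {u}, {u, v}}"
      unfolding Je by (cases b0; cases b1; cases b2) (simp_all add: insert_commute)
  next
    fix J assume "J \<in> {{}, {v}, {c}, {u}, {u, v}}"
    then show "J \<in> ?J"
      unfolding U using ne_u ne_v some na neq adj' nadj by auto
  qed
  then have tops: "tops = {completion {}, completion {v}, completion {c}, completion {u}, completion
    {u, v}}"
    unfolding tops_eq max_indep_iff[OF big'] by simp
  have m1: "completion {} = leaves u \<union> leaves c \<union> leaves v"
    unfolding completion_def U using neq by auto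
  have m2: "completion {v} = insert v (leaves u \<union> leaves c)"
    unfolding completion_def U using neq by auto
  have m3: "completion {c} = insert c (leaves u \<union> leaves v)"
    unfolding completion_def U using neq by auto
  have m4: "completion {u} = insert u (leaves c \<union> leaves v)"
    unfolding completion_def U using neq by auto
  have m5: "completion {u, v} = insert u (insert v (leaves c))"
    unfolding completion_def U using neq by auto
  have "distinct [{}, {v}, {c}, {u}, {u, v}]" using neq by (auto simp: doubleton_eq_iff)
  moreover have "inj_on completion (set [{}, {v}, {c}, {u}, {u, v}])"
    by (rule inj_on_subset[OF completion_inj]) (simp add: U)
  ultimately have dist: "distinct (map completion [{}, {v}, {c}, {u}, {u, v}])"
    unfolding distinct_map by (rule conjI)
  show ?thesis
  proof (rule structure6I)
    show "distinct [leaves u \<union> leaves c \<union> leaves v, insert v (leaves u \<union> leaves c), insert c (leaves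
      u \<union> leaves v), insert u (leaves c \<union> leaves v), insert u (insert v (leaves c))]" using dist
        unfolding list.map m1 m2 m3 m4 m5 .
    show "set [leaves u \<union> leaves c \<union> leaves v, insert v (leaves u \<union> leaves c), insert c (leaves u \<union>
      leaves v), insert u (leaves c \<union> leaves v), insert u (insert v (leaves c))] = tops" unfolding
        tops m1 m2 m3 m4 m5 by simp
    show "(leaves u \<union> leaves c \<union> leaves v) \<inter> (insert v (leaves u \<union> leaves c)) \<inter> (insert c (leaves u
      \<union> leaves v)) \<inter> (insert u (leaves c \<union> leaves v)) \<inter> (insert u (insert v (leaves c))) = {}" using
        neq out disj by auto
    show "1 \<le> card (leaves u)" using fin ne_u ne_v some by (simp add: Suc_le_eq card_gt_0_iff)
    show "1 \<le> card (leaves v)" using fin ne_u ne_v some by (simp add: Suc_le_eq card_gt_0_iff)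
    show "1 \<le> card (leaves c)" using fin ne_u ne_v some by (simp add: Suc_le_eq card_gt_0_iff)
    show "card (leaves u) + card (leaves v) + card (leaves c) + 3 = n" using n by simp
    show "card (leaves u \<union> leaves c \<union> leaves v) = card (leaves u) + card (leaves v) + card (leaves
      c)" using fin out neq cards by simp
    show "card (insert v (leaves u \<union> leaves c)) = card (leaves u) + card (leaves c) + 1" using fin
      out neq cards by simp
    show "card (insert c (leaves u \<union> leaves v)) = card (leaves u) + card (leaves v) + 1" using fin
      out neq cards by simp
    show "card (insert u (leaves c \<union> leaves v)) = card (leaves v) + card (leaves c) + 1" using fin
      out neq cards by simp
    show "card (insert u (insert v (leaves c))) = card (leaves c) + 2" using fin out neq cards by simp
    show "(insert c (leaves u \<union> leaves v)) \<inter> (insert u (insert v (leaves c))) = {}" using neq out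
      disj by auto
    have "(leaves u \<union> leaves c \<union> leaves v) \<inter> (insert v (leaves u \<union> leaves c)) = leaves u \<union> leaves c"
      using neq out disj by auto
    then show "card ((leaves u \<union> leaves c \<union> leaves v) \<inter> (insert v (leaves u \<union> leaves c))) = card
      (leaves u) + card (leaves c)" using fin out neq cards by simp
    have "(leaves u \<union> leaves c \<union> leaves v) \<inter> (insert c (leaves u \<union> leaves v)) = leaves u \<union> leaves v"
      using neq out disj by auto
    then show "card ((leaves u \<union> leaves c \<union> leaves v) \<inter> (insert c (leaves u \<union> leaves v))) = card
      (leaves u) + card (leaves v)" using fin out neq cards by simp
    have "(leaves u \<union> leaves c \<union> leaves v) \<inter> (insert u (leaves c \<union> leaves v)) = leaves c \<union> leaves v"
      using neq out disj by auto
    then show "card ((leaves u \<union> leaves c \<union> leaves v) \<inter> (insert u (leaves c \<union> leaves v))) = card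
      (leaves v) + card (leaves c)" using fin out neq cards by simp
    have "(leaves u \<union> leaves c \<union> leaves v) \<inter> (insert u (insert v (leaves c))) = leaves c" using neq
      out disj by auto
    then show "card ((leaves u \<union> leaves c \<union> leaves v) \<inter> (insert u (insert v (leaves c)))) = card
      (leaves c)" using fin out neq cards by simp
    have "(insert v (leaves u \<union> leaves c)) \<inter> (insert c (leaves u \<union> leaves v)) = leaves u" using neq
      out disj by auto
    then show "card ((insert v (leaves u \<union> leaves c)) \<inter> (insert c (leaves u \<union> leaves v))) = card
      (leaves u)" using fin out neq cards by simp
    have "(insert v (leaves u \<union> leaves c)) \<inter> (insert u (leaves c \<union> leaves v)) = leaves c" using neq
      out disj by auto
    then show "card ((insert v (leaves u \<union> leaves c)) \<inter> (insert u (leaves c \<union> leaves v))) = card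
      (leaves c)" using fin out neq cards by simp
    have "(insert c (leaves u \<union> leaves v)) \<inter> (insert u (leaves c \<union> leaves v)) = leaves v" using neq
      out disj by auto
    then show "card ((insert c (leaves u \<union> leaves v)) \<inter> (insert u (leaves c \<union> leaves v))) = card
      (leaves v)" using fin out neq cards by simp
    have "(insert v (leaves u \<union> leaves c)) \<inter> (insert u (insert v (leaves c))) = insert v (leaves c)"
      using neq out disj by auto
    then show "card ((insert v (leaves u \<union> leaves c)) \<inter> (insert u (insert v (leaves c)))) = card
      (leaves c) + 1" using fin out neq cards by simp
    have "(insert u (leaves c \<union> leaves v)) \<inter> (insert u (insert v (leaves c))) = insert u (leaves c)"
      using neq out disj by auto
    then show "card ((insert u (leaves c \<union> leaves v)) \<inter> (insert u (insert v (leaves c)))) = card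
      (leaves c) + 1" using fin out neq cards by simp
  qed
qed

lemma quadruple_structure5:
  assumes big: "n \<ge> 3" and U: "inner = {w, u, c, v}"
    and adj: "adj w u" "adj u c" "adj c v"
    and ap: "apart w c" "apart w v" "apart u v"
    and none: "leaves u = {}" "leaves c = {}"
  shows "structure5 n H"
proof -
  have big': "card {..<n} \<ge> 3" using big by simp
  have na: "\<not> adj x x" for x by (rule adj_irrefl)
  have neq: "w \<noteq> u" "w \<noteq> c" "w \<noteq> v" "u \<noteq> c" "u \<noteq> v" "c \<noteq> v"
    using adj na ap by (auto simp: apart_def)
  note adj' = adj adj[THEN adj_sym]
  have nadj: "\<not> adj w c" "\<not> adj c w" "\<not> adj w v" "\<not> adj v w" "\<not> adj u v" "\<not> adj v u"
    using ap by (simp_all add: apart_def)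
  have out: "w \<notin> leaves w" "w \<notin> leaves u" "w \<notin> leaves c" "w \<notin> leaves v" "u \<notin> leaves w" "u \<notin> leaves
    u" "u \<notin> leaves c" "u \<notin> leaves v" "c \<notin> leaves w" "c \<notin> leaves u" "c \<notin> leaves c" "c \<notin> leaves v" "v
      \<notin> leaves w" "v \<notin> leaves u" "v \<notin> leaves c" "v \<notin> leaves v"
    using U leaves_Int_inner by blast+
  have lt: "w < n" "u < n" "c < n" "v < n"
    using U inner_subset by auto
  have sub: "leaves w \<subseteq> {..<n}" "leaves v \<subseteq> {..<n}"
    using leaves_subset by blast+
  have fin: "finite (leaves w)" "finite (leaves v)"
    using sub finite_subset by blast+
  have disj: "leaves w \<inter> leaves v = {}"
    using neq by (auto intro!: leaves_disjoint)
  have ne_w: "leaves w \<noteq> {}"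
  proof -
    obtain b where b: "adj w b" "b \<noteq> u" using other_neighbour[of w u] U by blast
    then have "b \<notin> inner" using U na nadj by auto
    then show ?thesis using b(1) by (auto simp: leaves_def)
  qed
  have ne_v: "leaves v \<noteq> {}"
  proof -
    obtain b where b: "adj v b" "b \<noteq> c" using other_neighbour[of v c] U by blast
    then have "b \<notin> inner" using U na nadj by auto
    then show ?thesis using b(1) by (auto simp: leaves_def)
  qed
  have V: "{..<n} = {w, u, c, v} \<union> (leaves w \<union> leaves v)"
    using V_decomposition[OF big'] U none by auto
  have cards: "card (leaves w \<union> leaves v) = card (leaves w) + card (leaves v)"
    using fin disj by (simp_all add: card_Un_disjoint Int_Un_distrib Int_Un_distrib2)
  have "card {..<n} = card {w, u, c, v} + card (leaves w \<union> leaves v)"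
    unfolding V by (rule card_Un_disjoint) (use fin out in auto)
  then have n: "card (leaves w) + card (leaves v) + 4 = n" using cards neq by simp
  have "{J. J \<subseteq> inner \<and> (\<forall>u\<in>J. \<forall>v\<in>J. \<not> adj u v) \<and>
      (\<forall>u\<in>inner - J. leaves u \<noteq> {} \<or> (\<exists>w\<in>J. adj w u))} = {{u}, {c}, {u, v}, {w, c}, {w, v}}" (is "?J
        = _")
  proof (intro equalityI subsetI)
    fix J assume "J \<in> ?J"
    then have J: "J \<subseteq> inner" "\<And>x y. x \<in> J \<Longrightarrow> y \<in> J \<Longrightarrow> \<not> adj x y"
      "\<And>x. x \<in> inner \<Longrightarrow> x \<notin> J \<Longrightarrow> leaves x \<noteq> {} \<or> (\<exists>w\<in>J. adj w x)" by blast+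
    have c1: "\<not> (w \<in> J \<and> u \<in> J)" using J(2)[of w u] adj by blast
    have c2: "\<not> (u \<in> J \<and> c \<in> J)" using J(2)[of u c] adj by blast
    have c3: "\<not> (c \<in> J \<and> v \<in> J)" using J(2)[of c v] adj by blast
    have c4: "u \<in> J \<or> w \<in> J \<or> c \<in> J"
      using J(1) J(3)[of u] none nadj na unfolding U by blast
    have c5: "c \<in> J \<or> u \<in> J \<or> v \<in> J"
      using J(1) J(3)[of c] none nadj na unfolding U by blast
    obtain b0 b1 b2 b3 where b: "b0 \<longleftrightarrow> w \<in> J" "b1 \<longleftrightarrow> u \<in> J" "b2 \<longleftrightarrow> c \<in> J" "b3 \<longleftrightarrow> v \<in> J" by blast
    have Je: "J = (if b0 then {w} else {}) \<union> (if b1 then {u} else {}) \<union> (if b2 then {c} else {}) \<union>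
      (if b3 then {v} else {})"
      using J(1) unfolding b U by auto
    have "\<not> (b0 \<and> b1)" "\<not> (b1 \<and> b2)" "\<not> (b2 \<and> b3)" "b1 \<or> b0 \<or> b2" "b2 \<or> b1 \<or> b3" using c1 c2 c3 c4
      c5 b by blast+
    then show "J \<in> {{u}, {c}, {u, v}, {w, c}, {w, v}}"
      unfolding Je by (cases b0; cases b1; cases b2; cases b3) (simp_all add: insert_commute)
  next
    fix J assume "J \<in> {{u}, {c}, {u, v}, {w, c}, {w, v}}"
    then show "J \<in> ?J"
      unfolding U using ne_w ne_v na neq adj' nadj by auto
  qed
  then have tops: "tops = {completion {u}, completion {c}, completion {u, v}, completion {w, c},
    completion {w, v}}"
    unfolding tops_eq max_indep_iff[OF big'] by simp
  have m1: "completion {u} = insert u (leaves w \<union> leaves v)"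
    unfolding completion_def U using neq none by auto
  have m2: "completion {c} = insert c (leaves w \<union> leaves v)"
    unfolding completion_def U using neq none by auto
  have m3: "completion {u, v} = insert u (insert v (leaves w))"
    unfolding completion_def U using neq none by auto
  have m4: "completion {w, c} = insert w (insert c (leaves v))"
    unfolding completion_def U using neq none by auto
  have m5: "completion {w, v} = {w, v}"
    unfolding completion_def U using neq none by auto
  have "distinct [{u}, {c}, {u, v}, {w, c}, {w, v}]" using neq by (auto simp: doubleton_eq_iff)
  moreover have "inj_on completion (set [{u}, {c}, {u, v}, {w, c}, {w, v}])"
    by (rule inj_on_subset[OF completion_inj]) (simp add: U)
  ultimately have dist: "distinct (map completion [{u}, {c}, {u, v}, {w, c}, {w, v}])"
    unfolding distinct_map by (rule conjI)
  show ?thesis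
  proof (rule structure5I)
    show "distinct [insert u (leaves w \<union> leaves v), insert c (leaves w \<union> leaves v), insert u (insert
      v (leaves w)), insert w (insert c (leaves v)), {w, v}]" using dist unfolding list.map m1 m2 m3
        m4 m5 .
    show "set [insert u (leaves w \<union> leaves v), insert c (leaves w \<union> leaves v), insert u (insert v
      (leaves w)), insert w (insert c (leaves v)), {w, v}] = tops" unfolding tops m1 m2 m3 m4 m5 by
        simp
    show "(insert u (leaves w \<union> leaves v)) \<inter> (insert c (leaves w \<union> leaves v)) \<inter> (insert u (insert v
      (leaves w))) \<inter> (insert w (insert c (leaves v))) \<inter> ({w, v}) = {}" using neq out disj by auto
    show "1 \<le> card (leaves w)" using fin ne_w ne_v by (simp add: Suc_le_eq card_gt_0_iff)
    show "1 \<le> card (leaves v)" using fin ne_w ne_v by (simp add: Suc_le_eq card_gt_0_iff)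
    show "card (leaves w) + card (leaves v) + 4 = n" using n by simp
    show "card (insert u (leaves w \<union> leaves v)) = card (leaves w) + card (leaves v) + 1" using fin
      out neq cards by simp
    show "card (insert c (leaves w \<union> leaves v)) = card (leaves w) + card (leaves v) + 1" using fin
      out neq cards by simp
    show "card (insert u (insert v (leaves w))) = card (leaves w) + 2" using fin out neq cards by simp
    show "card (insert w (insert c (leaves v))) = card (leaves v) + 2" using fin out neq cards by simp
    show "card ({w, v}) = 2" using fin out neq cards by simp
    show "(insert u (insert v (leaves w))) \<inter> (insert w (insert c (leaves v))) = {}" using neq out
      disj by auto
    show "({w, v}) \<inter> (insert u (leaves w \<union> leaves v)) = {}" using neq out disj by auto
    show "({w, v}) \<inter> (insert c (leaves w \<union> leaves v)) = {}" using neq out disj by auto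
    have "(insert u (leaves w \<union> leaves v)) \<inter> (insert c (leaves w \<union> leaves v)) = leaves w \<union> leaves v"
      using neq out disj by auto
    then show "card ((insert u (leaves w \<union> leaves v)) \<inter> (insert c (leaves w \<union> leaves v))) = card
      (leaves w) + card (leaves v)" using fin out neq cards by simp
    have "(insert u (leaves w \<union> leaves v)) \<inter> (insert u (insert v (leaves w))) = insert u (leaves w)"
      using neq out disj by auto
    then show "card ((insert u (leaves w \<union> leaves v)) \<inter> (insert u (insert v (leaves w)))) = card
      (leaves w) + 1" using fin out neq cards by simp
    have "(insert u (leaves w \<union> leaves v)) \<inter> (insert w (insert c (leaves v))) = leaves v" using neq
      out disj by auto
    then show "card ((insert u (leaves w \<union> leaves v)) \<inter> (insert w (insert c (leaves v)))) = card
      (leaves v)" using fin out neq cards by simp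
    have "(insert c (leaves w \<union> leaves v)) \<inter> (insert u (insert v (leaves w))) = leaves w" using neq
      out disj by auto
    then show "card ((insert c (leaves w \<union> leaves v)) \<inter> (insert u (insert v (leaves w)))) = card
      (leaves w)" using fin out neq cards by simp
    have "(insert c (leaves w \<union> leaves v)) \<inter> (insert w (insert c (leaves v))) = insert c (leaves v)"
      using neq out disj by auto
    then show "card ((insert c (leaves w \<union> leaves v)) \<inter> (insert w (insert c (leaves v)))) = card
      (leaves v) + 1" using fin out neq cards by simp
    have "(insert u (insert v (leaves w))) \<inter> ({w, v}) = {v}" using neq out disj by auto
    then show "card ((insert u (insert v (leaves w))) \<inter> ({w, v})) = 1" using fin out neq cards by simp
    have "(insert w (insert c (leaves v))) \<inter> ({w, v}) = {w}" using neq out disj by auto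
    then show "card ((insert w (insert c (leaves v))) \<inter> ({w, v})) = 1" using fin out neq cards by simp
  qed
qed

theorem exactly_one_structure:
  assumes few: "card (maximal_vertices H) \<le> 5"
  shows "exactly_one [structure1 H, structure2 n H, structure3 n H,
           structure4 n H, structure5 n H, structure6 n H]"
proof -
  let ?S = "[structure1 H, structure2 n H, structure3 n H, structure4 n H, structure5 n H,
    structure6 n H]"
  have few': "card {S. max_indep S} \<le> 5" using few card_maximal_vertices tops_eq by simp
  let ?c = "card {K. maximal_hypercube H K}"
  have s3: "?c = 3 \<and> \<not> structure2 n H" if "structure3 n H"
    using structure3_hypercubes[OF that] maximal_hypercubes_card structure2_excluded by metis
  have s4: "?c = 4 \<and> \<not> structure2 n H" if "structure4 n H"
    using structure4_hypercubes[OF that] maximal_hypercubes_card structure2_excluded by metis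
  have s5: "?c = 5 \<and> \<not> structure2 n H" if "structure5 n H"
    using structure5_hypercubes[OF that] maximal_hypercubes_card structure2_excluded by metis
  have s6: "?c = 5 \<and> \<not> structure2 n H" if "structure6 n H"
    using structure6_hypercubes[OF that] maximal_hypercubes_card structure2_excluded by metis
  have s1: "\<not> structure2 n H \<and> \<not> structure3 n H \<and> \<not> structure4 n H \<and> \<not> structure5 n H \<and> \<not> structure6
    n H"
    if "structure1 H"
    using that unfolding structure1_iff structure2_def structure3_def structure4_def structure5_def
      structure6_def
    by auto
  have excl: "i = k" if "i < 6" "k < 6" "?S ! i" "?S ! k" for i k
    using less_6[OF that(1)] less_6[OF that(2)] that(3,4) s1 s3 s4 s5 s6 structure5_not_6[of n H]
    by (elim disjE) simp_all
  have "\<exists>k<6. ?S ! k"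
  proof (cases "n \<ge> 3")
    case True
    then have big: "card {..<n} \<ge> 3" by simp
    show ?thesis
    proof (rule few_max_indep_cases[OF few' big])
      fix c assume U: "inner = {c}"
      have c: "c < n" using U inner_subset by auto
      have V: "{..<n} = {c} \<union> leaves c" using V_decomposition[OF big] U by simp
      have "structure2 n H"
      proof (rule star_structure2[OF _ c])
        show "adj x y \<longleftrightarrow> x < n \<and> y < n \<and> x \<noteq> y \<and> (x = c \<or> y = c)" for x y
        proof
          assume xy: "adj x y"
          have lt: "x < n" "y < n" using adj_V[OF xy] adj_V[OF adj_sym[OF xy]] by auto
          have "x = c \<or> y = c"
          proof (rule ccontr)
            assume "\<not> (x = c \<or> y = c)"
            then have "x \<in> leaves c" using V lt(1) by auto
            then have "y = c" using leaf_neighbour_unique xy by blast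
            then show False using \<open>\<not> (x = c \<or> y = c)\<close> by simp
          qed
          then show "x < n \<and> y < n \<and> x \<noteq> y \<and> (x = c \<or> y = c)" using lt xy adj_irrefl by blast
        next
          assume r: "x < n \<and> y < n \<and> x \<noteq> y \<and> (x = c \<or> y = c)"
          have "adj c z" if "z < n" "z \<noteq> c" for z using V that by (auto simp: leaves_def)
          then show "adj x y" using r adj_sym by blast
        qed
      qed (use True in simp)
      then show ?thesis by (intro exI[of _ 1]) simp
    next
      fix u v assume "inner = {u, v}" "adj u v"
      then have "structure3 n H" using double_star_structure3 True by blast
      then show ?thesis by (intro exI[of _ 2]) simp
    next
      fix u c v assume *: "inner = {u, c, v}" "adj u c" "adj c v" "apart u v"
      show ?thesis
      proof (cases "leaves c = {}")
        case True
        then have "structure4 n H" using bare_triple_structure4 * \<open>n \<ge> 3\<close> by blast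
        then show ?thesis by (intro exI[of _ 3]) simp
      next
        case False
        then have "structure6 n H" using triple_structure6 * \<open>n \<ge> 3\<close> by blast
        then show ?thesis by (intro exI[of _ 5]) simp
      qed
    next
      fix w u c v assume "inner = {w, u, c, v}" "adj w u" "adj u c" "adj c v" "apart w c" "apart w
        v" "apart u v"
        "leaves u = {}" "leaves c = {}"
      then have "structure5 n H" using quadruple_structure5 True by blast
      then show ?thesis by (intro exI[of _ 4]) simp
    qed
  next
    case False
    then consider "n = 1" | "n = 2" using n_pos by linarith
    then show ?thesis
    proof cases
      case 1
      then have "structure1 H" by (simp add: structure1_iff)
      then show ?thesis by (intro exI[of _ 0]) simp
    next
      case 2
      obtain w where w: "adj 0 w" using neighbour_exists[of 0] 2 by auto
      have lt: "x < 2" "y < 2" if "adj x y" for x y using adj_V[OF that] adj_V[OF adj_sym[OF that]]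
        2 by auto
      have "w = 1" using w lt[OF w] adj_irrefl[of 0] by (cases "w = 0") auto
      then have a: "adj 0 1" "adj 1 0" using w adj_sym by auto
      have "structure2 n H"
      proof (rule star_structure2[of 0])
        show "adj x y \<longleftrightarrow> x < n \<and> y < n \<and> x \<noteq> y \<and> (x = 0 \<or> y = 0)" for x y
        proof
          assume xy: "adj x y"
          then have "x \<noteq> y" using adj_irrefl by blast
          then show "x < n \<and> y < n \<and> x \<noteq> y \<and> (x = 0 \<or> y = 0)" using lt[OF xy] 2 by auto
        next
          assume "x < n \<and> y < n \<and> x \<noteq> y \<and> (x = 0 \<or> y = 0)"
          then have "x = 0 \<and> y = 1 \<or> x = 1 \<and> y = 0" using 2 by auto
          then show "adj x y" using a by blast
        qed
      qed (use 2 in simp_all)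
      then show ?thesis by (intro exI[of _ 1]) simp
    qed
  qed
  then obtain k where "k < 6" "?S ! k" by blast
  then show ?thesis using excl by (intro exactly_oneI) blast+
qed

end

section \<open>Flipping faces\<close>

context plane_bipartite
begin

text \<open>On \<open>Q\<close> one can switch from \<open>M\<close> to \<open>N\<close>; as the difference is a single cycle, this switch is
  the whole change.\<close>

lemma cycle_closed_part:
  assumes M: "perfect_matching G M" and N: "perfect_matching G N" and C: "is_cycle_edge_set G
    (sym_diff M N)"
    and Q: "Q \<subseteq> A" and closed: "\<And>a a'. a \<in> Q \<Longrightarrow> a' \<in> A \<Longrightarrow> mate M a' = mate N a \<Longrightarrow> a' \<in> Q"
    and moved: "a \<in> Q" "mate M a \<noteq> mate N a" and x: "x \<in> A" "x \<notin> Q"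
  shows "mate M x = mate N x"
proof -
  have closed': "\<forall>a\<in>Q. \<forall>a'\<in>A. mate M a' = mate N a \<longrightarrow> a' \<in> Q" using closed by blast
  obtain L where L: "perfect_matching G L" "L \<subseteq> M \<union> N"
    "\<And>a. a \<in> A \<Longrightarrow> mate L a = (if a \<in> Q then mate N a else mate M a)"
    using matching_splice[OF M N Q closed'] by blast
  have "L \<noteq> M" using L(3)[of a] moved Q by auto
  then have "L = N" using cycle_two_matchings[OF M N L(1) C L(2)] by blast
  then show ?thesis using L(3)[OF x(1)] x(2) by simp
qed

lemma edge_in_sym_diff:
  assumes M: "perfect_matching G M" and N: "perfect_matching G N" and a: "a \<in> A"
  shows "{a, b} \<in> sym_diff M N \<longleftrightarrow> mate M a \<noteq> mate N a \<and> (b = mate M a \<or> b = mate N a)"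
proof -
  have "{a, b} \<in> M \<longleftrightarrow> b = mate M a" using mate_eq[OF M] mate_edge(1)[OF M a] by blast
  moreover have "{a, b} \<in> N \<longleftrightarrow> b = mate N a" using mate_eq[OF N] mate_edge(1)[OF N a] by blast
  ultimately show ?thesis by auto
qed

lemma sym_diff_eqI:
  assumes pm: "perfect_matching G M" "perfect_matching G N" "perfect_matching G M'"
    "perfect_matching G N'"
    and same: "\<And>a. a \<in> A \<Longrightarrow> mate M a \<noteq> mate N a \<longleftrightarrow> mate M' a \<noteq> mate N' a"
      "\<And>a. a \<in> A \<Longrightarrow> mate M a \<noteq> mate N a \<Longrightarrow> mate M a = mate M' a \<and> mate N a = mate N' a"
  shows "sym_diff M N = sym_diff M' N'"
proof -
  have "e \<in> sym_diff M N \<longleftrightarrow> e \<in> sym_diff M' N'" if E: "e \<in> edges G" for e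
  proof -
    obtain a b where ab: "a \<in> A" "b \<in> B" "e = {a, b}" by (rule edge_ends[OF E])
    show ?thesis
      unfolding ab(3) edge_in_sym_diff[OF pm(1,2) ab(1)] edge_in_sym_diff[OF pm(3,4) ab(1)]
      using same[OF ab(1)] by auto
  qed
  moreover have "sym_diff M N \<subseteq> edges G" "sym_diff M' N' \<subseteq> edges G" using pm matching_edges by blast+
  ultimately show ?thesis by (intro set_eqI) (meson subsetD)
qed

lemma resonance_edge_iff:
  "{M, N} \<in> edges (resonance_graph G \<gamma>) \<longleftrightarrow>
    perfect_matching G M \<and> perfect_matching G N \<and> is_cycle_edge_set G (sym_diff M N) \<and>
    (\<exists>F\<in>finite_faces G \<gamma>. is_periphery \<gamma> (sym_diff M N) F)" (is "?l \<longleftrightarrow> ?r M N")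
proof
  assume ?l
  then obtain M' N' where *: "{M, N} = {M', N'}" "?r M' N'" unfolding resonance_graph_def by auto
  have "sym_diff N' M' = sym_diff M' N'" by (rule Un_commute)
  then show "?r M N" using * unfolding doubleton_eq_iff by metis
qed (auto simp: resonance_graph_def)

lemma face_point:
  assumes "F \<in> finite_faces G \<gamma>"
  obtains z where "z \<in> F" "z \<notin> drawing G \<gamma>"
proof -
  have F: "F \<in> components (- drawing G \<gamma>)" using assms by (simp add: finite_faces_def)
  then have "F \<noteq> {}" "F \<subseteq> - drawing G \<gamma>" using in_components_nonempty in_components_subset by blast+
  then show thesis using that by blast
qed

lemma faces_disjoint:
  assumes "F \<in> finite_faces G \<gamma>" "F' \<in> finite_faces G \<gamma>" "z \<in> F" "z \<in> F'"
  shows "F = F'"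
  using assms components_nonoverlap[of F "- drawing G \<gamma>" F'] by (auto simp: finite_faces_def)

lemma resonance_edge_turn:
  assumes "{M, N} \<in> edges (resonance_graph G \<gamma>)"
  shows "\<exists>F s. F \<in> finite_faces G \<gamma> \<and> is_periphery \<gamma> (sym_diff M N) F \<and> s \<in> {1, -1} \<and>
    (\<forall>z. z \<notin> drawing G \<gamma> \<longrightarrow> matching_turn z N - matching_turn z M = (if z \<in> F then s else 0))"
proof -
  have *: "perfect_matching G M" "perfect_matching G N" "is_cycle_edge_set G (sym_diff M N)"
    using assms unfolding resonance_edge_iff by blast+
  obtain F where F: "F \<in> finite_faces G \<gamma>" "is_periphery \<gamma> (sym_diff M N) F"
    using assms unfolding resonance_edge_iff by blast
  show ?thesis
  proof (rule cycle_turn_diff[OF *])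
    fix s :: complex
    assume s: "s \<in> {1, -1}"
      "\<And>F z. F \<in> finite_faces G \<gamma> \<Longrightarrow> is_periphery \<gamma> (sym_diff M N) F \<Longrightarrow> z \<notin> drawing G \<gamma> \<Longrightarrow>
         matching_turn z N - matching_turn z M = (if z \<in> F then s else 0)"
    show ?thesis
      by (rule exI[of _ F], rule exI[of _ s], intro conjI allI impI) (rule F s(1) s(2)[OF F];
        assumption)+
  qed
qed

lemma sym_diff_cancel:
  assumes "sym_diff M N = sym_diff M N'"
  shows "N = N'"
proof (rule set_eqI)
  fix x
  have "x \<in> sym_diff M N \<longleftrightarrow> x \<in> sym_diff M N'" using assms by simp
  then show "x \<in> N \<longleftrightarrow> x \<in> N'" by auto
qed

text \<open>Evaluated at a point of the face flipped from \<open>M\<close> to \<open>M1\<close>, the turning numbers along the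
  two ways from \<open>M\<close> to \<open>N\<close> show that the same face is flipped from \<open>M2\<close> to \<open>N\<close>, and in the same
  sense.\<close>

lemma resonance_square:
  assumes e: "{M, M1} \<in> edges (resonance_graph G \<gamma>)" "{M, M2} \<in> edges (resonance_graph G \<gamma>)"
    "{M1, N} \<in> edges (resonance_graph G \<gamma>)" "{M2, N} \<in> edges (resonance_graph G \<gamma>)"
    and ne: "M1 \<noteq> M2" "M \<noteq> N"
  shows "sym_diff M M1 = sym_diff M2 N"
    and "z \<notin> drawing G \<gamma> \<Longrightarrow>
      matching_turn z M1 - matching_turn z M = matching_turn z N - matching_turn z M2"
proof -
  have pm: "perfect_matching G M" "perfect_matching G M1" "perfect_matching G M2" "perfect_matching
    G N"
    using e unfolding resonance_edge_iff by blast+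
  have sub: "sym_diff K L \<subseteq> edges G" if "perfect_matching G K" "perfect_matching G L" for K L
    using that matching_edges by blast
  obtain F1 s1 where 1: "F1 \<in> finite_faces G \<gamma>" "is_periphery \<gamma> (sym_diff M M1) F1" "s1 \<in> {1, -1}"
    "\<And>z. z \<notin> drawing G \<gamma> \<Longrightarrow> matching_turn z M1 - matching_turn z M = (if z \<in> F1 then s1 else 0)"
    using resonance_edge_turn[OF e(1)] by blast
  obtain F2 s2 where 2: "F2 \<in> finite_faces G \<gamma>" "is_periphery \<gamma> (sym_diff M M2) F2" "s2 \<in> {1, -1}"
    "\<And>z. z \<notin> drawing G \<gamma> \<Longrightarrow> matching_turn z M2 - matching_turn z M = (if z \<in> F2 then s2 else 0)"
    using resonance_edge_turn[OF e(2)] by blast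
  obtain F3 s3 where 3: "F3 \<in> finite_faces G \<gamma>" "is_periphery \<gamma> (sym_diff M1 N) F3" "s3 \<in> {1, -1}"
    "\<And>z. z \<notin> drawing G \<gamma> \<Longrightarrow> matching_turn z N - matching_turn z M1 = (if z \<in> F3 then s3 else 0)"
    using resonance_edge_turn[OF e(3)] by blast
  obtain F4 s4 where 4: "F4 \<in> finite_faces G \<gamma>" "is_periphery \<gamma> (sym_diff M2 N) F4" "s4 \<in> {1, -1}"
    "\<And>z. z \<notin> drawing G \<gamma> \<Longrightarrow> matching_turn z N - matching_turn z M2 = (if z \<in> F4 then s4 else 0)"
    using resonance_edge_turn[OF e(4)] by blast
  have "F1 \<noteq> F2"
  proof
    assume "F1 = F2"
    then have "sym_diff M M1 = sym_diff M M2"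
      using periphery_determines_edges[OF sub[OF pm(1,2)] sub[OF pm(1,3)]] 1(2) 2(2) by blast
    then show False using ne(1) sym_diff_cancel by blast
  qed
  have "F1 \<noteq> F3"
  proof
    assume "F1 = F3"
    then have "sym_diff M M1 = sym_diff M1 N"
      using periphery_determines_edges[OF sub[OF pm(1,2)] sub[OF pm(2,4)]] 1(2) 3(2) by blast
    then have "sym_diff M1 M = sym_diff M1 N" by (simp only: Un_commute)
    then show False using ne(2) sym_diff_cancel by blast
  qed
  have eq: "(if z \<in> F1 then s1 else 0) + (if z \<in> F3 then s3 else 0) =
      (if z \<in> F2 then s2 else 0) + (if z \<in> F4 then s4 else 0)" if "z \<notin> drawing G \<gamma>" for z
    unfolding 1(4)[OF that, symmetric] 2(4)[OF that, symmetric] 3(4)[OF that, symmetric]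
      4(4)[OF that, symmetric] by simp
  obtain z1 where z1: "z1 \<in> F1" "z1 \<notin> drawing G \<gamma>" by (rule face_point[OF 1(1)])
  have "z1 \<notin> F2" "z1 \<notin> F3"
    using faces_disjoint[OF 1(1) 2(1) z1(1)] faces_disjoint[OF 1(1) 3(1) z1(1)] \<open>F1 \<noteq> F2\<close> \<open>F1 \<noteq> F3\<close>
      by blast+
  then have "s1 = (if z1 \<in> F4 then s4 else 0)" using eq[OF z1(2)] z1(1) by simp
  then have "z1 \<in> F4" "s4 = s1" using 1(3) by (auto split: if_splits)
  then have F41: "F4 = F1" using faces_disjoint[OF 1(1) 4(1) z1(1)] by blast
  then show "sym_diff M M1 = sym_diff M2 N"
    using periphery_determines_edges[OF sub[OF pm(1,2)] sub[OF pm(3,4)]] 1(2) 4(2) by blast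
  show "matching_turn z M1 - matching_turn z M = matching_turn z N - matching_turn z M2"
    if "z \<notin> drawing G \<gamma>"
    using 1(4)[OF that] 4(4)[OF that] F41 \<open>s4 = s1\<close> by simp
qed

end

section \<open>Resonance graphs that are daisy cubes\<close>

text \<open>The resonance graph is a daisy cube via \<open>g\<close>, where the vertices of the daisy cube are
  given by their supports.\<close>

locale resonance_daisy = plane_bipartite +
  fixes n :: nat and \<X> :: "nat set set" and g :: "nat set \<Rightarrow> complex set set"
  assumes X_sub: "\<And>S. S \<in> \<X> \<Longrightarrow> S \<subseteq> {..<n}" and X_empty: "{} \<in> \<X>"
    and X_down: "\<And>S T. S \<in> \<X> \<Longrightarrow> T \<subseteq> S \<Longrightarrow> T \<in> \<X>"
    and g_bij: "bij_betw g \<X> {M. perfect_matching G M}"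
    and g_edge: "\<And>S T. S \<in> \<X> \<Longrightarrow> T \<in> \<X> \<Longrightarrow>
      card (sym_diff S T) = 1 \<longleftrightarrow> {g S, g T} \<in> edges (resonance_graph G \<gamma>)"
    and allowed_connected: "connected_graph \<lparr>verts = \<Union>(allowed_edges G), edges = allowed_edges G\<rparr>"
    and card_faces: "card (finite_faces G \<gamma>) = n" and n_pos: "n \<ge> 1"
begin

lemma g_matching: "S \<in> \<X> \<Longrightarrow> perfect_matching G (g S)"
  using g_bij bij_betwE by blast

lemma g_inj: "S \<in> \<X> \<Longrightarrow> T \<in> \<X> \<Longrightarrow> g S = g T \<longleftrightarrow> S = T"
  using g_bij unfolding bij_betw_def inj_on_def by blast

lemma g_surj:
  assumes "perfect_matching G M"
  obtains S where "S \<in> \<X>" "M = g S"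
  using assms g_bij unfolding bij_betw_def by blast

lemma finite_member: "S \<in> \<X> \<Longrightarrow> finite S"
  using X_sub finite_subset by blast

lemma flip_edge: "S \<in> \<X> \<Longrightarrow> i \<in> S \<Longrightarrow> {g (S - {i}), g S} \<in> edges (resonance_graph G \<gamma>)"
proof -
  assume S: "S \<in> \<X>" "i \<in> S"
  have "S - {i} \<in> \<X>" using X_down[OF S(1)] by blast
  moreover have "sym_diff (S - {i}) S = {i}" using S(2) by blast
  ultimately show ?thesis using g_edge[of "S - {i}" S] S(1) by simp
qed

abbreviation f0 :: "complex \<Rightarrow> complex" where "f0 \<equiv> mate (g {})"
abbreviation f :: "nat \<Rightarrow> complex \<Rightarrow> complex" where "f i \<equiv> mate (g {i})"

text \<open>The vertices in \<open>A\<close> on the cycle that is flipped between \<open>g {}\<close> and \<open>g {i}\<close>.\<close>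

definition part :: "nat \<Rightarrow> complex set" where
  "part i = {a \<in> A. f0 a \<noteq> f i a}"

definition flip :: "nat \<Rightarrow> complex \<Rightarrow> complex" where
  "flip i z = matching_turn z (g {i}) - matching_turn z (g {})"

text \<open>Opposite edges of a square flip the same face in the same sense, and any two edges of one
  direction below \<open>S\<close> are joined by squares.\<close>

lemma direction:
  assumes "S \<in> \<X>" "i \<in> S"
  shows "sym_diff (g (S - {i})) (g S) = sym_diff (g {}) (g {i}) \<and>
    (\<forall>z. z \<notin> drawing G \<gamma> \<longrightarrow> matching_turn z (g S) - matching_turn z (g (S - {i})) = flip i z)"
  using assms
proof (induction "card S" arbitrary: S rule: less_induct)
  case less
  have fin: "finite S" using finite_member less.prems(1) .
  show ?case
  proof (cases "S = {i}")
    case True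
    then show ?thesis by (simp add: flip_def)
  next
    case False
    then obtain j where j: "j \<in> S" "j \<noteq> i" using less.prems(2) by blast
    let ?Sj = "S - {j}" and ?Si = "S - {i}" and ?T = "S - {i, j}"
    have X: "?Sj \<in> \<X>" "?Si \<in> \<X>" "?T \<in> \<X>" using X_down[OF less.prems(1)] by blast+
    have T: "?Sj - {i} = ?T" "?Si - {j} = ?T" by blast+
    have i: "i \<in> ?Sj" "j \<in> ?Si" using j less.prems(2) by blast+
    have IH: "sym_diff (g ?T) (g ?Sj) = sym_diff (g {}) (g {i})"
      "\<And>z. z \<notin> drawing G \<gamma> \<Longrightarrow> matching_turn z (g ?Sj) - matching_turn z (g ?T) = flip i z"
      using less.hyps[OF card_Diff1_less[OF fin j(1)] X(1) i(1)] unfolding T by blast+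
    have e: "{g ?T, g ?Sj} \<in> edges (resonance_graph G \<gamma>)" "{g ?T, g ?Si} \<in> edges (resonance_graph G
      \<gamma>)"
      using flip_edge[OF X(1) i(1)] flip_edge[OF X(2) i(2)] unfolding T by blast+
    have "?Sj \<noteq> ?Si" "?T \<noteq> S" using j less.prems(2) by blast+
    then have ne: "g ?Sj \<noteq> g ?Si" "g ?T \<noteq> g S" using g_inj X less.prems(1) by auto
    note sq = resonance_square[OF e flip_edge[OF less.prems(1) j(1)] flip_edge[OF less.prems] ne]
    show ?thesis using sq(1) sq(2) IH by metis
  qed
qed

lemma turn_sum:
  assumes "S \<in> \<X>" "z \<notin> drawing G \<gamma>"
  shows "matching_turn z (g S) = matching_turn z (g {}) + (\<Sum>i\<in>S. flip i z)"
proof -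
  have "finite S" using finite_member assms(1) .
  then show ?thesis using assms(1)
  proof (induction rule: finite_induct)
    case (insert i S)
    have "S \<in> \<X>" using X_down[OF insert.prems] by blast
    moreover have "insert i S - {i} = S" using insert.hyps(2) by blast
    ultimately show ?case
      using direction[OF insert.prems, of i] insert.IH insert.hyps assms(2) by (simp add:
        algebra_simps)
  qed simp
qed

lemma flip_face:
  assumes "{i} \<in> \<X>"
  shows "\<exists>F s. F \<in> finite_faces G \<gamma> \<and> is_periphery \<gamma> (sym_diff (g {}) (g {i})) F \<and> s \<in> {1, -1} \<and>
    (\<forall>z. z \<notin> drawing G \<gamma> \<longrightarrow> flip i z = (if z \<in> F then s else 0))"
proof -
  have "{g {}, g {i}} \<in> edges (resonance_graph G \<gamma>)" using flip_edge[OF assms, of i] by simp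
  then show ?thesis unfolding flip_def by (rule resonance_edge_turn)
qed

lemma single_cycle: "{i} \<in> \<X> \<Longrightarrow> is_cycle_edge_set G (sym_diff (g {}) (g {i}))"
  using flip_edge[of "{i}" i] by (simp add: resonance_edge_iff)

lemma part_sub: "part i \<subseteq> A" by (auto simp: part_def)

lemma part_step:
  assumes i: "{i} \<in> \<X>" and a: "a \<in> part i" "a' \<in> A" "f0 a' = f i a"
  shows "a' \<in> part i"
proof (rule ccontr)
  assume "a' \<notin> part i"
  then have "f i a' = f i a" using a(2,3) by (simp add: part_def)
  then have "a' = a"
    using mate_bij[OF g_matching[OF i]] a(1,2) part_sub unfolding bij_betw_def inj_on_def by blast
  then show False using a(1,3) by (simp add: part_def)
qed

lemma part_nonempty:
  assumes "{i} \<in> \<X>"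
  shows "part i \<noteq> {}"
proof
  assume "part i = {}"
  then have "f0 a = f i a" if "a \<in> A" for a using that by (auto simp: part_def)
  then have "g {} = g {i}" by (rule matching_eqI[OF g_matching[OF X_empty] g_matching[OF assms]])
  then show False using g_inj[OF X_empty assms] by simp
qed

text \<open>If the two cycles agreed where they meet, the common part would be closed under both and
  hence be all of both, so that the two matchings would coincide.\<close>

lemma common_part_differs:
  assumes i: "{i} \<in> \<X>" and j: "{j} \<in> \<X>" and ij: "i \<noteq> j" and ne: "part i \<inter> part j \<noteq> {}"
  shows "\<exists>a\<in>part i \<inter> part j. f i a \<noteq> f j a"
proof (rule ccontr)
  assume "\<not> ?thesis"
  then have same: "f i a = f j a" if "a \<in> part i \<inter> part j" for a using that by blast
  let ?Q = "part i \<inter> part j"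
  obtain q where q: "q \<in> ?Q" using ne by blast
  have Q: "?Q \<subseteq> A" using part_sub by blast
  have "f0 x = f i x" if "x \<in> A" "x \<notin> ?Q" for x
  proof (rule cycle_closed_part[OF g_matching[OF X_empty] g_matching[OF i] single_cycle[OF i] Q _ q
    _ that])
    show "a' \<in> ?Q" if "a \<in> ?Q" "a' \<in> A" "f0 a' = f i a" for a a'
      using part_step[OF i, of a a'] part_step[OF j, of a a'] that same[OF that(1)] by simp
    show "f0 q \<noteq> f i q" using q by (simp add: part_def)
  qed
  moreover have "f0 x = f j x" if "x \<in> A" "x \<notin> ?Q" for x
  proof (rule cycle_closed_part[OF g_matching[OF X_empty] g_matching[OF j] single_cycle[OF j] Q _ q
    _ that])
    show "a' \<in> ?Q" if "a \<in> ?Q" "a' \<in> A" "f0 a' = f j a" for a a'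
      using part_step[OF i, of a a'] part_step[OF j, of a a'] that same[OF that(1)] by simp
    show "f0 q \<noteq> f j q" using q by (simp add: part_def)
  qed
  ultimately have "f i x = f j x" if "x \<in> A" for x using same that by metis
  then have "g {i} = g {j}" by (rule matching_eqI[OF g_matching[OF i] g_matching[OF j]])
  then show False using g_inj[OF i j] ij by simp
qed

text \<open>Both cycles are flipped in either order. At a common vertex the two flips would have to
  use the same edges.\<close>

lemma pair_parts_disjoint:
  assumes ij: "{i, j} \<in> \<X>" "i \<noteq> j"
  shows "part i \<inter> part j = {}"
proof (rule ccontr)
  have i: "{i} \<in> \<X>" and j: "{j} \<in> \<X>" using X_down[OF ij(1)] by blast+
  assume "part i \<inter> part j \<noteq> {}"
  then obtain a where a: "a \<in> part i" "a \<in> part j" "f i a \<noteq> f j a"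
    using common_part_differs[OF i j ij(2)] by blast
  have aA: "a \<in> A" using a(1) part_sub by blast
  have "{i, j} - {i} = {j}" using ij(2) by blast
  then have sd: "sym_diff (g {j}) (g {i, j}) = sym_diff (g {}) (g {i})"
    using direction[OF ij(1), of i] by simp
  note D = edge_in_sym_diff[OF g_matching[OF j] g_matching[OF ij(1)] aA]
    and D0 = edge_in_sym_diff[OF g_matching[OF X_empty] g_matching[OF i] aA]
  have "{a, f0 a} \<in> sym_diff (g {j}) (g {i, j})" "{a, f i a} \<in> sym_diff (g {j}) (g {i, j})"
    unfolding sd D0 using a(1) by (auto simp: part_def)
  then have "f0 a = f j a \<or> f0 a = mate (g {i, j}) a" "f i a = f j a \<or> f i a = mate (g {i, j}) a"
    unfolding D by blast+
  then show False using a by (auto simp: part_def)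
qed

lemma mate_member:
  assumes "S \<in> \<X>" "a \<in> A"
  shows "(\<forall>i\<in>S. a \<in> part i \<longrightarrow> mate (g S) a = f i a) \<and> ((\<forall>i\<in>S. a \<notin> part i) \<longrightarrow> mate (g S) a = f0 a)"
proof -
  have "finite S" using finite_member assms(1) .
  then show ?thesis using assms(1)
  proof (induction rule: finite_induct)
    case (insert i S)
    have SX: "S \<in> \<X>" "{i} \<in> \<X>" using X_down[OF insert.prems] by blast+
    have "insert i S - {i} = S" using insert.hyps(2) by blast
    then have sd: "sym_diff (g S) (g (insert i S)) = sym_diff (g {}) (g {i})"
      using direction[OF insert.prems, of i] by simp
    note D = edge_in_sym_diff[OF g_matching[OF SX(1)] g_matching[OF insert.prems] assms(2)]
      and D0 = edge_in_sym_diff[OF g_matching[OF X_empty] g_matching[OF SX(2)] assms(2)]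
    have eq: "mate (g S) a \<noteq> mate (g (insert i S)) a \<and> (b = mate (g S) a \<or> b = mate (g (insert i S))
      a)
        \<longleftrightarrow> f0 a \<noteq> f i a \<and> (b = f0 a \<or> b = f i a)" for b
      unfolding D[symmetric] D0[symmetric] sd ..
    show ?case
    proof (cases "a \<in> part i")
      case True
      have off: "a \<notin> part j" if "j \<in> S" for j
      proof -
        have "{i, j} \<in> \<X>" "i \<noteq> j" using X_down[OF insert.prems, of "{i, j}"] that insert.hyps(2) by
          blast+
        then show ?thesis using pair_parts_disjoint True by blast
      qed
      then have "mate (g S) a = f0 a" using insert.IH[OF SX(1)] by blast
      then have "mate (g (insert i S)) a = f i a" using eq[of "f i a"] True by (auto simp: part_def)
      then show ?thesis using True off by blast
    next
      case False
      then have "f0 a = f i a" using assms(2) by (simp add: part_def)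
      then have "mate (g S) a = mate (g (insert i S)) a" using eq[of "mate (g S) a"] by blast
      then show ?thesis using insert.IH[OF SX(1)] False by auto
    qed
  qed simp
qed

lemma differs_iff_part:
  assumes "S \<in> \<X>" "i \<in> S" "a \<in> A"
  shows "mate (g (S - {i})) a \<noteq> mate (g S) a \<longleftrightarrow> a \<in> part i"
proof -
  have X: "S - {i} \<in> \<X>" "{i} \<in> \<X>" using X_down[OF assms(1)] assms(2) by blast+
  have sd: "sym_diff (g (S - {i})) (g S) = sym_diff (g {}) (g {i})" using direction[OF assms(1,2)]
    by blast
  note D = edge_in_sym_diff[OF g_matching[OF X(1)] g_matching[OF assms(1)] assms(3)]
    and D0 = edge_in_sym_diff[OF g_matching[OF X_empty] g_matching[OF X(2)] assms(3)]
  have eq: "mate (g (S - {i})) a \<noteq> mate (g S) a \<and> (b = mate (g (S - {i})) a \<or> b = mate (g S) a)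
        \<longleftrightarrow> f0 a \<noteq> f i a \<and> (b = f0 a \<or> b = f i a)" for b
    unfolding D[symmetric] D0[symmetric] sd ..
  show ?thesis using eq[of "f0 a"] eq[of "mate (g S) a"] assms(3) by (auto simp: part_def)
qed

text \<open>Flipping two disjoint cycles \<open>i\<close> and \<open>j\<close> from \<open>S - {i, j}\<close> gives a matching \<open>L\<close> that is
  adjacent to those of \<open>S - {i}\<close> and \<open>S - {j}\<close>. In the hypercube only \<open>S\<close> can be its place.\<close>

lemma disjoint_parts_member:
  assumes "S \<subseteq> {..<n}" "\<And>i. i \<in> S \<Longrightarrow> {i} \<in> \<X>"
    "\<And>i j. i \<in> S \<Longrightarrow> j \<in> S \<Longrightarrow> i \<noteq> j \<Longrightarrow> part i \<inter> part j = {}"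
  shows "S \<in> \<X>"
  using assms
proof (induction "card S" arbitrary: S rule: less_induct)
  case less
  have fin: "finite S" using less.prems(1) finite_subset by blast
  consider "S = {}" | i where "S = {i}" | i j where "i \<in> S" "j \<in> S" "i \<noteq> j" by blast
  then show ?case
  proof cases
    case 1
    then show ?thesis using X_empty by simp
  next
    case (2 i)
    then show ?thesis using less.prems(2) by simp
  next
    case (3 i j)
    let ?Sj = "S - {j}" and ?Si = "S - {i}" and ?T = "S - {i, j}"
    have Si: "?Si \<in> \<X>" using less.hyps[OF card_Diff1_less[OF fin 3(1)]] less.prems by blast
    have Sj: "?Sj \<in> \<X>" using less.hyps[OF card_Diff1_less[OF fin 3(2)]] less.prems by blast
    have T: "?T \<in> \<X>" using X_down[OF Si] by blast
    have Tij: "?Sj - {i} = ?T" "?Si - {j} = ?T" by blast+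
    have mem: "i \<in> ?Sj" "j \<in> ?Si" using 3 by blast+
    have ij: "{i} \<in> \<X>" "{j} \<in> \<X>" using less.prems(2) 3 by blast+
    have disj: "part i \<inter> part j = {}" using less.prems(3) 3 by blast
    note pm = g_matching[OF Si] g_matching[OF Sj] g_matching[OF T]
    have dj: "mate (g ?T) a \<noteq> mate (g ?Sj) a \<longleftrightarrow> a \<in> part i" if "a \<in> A" for a
      using differs_iff_part[OF Sj mem(1) that] unfolding Tij .
    have di: "mate (g ?T) a \<noteq> mate (g ?Si) a \<longleftrightarrow> a \<in> part j" if "a \<in> A" for a
      using differs_iff_part[OF Si mem(2) that] unfolding Tij .
    have step: "a' \<in> part i" if a: "a \<in> part i" "a' \<in> A" "mate (g ?Si) a' = mate (g ?Sj) a" for a a'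
    proof -
      have aA: "a \<in> A" using a(1) part_sub by blast
      have "mate (g ?T) ` A = B" using mate_bij[OF pm(3)] by (simp add: bij_betw_def)
      then have "mate (g ?Sj) a \<in> mate (g ?T) ` A" using mate_edge(2)[OF pm(2) aA] by simp
      then obtain x where x': "mate (g ?Sj) a = mate (g ?T) x" and xA: "x \<in> A" by (rule imageE)
      note x = xA x'[symmetric]
      have "x \<in> part i"
      proof (rule ccontr)
        assume "x \<notin> part i"
        then have "mate (g ?Sj) x = mate (g ?Sj) a" using dj[OF x(1)] x(2) by simp
        then have "x = a" by (rule inj_onD[OF bij_betw_imp_inj_on[OF mate_bij[OF pm(2)]] _ x(1) aA])
        then show False using \<open>x \<notin> part i\<close> a(1) by simp
      qed
      then have "x \<notin> part j" using disj by blast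
      then have "mate (g ?Si) x = mate (g ?Si) a'" using di[OF x(1)] x(2) a(3) by simp
      then have "x = a'" by (rule inj_onD[OF bij_betw_imp_inj_on[OF mate_bij[OF pm(1)]] _ x(1) a(2)])
      then show ?thesis using \<open>x \<in> part i\<close> by simp
    qed
    then have step': "\<forall>a\<in>part i. \<forall>a'\<in>A. mate (g ?Si) a' = mate (g ?Sj) a \<longrightarrow> a' \<in> part i"
      by blast
    obtain L where L: "perfect_matching G L"
      "\<And>a. a \<in> A \<Longrightarrow> mate L a = (if a \<in> part i then mate (g ?Sj) a else mate (g ?Si) a)"
      using matching_splice[OF pm(1,2) part_sub step'] by blast
    have "sym_diff (g ?Si) L = sym_diff (g ?T) (g ?Sj)"
    proof (rule sym_diff_eqI[OF pm(1) L(1) pm(3,2)])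
      fix a assume a: "a \<in> A"
      have e: "mate (g ?Si) a = mate (g ?T) a" if "a \<in> part i" using di[OF a] disj that by auto
      show "mate (g ?Si) a \<noteq> mate L a \<longleftrightarrow> mate (g ?T) a \<noteq> mate (g ?Sj) a"
        using e L(2)[OF a] dj[OF a] by auto
      show "mate (g ?Si) a = mate (g ?T) a \<and> mate L a = mate (g ?Sj) a" if "mate (g ?Si) a \<noteq> mate L a"
        using e L(2)[OF a] that by (auto split: if_splits)
    qed
    then have eL1: "{g ?Si, L} \<in> edges (resonance_graph G \<gamma>)"
      using flip_edge[OF Sj mem(1)] pm L(1) unfolding Tij resonance_edge_iff by simp
    have "sym_diff (g ?Sj) L = sym_diff (g ?T) (g ?Si)"
    proof (rule sym_diff_eqI[OF pm(2) L(1) pm(3,1)])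
      fix a assume a: "a \<in> A"
      have e: "mate (g ?Sj) a = mate (g ?T) a" if "a \<notin> part i" using dj[OF a] that by auto
      have e': "mate (g ?Si) a = mate (g ?T) a" if "a \<in> part i" using di[OF a] disj that by auto
      show "mate (g ?Sj) a \<noteq> mate L a \<longleftrightarrow> mate (g ?T) a \<noteq> mate (g ?Si) a"
        using e e' L(2)[OF a] by auto
      show "mate (g ?Sj) a = mate (g ?T) a \<and> mate L a = mate (g ?Si) a" if "mate (g ?Sj) a \<noteq> mate L a"
        using e L(2)[OF a] that by (auto split: if_splits)
    qed
    then have eL2: "{g ?Sj, L} \<in> edges (resonance_graph G \<gamma>)"
      using flip_edge[OF Si mem(2)] pm L(1) unfolding Tij resonance_edge_iff by simp
    obtain U where U: "U \<in> \<X>" "L = g U" by (rule g_surj[OF L(1)])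
    obtain a where a: "a \<in> part i" using part_nonempty[OF ij(1)] by blast
    have aA: "a \<in> A" using a part_sub by blast
    have "mate L a \<noteq> mate (g ?T) a" using L(2)[OF aA] dj[OF aA] a by simp
    then have "U \<noteq> ?T" using U(2) by auto
    have TS: "?Si = sym_diff ?T {j}" "?Sj = sym_diff ?T {i}" "S = sym_diff ?T {i, j}" using 3 by auto
    have comm: "sym_diff U V = sym_diff V U" for V by (rule Un_commute)
    have "U = sym_diff ?T {i, j}"
    proof (rule square_completion[OF 3(3) \<open>U \<noteq> ?T\<close>])
      show "card (sym_diff U (sym_diff ?T {i})) = 1"
        using g_edge[OF Sj U(1)] eL2 U(2) unfolding TS(2)[symmetric] comm by simp
      show "card (sym_diff U (sym_diff ?T {j})) = 1"
        using g_edge[OF Si U(1)] eL1 U(2) unfolding TS(1)[symmetric] comm by simp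
    qed
    then show ?thesis using U(1) TS(3) by simp
  qed
qed

end

section \<open>All bounded faces are flipped, and neighbours in opposite senses\<close>

context resonance_daisy
begin

text \<open>The arcs of the digraph obtained by contracting the edges of the matching \<open>g {}\<close>.\<close>

text \<open>The bijections \<open>A \<rightarrow> B\<close> given by matchings become permutations of \<open>A\<close> when the edges of \<open>g
  {}\<close> are contracted.\<close>

definition contract :: "complex set set \<Rightarrow> complex \<Rightarrow> complex" where
  "contract M a = inv_into A f0 (mate M a)"

lemma f0_bij: "bij_betw f0 A B" by (rule mate_bij[OF g_matching[OF X_empty]])

lemma f0_inj: "a \<in> A \<Longrightarrow> a' \<in> A \<Longrightarrow> f0 a = f0 a' \<longleftrightarrow> a = a'"
  using f0_bij unfolding bij_betw_def inj_on_def by blast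

lemma f0_contract: "perfect_matching G M \<Longrightarrow> a \<in> A \<Longrightarrow> f0 (contract M a) = mate M a"
  unfolding contract_def using f0_bij mate_edge(2) bij_betw_inv_into_right by metis

lemma contract_bij: "perfect_matching G M \<Longrightarrow> bij_betw (contract M) A A"
  using bij_betw_trans[OF mate_bij bij_betw_inv_into[OF f0_bij]]
  by (simp add: contract_def[abs_def] comp_def)

lemma contract_in: "perfect_matching G M \<Longrightarrow> a \<in> A \<Longrightarrow> contract M a \<in> A"
  using contract_bij bij_betwE by blast

lemma contract_g0: "a \<in> A \<Longrightarrow> contract (g {}) a = a"
  unfolding contract_def using f0_bij bij_betw_inv_into_left by metis

definition arcs :: "(complex \<times> complex) set" where
  "arcs = {(a, contract (g {i}) a) | a i. {i} \<in> \<X> \<and> a \<in> part i}"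

lemma arcs_sub: "arcs \<subseteq> A \<times> A"
proof
  fix e assume "e \<in> arcs"
  then obtain a i where "e = (a, contract (g {i}) a)" "{i} \<in> \<X>" "a \<in> part i" unfolding arcs_def by
    blast
  then show "e \<in> A \<times> A" using part_sub contract_in[OF g_matching] by blast
qed

lemma contract_moves:
  assumes "{i} \<in> \<X>" "a \<in> A"
  shows "contract (g {i}) a \<noteq> a \<longleftrightarrow> a \<in> part i"
  using f0_contract[OF g_matching[OF assms(1)] assms(2)] contract_in[OF g_matching[OF assms(1)]
    assms(2)]
    f0_inj[OF _ assms(2), of "contract (g {i}) a"] assms(2) by (auto simp: part_def)

lemma arcs_irrefl: "(a, a) \<notin> arcs"
proof
  assume "(a, a) \<in> arcs"
  then obtain i where "{i} \<in> \<X>" "a \<in> part i" "contract (g {i}) a = a" unfolding arcs_def by auto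
  then show False using contract_moves part_sub by blast
qed

lemma contract_member:
  assumes S: "S \<in> \<X>" and a: "a \<in> A"
  shows "i \<in> S \<Longrightarrow> a \<in> part i \<Longrightarrow> contract (g S) a = contract (g {i}) a"
    and "(\<forall>i\<in>S. a \<notin> part i) \<Longrightarrow> contract (g S) a = a"
  using mate_member[OF S a] contract_g0[OF a] by (simp_all add: contract_def)

lemma contract_arc:
  assumes "perfect_matching G M" "a \<in> A"
  shows "(a, contract M a) \<in> arcs\<^sup>="
proof -
  obtain S where S: "S \<in> \<X>" "M = g S" by (rule g_surj[OF assms(1)])
  show ?thesis
  proof (cases "\<exists>i\<in>S. a \<in> part i")
    case True
    then obtain i where i: "i \<in> S" "a \<in> part i" by blast
    have "{i} \<in> \<X>" using X_down[OF S(1)] i(1) by blast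
    then have "(a, contract (g {i}) a) \<in> arcs" using i(2) unfolding arcs_def by blast
    then show ?thesis using contract_member(1)[OF S(1) assms(2) i] S(2) by simp
  next
    case False
    then show ?thesis using contract_member(2)[OF S(1) assms(2)] S(2) by simp
  qed
qed

text \<open>A permutation of a finite set returns, so each of its arcs lies on a directed cycle.\<close>

lemma contract_reversible:
  assumes M: "perfect_matching G M" and a: "a \<in> A"
  shows "(contract M a, a) \<in> arcs\<^sup>*"
proof -
  obtain m where m: "m > 0" "(contract M ^^ m) a = a"
    by (rule orbit_cycle[OF finite_parts(1) contract_bij[OF M] a])
  have in_A: "(contract M ^^ k) a \<in> A" for k
    by (induction k) (use a contract_in[OF M] in auto)
  have reach: "((contract M) a, (contract M ^^ Suc k) a) \<in> arcs\<^sup>*" for k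
  proof (induction k)
    case (Suc k)
    have "((contract M ^^ Suc k) a, contract M ((contract M ^^ Suc k) a)) \<in> arcs\<^sup>="
      by (rule contract_arc[OF M in_A])
    then have "((contract M ^^ Suc k) a, (contract M ^^ Suc (Suc k)) a) \<in> arcs\<^sup>*" by auto
    with Suc.IH show ?case by (rule rtrancl_trans)
  qed simp
  show ?thesis using reach[of "m - 1"] m by simp
qed

lemma matched_allowed: "perfect_matching G M \<Longrightarrow> e \<in> M \<Longrightarrow> e \<in> allowed_edges G"
  by (auto simp: allowed_edges_def)

lemma vertex_allowed:
  assumes "v \<in> verts G"
  shows "v \<in> \<Union>(allowed_edges G)"
proof -
  obtain e where "e \<in> g {}" "v \<in> e" by (rule matching_covers[OF g_matching[OF X_empty] assms])
  then show ?thesis using matched_allowed[OF g_matching[OF X_empty]] by blast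
qed

lemma allowed_reachable:
  assumes "u \<in> verts G" "v \<in> verts G"
  shows "(u, v) \<in> {(x, y). {x, y} \<in> allowed_edges G}\<^sup>*"
proof -
  have "\<forall>u\<in>\<Union>(allowed_edges G). \<forall>v\<in>\<Union>(allowed_edges G). (u, v) \<in> {(x, y). {x, y} \<in> allowed_edges G}\<^sup>*"
    using allowed_connected by (simp add: connected_graph_def)
  from bspec[OF bspec[OF this vertex_allowed[OF assms(1)]] vertex_allowed[OF assms(2)]] show ?thesis .
qed

definition contract_vertex :: "complex \<Rightarrow> complex" where
  "contract_vertex v = (if v \<in> A then v else inv_into A f0 v)"

text \<open>The allowed edges connect the graph, and each contracted arc can be traversed back.\<close>

lemma arcs_strong:
  assumes "a \<in> A" "a' \<in> A"
  shows "(a, a') \<in> arcs\<^sup>*"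
proof -
  have step: "(contract_vertex x, contract_vertex y) \<in> arcs\<^sup>*" if xy: "{x, y} \<in> allowed_edges G" for
    x y
  proof -
    obtain M where M: "perfect_matching G M" "{x, y} \<in> M" using xy unfolding allowed_edges_def by
      blast
    have both: "(contract_vertex u, contract_vertex v) \<in> arcs\<^sup>* \<and> (contract_vertex v,
      contract_vertex u) \<in> arcs\<^sup>*"
      if "u \<in> A" "v \<in> B" "{u, v} \<in> M" for u v
    proof -
      have "mate M u = v" by (rule mate_eq[OF M(1) that(3)])
      then have "contract_vertex v = contract M u" "contract_vertex u = u"
        using that(1,2) parts(1) by (auto simp: contract_vertex_def contract_def)
      then show ?thesis
        using contract_arc[OF M(1) that(1)] contract_reversible[OF M(1) that(1)] by auto
    qed
    have "{x, y} \<in> edges G" by (rule matching_edges[OF M])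
    then have "x \<in> A \<and> y \<in> B \<or> y \<in> A \<and> x \<in> B" using edge_sides by blast
    then show ?thesis using both[of x y] both[of y x] M(2) by (auto simp: insert_commute)
  qed
  have "(a, a') \<in> {(x, y). {x, y} \<in> allowed_edges G}\<^sup>*"
    using assms parts(2) by (intro allowed_reachable) auto
  then have "(contract_vertex a, contract_vertex a') \<in> arcs\<^sup>*"
  proof (induction rule: rtrancl_induct)
    case (step y z)
    have "{y, z} \<in> allowed_edges G" using step.hyps(2) by simp
    from rtrancl_trans[OF step.IH \<open>\<And>x y. {x, y} \<in> allowed_edges G \<Longrightarrow> (contract_vertex x,
      contract_vertex y) \<in> arcs\<^sup>*\<close>[OF this]]
    show ?case .
  qed simp
  then show ?thesis using assms by (simp add: contract_vertex_def)
qed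

text \<open>The turning numbers become a balanced weight on the digraph with the edges of \<open>g {}\<close>
  contracted. Its potential extends to the vertices in \<open>B\<close> along the contracted edges.\<close>

lemma constant_turn_potential:
  assumes z: "z \<notin> drawing G \<gamma>"
    and const: "\<And>M. perfect_matching G M \<Longrightarrow> matching_turn z M = matching_turn z (g {})"
  shows "\<exists>\<phi>. \<forall>u v. {u, v} \<in> edges G \<longrightarrow> turn z u v = \<phi> v - \<phi> u"
proof -
  define D where "D = {(a, a'). a \<in> A \<and> a' \<in> A \<and> {a, f0 a'} \<in> edges G}"
  define d where "d a a' = turn z a (f0 a') - turn z a' (f0 a')" for a a'
  interpret balanced_digraph A D d
  proof
    show "finite A" by (rule finite_parts)
    show "D \<subseteq> A \<times> A" by (auto simp: D_def)
    show "d a a = 0" for a by (simp add: d_def)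
    have "arcs \<subseteq> D"
    proof
      fix e assume "e \<in> arcs"
      then obtain a i where e: "e = (a, contract (g {i}) a)" "{i} \<in> \<X>" "a \<in> part i" unfolding
        arcs_def by blast
      have a: "a \<in> A" using e(3) part_sub by blast
      have "{a, mate (g {i}) a} \<in> edges G"
        using matching_edges[OF g_matching[OF e(2)]] mate_edge(1)[OF g_matching[OF e(2)] a] by blast
      then show "e \<in> D"
        using e(1) a contract_in[OF g_matching[OF e(2)] a] f0_contract[OF g_matching[OF e(2)] a] by
          (simp add: D_def)
    qed
    then show "(a, b) \<in> D\<^sup>*" if "a \<in> A" "b \<in> A" for a b
      using arcs_strong[OF that] rtrancl_mono by blast
    show "(\<Sum>a\<in>A. d a (p a)) = 0"
      if p: "bij_betw p A A" and arc: "\<And>a. a \<in> A \<Longrightarrow> p a \<noteq> a \<Longrightarrow> (a, p a) \<in> D" for p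
    proof -
      have bij: "bij_betw (\<lambda>a. f0 (p a)) A B" using bij_betw_trans[OF p f0_bij] by (simp add:
        comp_def)
      have E: "{a, f0 (p a)} \<in> edges G" if a: "a \<in> A" for a
      proof (cases "p a = a")
        case True
        then show ?thesis
          using matching_edges[OF g_matching[OF X_empty]] mate_edge(1)[OF g_matching[OF X_empty] a]
            by simp
      next
        case False
        then show ?thesis using arc[OF a] by (simp add: D_def)
      qed
      let ?L = "(\<lambda>a. {a, f0 (p a)}) ` A"
      have L: "perfect_matching G ?L" by (rule matching_of_bij(1)[OF bij]) (rule E)
      have mL: "mate ?L a = f0 (p a)" if "a \<in> A" for a
        by (rule matching_of_bij(2)[OF bij _ that]) (rule E)
      have "(\<Sum>a\<in>A. turn z a (f0 (p a))) = matching_turn z ?L"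
        unfolding matching_turn_def using mL by (intro sum.cong) auto
      moreover have "(\<Sum>a\<in>A. turn z (p a) (f0 (p a))) = matching_turn z (g {})"
        unfolding matching_turn_def using sum.reindex_bij_betw[OF p, of "\<lambda>a. turn z a (f0 a)"] by simp
      ultimately show ?thesis using const[OF L] by (simp add: d_def sum_subtractf)
    qed
  qed
  obtain \<phi> where \<phi>: "\<forall>(a, b)\<in>D. d a b = \<phi> b - \<phi> a" using potential_exists by blast
  define \<psi> where "\<psi> v = (if v \<in> A then \<phi> v else \<phi> (inv_into A f0 v) + turn z (inv_into A f0 v) v)"
    for v
  have AB: "turn z u v = \<psi> v - \<psi> u" if e: "{u, v} \<in> edges G" and u: "u \<in> A" and v: "v \<in> B" for u v
  proof -
    let ?a = "inv_into A f0 v"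
    have a: "?a \<in> A" "f0 ?a = v"
      using v f0_bij bij_betw_inv_into_right[OF f0_bij v] bij_betwE[OF bij_betw_inv_into[OF f0_bij]]
        by blast+
    then have "(u, ?a) \<in> D" using e u by (simp add: D_def)
    then have "d u ?a = \<phi> ?a - \<phi> u" using \<phi> by blast
    moreover have "v \<notin> A" using v parts(1) by blast
    ultimately show ?thesis using u a(2) by (simp add: d_def \<psi>_def algebra_simps)
  qed
  have "turn z u v = \<psi> v - \<psi> u" if e: "{u, v} \<in> edges G" for u v
  proof (cases "u \<in> A")
    case True
    then show ?thesis using AB[OF e] edge_sides[OF e] parts(1) by blast
  next
    case False
    then have uv: "u \<in> B" "v \<in> A" using edge_sides[OF e] by blast+
    have e': "{v, u} \<in> edges G" using e by (simp add: insert_commute)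
    show ?thesis using AB[OF e' uv(2,1)] turn_commute[OF e' z] by simp
  qed
  then show ?thesis by blast
qed

text \<open>From a face that is never flipped, all perfect matchings have the same turning number.\<close>

lemma every_face_flipped:
  assumes F: "F \<in> finite_faces G \<gamma>"
  shows "\<exists>i. {i} \<in> \<X> \<and> is_periphery \<gamma> (sym_diff (g {}) (g {i})) F"
proof (rule ccontr)
  assume no: "\<not> ?thesis"
  obtain z where z: "z \<in> F" "z \<notin> drawing G \<gamma>" by (rule face_point[OF F])
  have zero: "flip i z = 0" if i: "{i} \<in> \<X>" for i
  proof -
    obtain F' s where F': "F' \<in> finite_faces G \<gamma>" "is_periphery \<gamma> (sym_diff (g {}) (g {i})) F'"
      "\<And>z. z \<notin> drawing G \<gamma> \<Longrightarrow> flip i z = (if z \<in> F' then s else 0)"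
      using flip_face[OF i] by blast
    have "F' \<noteq> F" using no i F'(2) by blast
    then have "z \<notin> F'" using faces_disjoint[OF F F'(1) z(1)] by blast
    then show ?thesis using F'(3)[OF z(2)] by simp
  qed
  have "matching_turn z M = matching_turn z (g {})" if M: "perfect_matching G M" for M
  proof -
    obtain S where S: "S \<in> \<X>" "M = g S" by (rule g_surj[OF M])
    have "flip i z = 0" if "i \<in> S" for i using zero X_down[OF S(1)] that by blast
    then have "(\<Sum>i\<in>S. flip i z) = 0" by simp
    then show ?thesis using turn_sum[OF S(1) z(2)] S(2) by simp
  qed
  then obtain \<phi> where \<phi>: "\<And>u v. {u, v} \<in> edges G \<Longrightarrow> turn z u v = \<phi> v - \<phi> u"
    using constant_turn_potential[OF z(2)] by blast
  have sub: "allowed_edges G \<subseteq> edges G" using matching_edges by (auto simp: allowed_edges_def)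
  have conn: "(u, v) \<in> {(x, y). {x, y} \<in> edges G}\<^sup>*" if "u \<in> verts G" "v \<in> verts G" for u v
  proof -
    have "{(x, y). {x, y} \<in> allowed_edges G} \<subseteq> {(x, y). {x, y} \<in> edges G}" using sub by blast
    then show ?thesis using allowed_reachable[OF that] rtrancl_mono by blast
  qed
  have cover: "\<exists>e\<in>edges G. v \<in> e" if "v \<in> verts G" for v
    using vertex_allowed[OF that] sub by blast
  show False by (rule no_potential_in_bounded_face[OF F z(1) conn cover \<phi>])
qed

text \<open>There are as many bounded faces as coordinates, and different faces are flipped by
  different coordinates.\<close>

lemma all_single: "i < n \<Longrightarrow> {i} \<in> \<X>"
proof -
  let ?I = "{i. {i} \<in> \<X>}"
  have sub: "?I \<subseteq> {..<n}" using X_sub by auto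
  then have fin: "finite ?I" using finite_subset by blast
  obtain c where c: "\<And>F. F \<in> finite_faces G \<gamma> \<Longrightarrow>
      {c F} \<in> \<X> \<and> is_periphery \<gamma> (sym_diff (g {}) (g {c F})) F"
    using every_face_flipped by metis
  have "inj_on c (finite_faces G \<gamma>)"
  proof (rule inj_onI)
    fix F F' assume F: "F \<in> finite_faces G \<gamma>" "F' \<in> finite_faces G \<gamma>" "c F = c F'"
    let ?C = "sym_diff (g {}) (g {c F})"
    have per: "is_periphery \<gamma> ?C F" "is_periphery \<gamma> ?C F'" using c[OF F(1)] c[OF F(2)] F(3) by
      simp_all
    obtain s where s: "s \<in> {1, -1}" "\<And>F z. F \<in> finite_faces G \<gamma> \<Longrightarrow> is_periphery \<gamma> ?C F \<Longrightarrow> z \<notin> drawing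
      G \<gamma> \<Longrightarrow>
       matching_turn z (g {c F'}) - matching_turn z (g {}) = (if z \<in> F then s else 0)"
    proof (rule cycle_turn_diff[OF g_matching[OF X_empty] g_matching single_cycle])
      show "{c F} \<in> \<X>" "{c F} \<in> \<X>" using c[OF F(1)] by simp_all
    qed (use F(3) in auto)
    obtain z where z: "z \<in> F" "z \<notin> drawing G \<gamma>" by (rule face_point[OF F(1)])
    have "z \<in> F'"
      using s(2)[OF F(1) per(1) z(2)] s(2)[OF F(2) per(2) z(2)] s(1) z(1) by (auto split: if_splits)
    then show "F = F'" using faces_disjoint[OF F(1,2) z(1)] by blast
  qed
  then have "card (finite_faces G \<gamma>) \<le> card ?I"
    using c fin by (intro card_inj_on_le[of c]) auto
  then have "card {..<n} \<le> card ?I" using card_faces by simp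
  then have eq: "?I = {..<n}" by (rule card_seteq[OF finite_lessThan sub])
  assume "i < n"
  then have "i \<in> ?I" unfolding eq by simp
  then show "{i} \<in> \<X>" by simp
qed

definition touch :: "nat \<Rightarrow> nat \<Rightarrow> bool" where
  "touch i j \<longleftrightarrow> i < n \<and> j < n \<and> i \<noteq> j \<and> {i, j} \<notin> \<X>"

lemma touch_iff: "touch i j \<longleftrightarrow> i < n \<and> j < n \<and> i \<noteq> j \<and> part i \<inter> part j \<noteq> {}"
proof -
  have "{i, j} \<in> \<X>" if ij: "i < n" "j < n" "i \<noteq> j" "part i \<inter> part j = {}"
  proof (rule disjoint_parts_member)
    show "{i, j} \<subseteq> {..<n}" using ij by simp
    show "{k} \<in> \<X>" if "k \<in> {i, j}" for k
      using that all_single[OF ij(1)] all_single[OF ij(2)] by blast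
    show "part k \<inter> part l = {}" if "k \<in> {i, j}" "l \<in> {i, j}" "k \<noteq> l" for k l
      using that ij(4) by blast
  qed
  then show ?thesis using pair_parts_disjoint unfolding touch_def by blast
qed

lemma member_iff: "S \<in> \<X> \<longleftrightarrow> S \<subseteq> {..<n} \<and> (\<forall>i\<in>S. \<forall>j\<in>S. \<not> touch i j)"
proof
  assume S: "S \<in> \<X>"
  have "\<not> touch i j" if "i \<in> S" "j \<in> S" for i j
  proof -
    have "{i, j} \<in> \<X>" by (rule X_down[OF S]) (use that in simp)
    then show ?thesis by (simp add: touch_def)
  qed
  then show "S \<subseteq> {..<n} \<and> (\<forall>i\<in>S. \<forall>j\<in>S. \<not> touch i j)" using X_sub[OF S] by simp
next
  assume S: "S \<subseteq> {..<n} \<and> (\<forall>i\<in>S. \<forall>j\<in>S. \<not> touch i j)"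
  have lt: "i < n" if "i \<in> S" for i using S that by auto
  show "S \<in> \<X>"
  proof (rule disjoint_parts_member)
    show "S \<subseteq> {..<n}" using S by simp
    show "{i} \<in> \<X>" if "i \<in> S" for i by (rule all_single[OF lt[OF that]])
    show "part i \<inter> part j = {}" if "i \<in> S" "j \<in> S" "i \<noteq> j" for i j
    proof -
      have "\<not> touch i j" using S that by simp
      then show ?thesis using lt[OF that(1)] lt[OF that(2)] that(3) touch_iff[of i j] by simp
    qed
  qed
qed

definition face :: "nat \<Rightarrow> complex set" where
  "face i = (SOME F. F \<in> finite_faces G \<gamma> \<and> (\<exists>s\<in>{1, -1}. \<forall>z. z \<notin> drawing G \<gamma> \<longrightarrow>
     flip i z = (if z \<in> F then s else 0)))"

text \<open>The orientation of the flip: \<open>1\<close> if the turning number around the face increases, \<open>-1\<close> if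
  it decreases.\<close>

definition sense :: "nat \<Rightarrow> complex" where
  "sense i = (SOME s. s \<in> {1, -1} \<and> (\<forall>z. z \<notin> drawing G \<gamma> \<longrightarrow> flip i z = (if z \<in> face i then s else 0)))"

lemma face_sense:
  assumes "i < n"
  shows "face i \<in> finite_faces G \<gamma>" "sense i \<in> {1, -1}"
    "z \<notin> drawing G \<gamma> \<Longrightarrow> flip i z = (if z \<in> face i then sense i else 0)"
proof -
  have "\<exists>F. F \<in> finite_faces G \<gamma> \<and> (\<exists>s\<in>{1, -1}. \<forall>z. z \<notin> drawing G \<gamma> \<longrightarrow>
     flip i z = (if z \<in> F then s else 0))"
    using flip_face[OF all_single[OF assms]] by blast
  from someI_ex[OF this] have 1: "face i \<in> finite_faces G \<gamma>"
    "\<exists>s. s \<in> {1, -1} \<and> (\<forall>z. z \<notin> drawing G \<gamma> \<longrightarrow> flip i z = (if z \<in> face i then s else 0))"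
    unfolding face_def[symmetric] by blast+
  show "face i \<in> finite_faces G \<gamma>" by (rule 1(1))
  from someI_ex[OF 1(2)] show "sense i \<in> {1, -1}"
    "z \<notin> drawing G \<gamma> \<Longrightarrow> flip i z = (if z \<in> face i then sense i else 0)"
    unfolding sense_def[symmetric] by blast+
qed

lemma face_inj:
  assumes "i < n" "j < n" "i \<noteq> j"
  shows "face i \<noteq> face j"
proof
  assume eq: "face i = face j"
  obtain Fi s where Fi: "Fi \<in> finite_faces G \<gamma>" "is_periphery \<gamma> (sym_diff (g {}) (g {i})) Fi" "s \<in>
    {1, -1}"
    "\<And>z. z \<notin> drawing G \<gamma> \<Longrightarrow> flip i z = (if z \<in> Fi then s else 0)"
    using flip_face[OF all_single[OF assms(1)]] by blast
  obtain Fj s' where Fj: "Fj \<in> finite_faces G \<gamma>" "is_periphery \<gamma> (sym_diff (g {}) (g {j})) Fj" "s' \<in>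
    {1, -1}"
    "\<And>z. z \<notin> drawing G \<gamma> \<Longrightarrow> flip j z = (if z \<in> Fj then s' else 0)"
    using flip_face[OF all_single[OF assms(2)]] by blast
  obtain z where z: "z \<in> face i" "z \<notin> drawing G \<gamma>" by (rule face_point[OF face_sense(1)[OF assms(1)]])
  have "flip i z \<noteq> 0" "flip j z \<noteq> 0"
    using face_sense(2,3)[OF assms(1)] face_sense(2,3)[OF assms(2)] z eq by auto
  then have "z \<in> Fi" "z \<in> Fj" using Fi(4)[OF z(2)] Fj(4)[OF z(2)] by (auto split: if_splits)
  then have "Fi = Fj" using faces_disjoint[OF Fi(1) Fj(1)] by blast
  then have per: "is_periphery \<gamma> (sym_diff (g {}) (g {j})) Fi" using Fj(2) by simp
  note pm = g_matching[OF X_empty] g_matching[OF all_single[OF assms(1)]] g_matching[OF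
    all_single[OF assms(2)]]
  have "sym_diff (g {}) (g {i}) = sym_diff (g {}) (g {j})"
    by (rule periphery_determines_edges[OF _ _ Fi(2) per]) (use pm matching_edges in blast)+
  then have "g {i} = g {j}" by (rule sym_diff_cancel)
  then show False using g_inj all_single assms by simp
qed

lemma turn_at_face:
  assumes S: "S \<in> \<X>" and l: "l < n" and z: "z \<in> face l" "z \<notin> drawing G \<gamma>"
  shows "matching_turn z (g S) = matching_turn z (g {}) + (if l \<in> S then sense l else 0)"
proof -
  have "flip i z = (if i = l then sense l else 0)" if "i \<in> S" for i
  proof -
    have i: "i < n" using X_sub[OF S] that by auto
    have "z \<notin> face i" if "i \<noteq> l"
      using faces_disjoint[OF face_sense(1)[OF i] face_sense(1)[OF l]] face_inj[OF i l that] z(1) by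
        blast
    then show ?thesis using face_sense(3)[OF i z(2)] z(1) by auto
  qed
  then have "(\<Sum>i\<in>S. flip i z) = (\<Sum>i\<in>S. if i = l then sense l else 0)" by (rule sum.cong[OF refl])
  also have "\<dots> = (if l \<in> S then sense l else 0)" using finite_member[OF S] by (simp add: sum.delta)
  finally show ?thesis using turn_sum[OF S z(2)] by simp
qed

text \<open>A perfect matching within the union of \<open>g {i}\<close> and \<open>g {j}\<close> has a complementary one there,
  and by the turning numbers the two have flipped \<open>i\<close> and \<open>j\<close> once together. As \<open>{i, j}\<close> is no
  vertex, they are \<open>g {i}\<close> and \<open>g {j}\<close>, which therefore differ in a single cycle. Its winding
  numbers, \<open>- sense i\<close> in one face and \<open>sense j\<close> in the other, have the same sign.\<close>

lemma touch_opposite: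
  assumes t: "touch i j"
  shows "sense j = - sense i"
proof -
  have ij: "i < n" "j < n" "i \<noteq> j" "{i, j} \<notin> \<X>" using t by (auto simp: touch_def)
  note X = all_single[OF ij(1)] all_single[OF ij(2)]
  note Mi = g_matching[OF X(1)] and Mj = g_matching[OF X(2)]
  have two: "L = g {i} \<or> L = g {j}" if L: "perfect_matching G L" "L \<subseteq> g {i} \<union> g {j}" for L
  proof -
    have L_cases: "mate L a = f i a \<or> mate L a = f j a" if "a \<in> A" for a
      using mate_edge(1)[OF L(1) that] L(2) mate_eq[OF Mi, of a "mate L a"] mate_eq[OF Mj, of a
        "mate L a"] by auto
    let ?Q = "{a \<in> A. mate L a = f i a}"
    have closed: "\<forall>a\<in>?Q. \<forall>a'\<in>A. f i a' = f j a \<longrightarrow> a' \<in> ?Q"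
    proof (intro ballI impI)
      fix a a' assume a: "a \<in> ?Q" and a': "a' \<in> A" "f i a' = f j a"
      show "a' \<in> ?Q"
      proof (rule ccontr)
        assume "a' \<notin> ?Q"
        then have n': "mate L a' \<noteq> f i a'" using a'(1) by simp
        have "mate L ` A = B" using mate_bij[OF L(1)] by (simp add: bij_betw_def)
        then have "f i a' \<in> mate L ` A" using mate_edge(2)[OF Mi a'(1)] by simp
        then obtain x where x: "f i a' = mate L x" and xA: "x \<in> A" by (rule imageE)
        have aA: "a \<in> A" "mate L a = f i a" using a by auto
        show False
        proof (cases "mate L x = f i x")
          case True
          then have "x = a'" using inj_onD[OF bij_betw_imp_inj_on[OF mate_bij[OF Mi]], of x a'] x xA
            a'(1) by simp
          then show False using x n' by simp
        next
          case False
          then have "f j x = f j a" using L_cases[OF xA] x a'(2) by simp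
          then have "x = a" by (rule inj_onD[OF bij_betw_imp_inj_on[OF mate_bij[OF Mj]] _ xA aA(1)])
          then show False using False aA(2) by simp
        qed
      qed
    qed
    obtain L' where L': "perfect_matching G L'" "\<And>a. a \<in> A \<Longrightarrow> mate L' a = (if a \<in> ?Q then f j a else
      f i a)"
      using matching_splice[OF Mi Mj _ closed] by blast
    have sum: "matching_turn z L + matching_turn z L' = matching_turn z (g {i}) + matching_turn z (g
      {j})" for z
      unfolding matching_turn_def sum.distrib[symmetric]
    proof (rule sum.cong[OF refl])
      fix a assume a: "a \<in> A"
      show "turn z a (mate L a) + turn z a (mate L' a) = turn z a (f i a) + turn z a (f j a)"
        using L'(2)[OF a] L_cases[OF a] a by (auto simp: add.commute)
    qed
    obtain U where U: "U \<in> \<X>" "L = g U" by (rule g_surj[OF L(1)])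
    obtain U' where U': "U' \<in> \<X>" "L' = g U'" by (rule g_surj[OF L'(1)])
    have count: "(l \<in> U \<and> l \<notin> U' \<or> l \<notin> U \<and> l \<in> U') \<longleftrightarrow> l = i \<or> l = j" and excl: "\<not> (l \<in> U \<and> l \<in> U')"
      if l: "l < n" for l
    proof -
      obtain z where z: "z \<in> face l" "z \<notin> drawing G \<gamma>" by (rule face_point[OF face_sense(1)[OF l]])
      have "(if l \<in> U then sense l else 0) + (if l \<in> U' then sense l else 0) =
          (if l = i then sense l else 0) + (if l = j then sense l else 0)"
        using sum[of z] turn_at_face[OF U(1) l z] turn_at_face[OF U'(1) l z]
          turn_at_face[OF X(1) l z] turn_at_face[OF X(2) l z] U(2) U'(2) by (simp add: algebra_simps)
      moreover have "sense l \<noteq> 0" using face_sense(2)[OF l] by auto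
      ultimately show "(l \<in> U \<and> l \<notin> U' \<or> l \<notin> U \<and> l \<in> U') \<longleftrightarrow> l = i \<or> l = j" "\<not> (l \<in> U \<and> l \<in> U')"
        using ij(3) by (auto split: if_splits)
    qed
    have sub: "U \<subseteq> {i, j}" "U' \<subseteq> {i, j}"
    proof -
      show "U \<subseteq> {i, j}"
      proof
        fix l assume l: "l \<in> U"
        then have "l < n" using X_sub[OF U(1)] by auto
        then show "l \<in> {i, j}" using count[of l] excl[of l] l by simp
      qed
      show "U' \<subseteq> {i, j}"
      proof
        fix l assume l: "l \<in> U'"
        then have "l < n" using X_sub[OF U'(1)] by auto
        then show "l \<in> {i, j}" using count[of l] excl[of l] l by simp
      qed
    qed
    have ne: "U \<noteq> {i, j}" "U' \<noteq> {i, j}" using U(1) U'(1) ij(4) by auto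
    have c: "i \<in> U \<longleftrightarrow> i \<notin> U'" "j \<in> U \<longleftrightarrow> j \<notin> U'" using count[OF ij(1)] count[OF ij(2)] by auto
    have "U = {i} \<or> U = {j}"
    proof (cases "i \<in> U")
      case True
      then have "j \<notin> U" using ne(1) sub(1) by blast
      then show ?thesis using True sub(1) by blast
    next
      case False
      then have "j \<notin> U'" using c(1) ne(2) sub(2) by blast
      then show ?thesis using False c(2) sub(1) by blast
    qed
    then show ?thesis using U(2) by blast
  qed
  have "g {i} \<noteq> g {j}" using g_inj X ij(3) by simp
  then have cyc: "is_cycle_edge_set G (sym_diff (g {i}) (g {j}))"
    by (rule cycle_of_two_matchings[OF Mi Mj]) (rule two)
  have "\<exists>s. \<forall>z. z \<notin> drawing G \<gamma> \<longrightarrow> matching_turn z (g {j}) - matching_turn z (g {i}) \<in> {0, s}"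
    by (rule cycle_turn_diff[OF Mi Mj cyc]) blast
  then obtain s where s: "\<And>z. z \<notin> drawing G \<gamma> \<Longrightarrow> matching_turn z (g {j}) - matching_turn z (g {i}) \<in>
    {0, s}"
    by blast
  obtain zi where zi: "zi \<in> face i" "zi \<notin> drawing G \<gamma>" by (rule face_point[OF face_sense(1)[OF
    ij(1)]])
  obtain zj where zj: "zj \<in> face j" "zj \<notin> drawing G \<gamma>" by (rule face_point[OF face_sense(1)[OF
    ij(2)]])
  have "- sense i \<in> {0, s}"
    using s[OF zi(2)] turn_at_face[OF X(1) ij(1) zi] turn_at_face[OF X(2) ij(1) zi] ij(3) by auto
  moreover have "sense j \<in> {0, s}"
    using s[OF zj(2)] turn_at_face[OF X(1) ij(2) zj] turn_at_face[OF X(2) ij(2) zj] ij(3) by auto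
  moreover have "sense i \<noteq> 0" "sense j \<noteq> 0" using face_sense(2)[OF ij(1)] face_sense(2)[OF ij(2)] by
    auto
  ultimately show ?thesis by auto
qed

text \<open>Three faces at one vertex would have pairwise opposite senses.\<close>

lemma at_most_two_parts:
  assumes "i < n" "j < n" "k < n" "i \<noteq> j" "i \<noteq> k" "j \<noteq> k" "a \<in> part i" "a \<in> part j"
  shows "a \<notin> part k"
proof
  assume "a \<in> part k"
  then have "touch i j" "touch i k" "touch j k" using assms unfolding touch_iff by blast+
  then have "sense j = - sense i" "sense k = - sense i" "sense k = - sense j"
    using touch_opposite by blast+
  then have "sense i = - sense i" by simp
  then have "sense i = 0" by simp
  then show False using face_sense(2)[OF assms(1)] by simp
qed

end

section \<open>The touching faces form a tree\<close>

context resonance_daisy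
begin

lemma part_zero:
  obtains a where "a \<in> part 0" "a \<in> A"
proof -
  have "{0} \<in> \<X>" by (rule all_single) (use n_pos in simp)
  then obtain a where "a \<in> part 0" using part_nonempty by blast
  then show thesis using part_sub that by blast
qed

text \<open>The permutation of \<open>S\<close> is the product of the disjoint cycles of its members.\<close>

lemma contract_sum:
  fixes d :: "complex \<Rightarrow> complex \<Rightarrow> real"
  assumes S: "S \<in> \<X>" and d: "\<And>a. d a a = 0" and a: "a \<in> A"
  shows "d a (contract (g S) a) = (\<Sum>i\<in>S. d a (contract (g {i}) a))"
proof -
  have fin: "finite S" by (rule finite_member[OF S])
  have single: "{i} \<in> \<X>" if "i \<in> S" for i by (rule X_down[OF S]) (use that in simp)
  have stay: "d a (contract (g {i}) a) = 0" if "i \<in> S" "a \<notin> part i" for i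
    using contract_moves[OF single[OF that(1)] a] that(2) d by simp
  show ?thesis
  proof (cases "\<exists>i\<in>S. a \<in> part i")
    case True
    then obtain i where i: "i \<in> S" "a \<in> part i" by blast
    have "a \<notin> part j" if "j \<in> S" "j \<noteq> i" for j
    proof -
      have "{i, j} \<in> \<X>" by (rule X_down[OF S]) (use that i in simp)
      then have "part i \<inter> part j = {}" using that(2) by (intro pair_parts_disjoint) simp_all
      then show ?thesis using i(2) by blast
    qed
    then have "(\<Sum>j\<in>S - {i}. d a (contract (g {j}) a)) = 0" using stay by (intro sum.neutral) simp
    then have "(\<Sum>j\<in>S. d a (contract (g {j}) a)) = d a (contract (g {i}) a)"
      using sum.remove[OF fin i(1), of "\<lambda>j. d a (contract (g {j}) a)"] by simp
    then show ?thesis using contract_member(1)[OF S a i] by simp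
  next
    case False
    then have "contract (g S) a = a" by (intro contract_member(2)[OF S a]) simp
    moreover have "(\<Sum>i\<in>S. d a (contract (g {i}) a)) = 0" using False stay by (intro sum.neutral) simp
    ultimately show ?thesis using d by simp
  qed
qed

text \<open>A weight balanced on the \<open>n\<close> cycles is balanced on all perfect matchings, hence a
  potential difference.\<close>

lemma card_arcs: "card arcs < n + card A"
proof -
  have "card arcs < card {..<n} + card A"
  proof (rule card_arcs_less[where p = "\<lambda>i. contract (g {i})"])
    show "finite A" by (rule finite_parts)
    obtain a where "a \<in> A" by (rule part_zero)
    then show "A \<noteq> {}" by blast
    show "arcs \<subseteq> A \<times> A" by (rule arcs_sub)
    show "(a, a) \<notin> arcs" for a by (rule arcs_irrefl)
    fix d :: "complex \<Rightarrow> complex \<Rightarrow> real"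
    assume d: "\<And>a. d a a = 0" "\<And>i. i \<in> {..<n} \<Longrightarrow> (\<Sum>a\<in>A. d a (contract (g {i}) a)) = 0"
    interpret balanced_digraph A arcs d
    proof
      show "finite A" by (rule finite_parts)
      show "arcs \<subseteq> A \<times> A" by (rule arcs_sub)
      show "d a a = 0" for a by (rule d)
      show "(a, b) \<in> arcs\<^sup>*" if "a \<in> A" "b \<in> A" for a b by (rule arcs_strong[OF that])
      show "(\<Sum>a\<in>A. d a (p a)) = 0"
        if p: "bij_betw p A A" and arc: "\<And>a. a \<in> A \<Longrightarrow> p a \<noteq> a \<Longrightarrow> (a, p a) \<in> arcs" for p
      proof -
        have bij: "bij_betw (\<lambda>a. f0 (p a)) A B" using bij_betw_trans[OF p f0_bij] by (simp add:
          comp_def)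
        have E: "{a, f0 (p a)} \<in> edges G" if a: "a \<in> A" for a
        proof (cases "p a = a")
          case True
          then show ?thesis
            using matching_edges[OF g_matching[OF X_empty]] mate_edge(1)[OF g_matching[OF X_empty]
              a] by simp
        next
          case False
          then obtain i where i: "{i} \<in> \<X>" "p a = contract (g {i}) a" using arc[OF a] unfolding
            arcs_def by auto
          have "{a, f i a} \<in> edges G"
            using matching_edges[OF g_matching[OF i(1)]] mate_edge(1)[OF g_matching[OF i(1)] a] by
              blast
          then show ?thesis using i(2) f0_contract[OF g_matching[OF i(1)] a] by simp
        qed
        let ?L = "(\<lambda>a. {a, f0 (p a)}) ` A"
        have L: "perfect_matching G ?L" by (rule matching_of_bij(1)[OF bij]) (rule E)
        have mL: "mate ?L a = f0 (p a)" if "a \<in> A" for a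
          by (rule matching_of_bij(2)[OF bij _ that]) (rule E)
        obtain S where S: "S \<in> \<X>" "?L = g S" by (rule g_surj[OF L])
        have pc: "p a = contract (g S) a" if a: "a \<in> A" for a
        proof -
          have "p a \<in> A" using p a bij_betwE by blast
          moreover have "f0 (p a) = f0 (contract (g S) a)"
            using mL[OF a] f0_contract[OF L a] S(2) by simp
          ultimately show ?thesis using f0_inj[of "p a" "contract (g S) a"] contract_in[OF
            g_matching[OF S(1)] a] by simp
        qed
        have cs: "d a (p a) = (\<Sum>i\<in>S. d a (contract (g {i}) a))" if a: "a \<in> A" for a
          unfolding pc[OF a] by (rule contract_sum[where d = d, OF S(1) _ a]) (rule d(1))
        have "(\<Sum>a\<in>A. d a (p a)) = (\<Sum>a\<in>A. \<Sum>i\<in>S. d a (contract (g {i}) a))"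
          by (rule sum.cong[OF refl]) (rule cs)
        also have "\<dots> = (\<Sum>i\<in>S. \<Sum>a\<in>A. d a (contract (g {i}) a))" by (rule sum.swap)
        also have "\<dots> = 0"
        proof (rule sum.neutral, rule ballI)
          fix i assume "i \<in> S"
          then have "i \<in> {..<n}" using X_sub[OF S(1)] by (rule subsetD[rotated])
          then show "(\<Sum>a\<in>A. d a (contract (g {i}) a)) = 0" by (rule d(2))
        qed
        finally show ?thesis .
      qed
    qed
    show "\<exists>\<phi>. \<forall>(a, b)\<in>arcs. d a b = \<phi> b - \<phi> a" by (rule potential_exists)
  qed simp
  then show ?thesis by simp
qed

lemma in_some_part:
  assumes a: "a \<in> A"
  obtains i where "i < n" "a \<in> part i"
proof -
  obtain b where b: "b \<in> part 0" "b \<in> A" by (rule part_zero)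
  have 0: "{0} \<in> \<X>" by (rule all_single) (use n_pos in simp)
  have "contract (g {0}) b \<noteq> b" using contract_moves[OF 0 b(2)] b(1) by simp
  then obtain c where c: "c \<in> A" "c \<noteq> a" using b(2) contract_in[OF g_matching[OF 0] b(2)] by metis
  have "(a, c) \<in> arcs\<^sup>*" by (rule arcs_strong[OF a c(1)])
  then obtain x where "(a, x) \<in> arcs" using c(2) by (metis converse_rtranclE)
  then obtain i where "{i} \<in> \<X>" "a \<in> part i" unfolding arcs_def by blast
  then show thesis using X_sub[of "{i}"] that by simp
qed

definition touching_pairs :: "nat set set" where
  "touching_pairs = {{i, j} | i j. touch i j}"

lemma touch_sym: "touch i j \<Longrightarrow> touch j i"
  by (auto simp: touch_def insert_commute)

lemma touching_pair_iff: "{i, j} \<in> touching_pairs \<longleftrightarrow> touch i j"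
  unfolding touching_pairs_def using touch_sym by (auto simp: doubleton_eq_iff)

lemma finite_touching_pairs: "finite touching_pairs"
  by (rule finite_subset[of _ "Pow {..<n}"]) (auto simp: touching_pairs_def touch_def)

text \<open>Every vertex of the contracted digraph has an outgoing arc, and where two touching cycles
  part it has two. A branching vertex belongs to one pair only, as at most two cycles pass
  through it.\<close>

lemma card_touching_pairs: "card touching_pairs < n"
proof -
  have "\<exists>a i j. e = {i, j} \<and> touch i j \<and> a \<in> part i \<and> a \<in> part j \<and> f i a \<noteq> f j a"
    if "e \<in> touching_pairs" for e
  proof -
    obtain i j where ij: "e = {i, j}" "touch i j" using \<open>e \<in> touching_pairs\<close> unfolding
      touching_pairs_def by blast
    then have "i < n" "j < n" "i \<noteq> j" "part i \<inter> part j \<noteq> {}" unfolding touch_iff by blast+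
    then have "\<exists>a\<in>part i \<inter> part j. f i a \<noteq> f j a" by (intro common_part_differs all_single)
    then show ?thesis using ij by blast
  qed
  then obtain br where br: "\<And>e. e \<in> touching_pairs \<Longrightarrow> \<exists>i j. e = {i, j} \<and> touch i j \<and>
      br e \<in> part i \<and> br e \<in> part j \<and> f i (br e) \<noteq> f j (br e)"
    by metis
  have inj: "inj_on br touching_pairs"
  proof (rule inj_onI)
    fix e e' assume e: "e \<in> touching_pairs" "e' \<in> touching_pairs" "br e = br e'"
    obtain i j where ij: "e = {i, j}" "touch i j" "br e \<in> part i" "br e \<in> part j" using br[OF e(1)]
      by blast
    obtain k l where kl: "e' = {k, l}" "touch k l" "br e \<in> part k" "br e \<in> part l" using br[OF e(2)]
      e(3) by auto
    have lt: "i < n" "j < n" "i \<noteq> j" "k < n" "l < n" "k \<noteq> l" using ij(2) kl(2) by (auto simp: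
      touch_def)
    have "k = i \<or> k = j" "l = i \<or> l = j"
      using at_most_two_parts[OF lt(1,2,4) lt(3) _ _ ij(3,4)] at_most_two_parts[OF lt(1,2,5) lt(3) _
        _ ij(3,4)]
        kl(3,4) by auto
    then show "e = e'" using ij(1) kl(1) lt(6) by auto
  qed
  let ?Br = "br ` touching_pairs"
  have brA: "?Br \<subseteq> A" using br part_sub by blast
  have two: "\<exists>x y. (a, x) \<in> arcs \<and> (a, y) \<in> arcs \<and> x \<noteq> y" if "a \<in> ?Br" for a
  proof -
    obtain e where e: "e \<in> touching_pairs" "a = br e" using \<open>a \<in> ?Br\<close> by blast
    obtain i j where ij: "touch i j" "a \<in> part i" "a \<in> part j" "f i a \<noteq> f j a" using br[OF e(1)]
      e(2) by blast
    have X: "{i} \<in> \<X>" "{j} \<in> \<X>" using ij(1) all_single by (auto simp: touch_def)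
    have "contract (g {i}) a \<noteq> contract (g {j}) a"
      using f0_contract[OF g_matching[OF X(1)], of a] f0_contract[OF g_matching[OF X(2)], of a] ij
        part_sub by force
    moreover have "(a, contract (g {i}) a) \<in> arcs" "(a, contract (g {j}) a) \<in> arcs"
      using X ij unfolding arcs_def by blast+
    ultimately show ?thesis by blast
  qed
  have "\<exists>x. (a, x) \<in> arcs" if a: "a \<in> A" for a
  proof -
    obtain i where "i < n" "a \<in> part i" by (rule in_some_part[OF a])
    then show ?thesis using all_single unfolding arcs_def by blast
  qed
  then obtain o1 where o1: "\<And>a. a \<in> A \<Longrightarrow> (a, o1 a) \<in> arcs" by metis
  have "\<exists>y. (a, y) \<in> arcs \<and> y \<noteq> o1 a" if "a \<in> ?Br" for a using two[OF that] by metis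
  then obtain o2 where o2: "\<And>a. a \<in> ?Br \<Longrightarrow> (a, o2 a) \<in> arcs \<and> o2 a \<noteq> o1 a" by metis
  let ?P = "(\<lambda>a. (a, o1 a)) ` A" and ?R = "(\<lambda>a. (a, o2 a)) ` ?Br"
  have fin: "finite A" "finite ?Br" using finite_parts finite_touching_pairs by auto
  have "card ?P = card A" "card ?R = card ?Br" by (auto intro!: card_image inj_onI)
  moreover have "?P \<inter> ?R = {}"
  proof (rule ccontr)
    assume "?P \<inter> ?R \<noteq> {}"
    then obtain p where p: "p \<in> ?P" "p \<in> ?R" by blast
    obtain a where a: "p = (a, o1 a)" using p(1) by (rule imageE)
    obtain b where b: "p = (b, o2 b)" "b \<in> ?Br" using p(2) by (rule imageE)
    have "a = b \<and> o1 a = o2 b"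
      using trans[OF a[symmetric] b(1)] unfolding prod.inject .
    then show False using o2[OF b(2)] by metis
  qed
  ultimately have "card (?P \<union> ?R) = card A + card ?Br" using fin by (simp add: card_Un_disjoint)
  moreover have "card (?P \<union> ?R) \<le> card arcs"
    using o1 o2 finite_subset[OF arcs_sub] fin(1) by (intro card_mono) auto
  moreover have "card ?Br = card touching_pairs" by (rule card_image[OF inj])
  ultimately show ?thesis using card_arcs by simp
qed

text \<open>The arcs never leave the union of the cycles of a set closed under touching.\<close>

lemma touch_closed:
  assumes S: "S \<subseteq> {..<n}" "S \<noteq> {}" and closed: "\<And>i j. i \<in> S \<Longrightarrow> touch i j \<Longrightarrow> j \<in> S"
  shows "S = {..<n}"
proof
  show "S \<subseteq> {..<n}" by (rule S(1))
  let ?P = "\<Union>i\<in>S. part i"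
  have join: "j \<in> S" if "i \<in> S" "j < n" "a \<in> part i" "a \<in> part j" for i j a
  proof (cases "i = j")
    case False
    then have "touch i j" using that S(1) unfolding touch_iff by auto
    then show ?thesis by (rule closed[OF that(1)])
  qed (use that in simp)
  have step: "b \<in> ?P" if "a \<in> ?P" "(a, b) \<in> arcs" for a b
  proof -
    obtain i where i: "i \<in> S" "a \<in> part i" using \<open>a \<in> ?P\<close> by blast
    obtain j where j: "b = contract (g {j}) a" "{j} \<in> \<X>" "a \<in> part j"
      using \<open>(a, b) \<in> arcs\<close> unfolding arcs_def by blast
    have aA: "a \<in> A" using i(2) part_sub by blast
    have "j < n" using X_sub[OF j(2)] by simp
    then have "j \<in> S" using join i j(3) by blast
    moreover have "b \<in> part j"
      using part_step[OF j(2,3)] contract_in[OF g_matching[OF j(2)] aA] f0_contract[OF g_matching[OF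
        j(2)] aA] j(1) by simp
    ultimately show ?thesis by blast
  qed
  obtain i where i: "i \<in> S" using S(2) by blast
  then have "i < n" using S(1) by auto
  then obtain a where a: "a \<in> part i" using part_nonempty[OF all_single] by blast
  have reach: "b \<in> ?P" if "(a, b) \<in> arcs\<^sup>*" for b
    using that by (induction rule: rtrancl_induct) (use a i step in blast)+
  show "{..<n} \<subseteq> S"
  proof
    fix l assume "l \<in> {..<n}"
    then have l: "l < n" by simp
    then obtain b where b: "b \<in> part l" using part_nonempty[OF all_single] by blast
    have "(a, b) \<in> arcs\<^sup>*" using a b part_sub by (intro arcs_strong) blast+
    then obtain k where "k \<in> S" "b \<in> part k" using reach by blast
    then show "l \<in> S" using join l b by blast
  qed
qed

text \<open>Without a touching pair that is no bridge, the remaining pairs would still connect \<open>n\<close>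
  faces, but there are fewer than \<open>n - 1\<close> of them.\<close>

lemma touch_tree: "tree_graph {..<n} touch"
proof
  show "finite {..<n}" by simp
  show "{..<n} \<noteq> {}" using n_pos by (simp add: lessThan_empty_iff)
  show "touch v u" if "touch u v" for u v by (rule touch_sym[OF that])
  show "\<not> touch u u" for u by (simp add: touch_def)
  show "u \<in> {..<n}" if "touch u v" for u v using that by (simp add: touch_def)
  show "S = {..<n}" if "S \<subseteq> {..<n}" "S \<noteq> {}" "\<And>u v. u \<in> S \<Longrightarrow> touch u v \<Longrightarrow> v \<in> S" for S
    by (rule touch_closed[OF that(1,2)]) (rule that(3))
  show "(u, v) \<notin> {(x, y). touch x y \<and> {x, y} \<noteq> {u, v}}\<^sup>*" if uv: "touch u v" for u v
  proof
    let ?T = "{(x, y). touch x y}" and ?E = "touching_pairs - {{u, v}}"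
    let ?R = "{(x, y). {x, y} \<in> ?E}"
    assume "(u, v) \<in> {(x, y). touch x y \<and> {x, y} \<noteq> {u, v}}\<^sup>*"
    moreover have "{(x, y). touch x y \<and> {x, y} \<noteq> {u, v}} = ?R" by (auto simp: touching_pair_iff)
    ultimately have uvR: "(u, v) \<in> ?R\<^sup>*" by simp
    have "sym ?R" by (auto simp: sym_def insert_commute)
    then have vuR: "(v, u) \<in> ?R\<^sup>*" using sym_rtrancl uvR by (meson symD)
    have "?T \<subseteq> ?R\<^sup>*"
    proof
      fix e assume "e \<in> ?T"
      then obtain x y where xy: "e = (x, y)" "touch x y" by blast
      show "e \<in> ?R\<^sup>*"
      proof (cases "{x, y} = {u, v}")
        case True
        then have "x = u \<and> y = v \<or> x = v \<and> y = u" by (simp add: doubleton_eq_iff)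
        then show ?thesis using xy(1) uvR vuR by blast
      next
        case False
        then have "(x, y) \<in> ?R" using xy(2) touching_pair_iff by simp
        then show ?thesis using xy(1) by blast
      qed
    qed
    then have TR: "?T\<^sup>* \<subseteq> ?R\<^sup>*" by (rule rtrancl_subset_rtrancl)
    have conn: "(x, y) \<in> ?R\<^sup>*" if x: "x \<in> {..<n}" and y: "y \<in> {..<n}" for x y
    proof -
      have "{z \<in> {..<n}. (x, z) \<in> ?T\<^sup>*} = {..<n}"
      proof (rule touch_closed)
        show "{z \<in> {..<n}. (x, z) \<in> ?T\<^sup>*} \<noteq> {}" using x by blast
        fix i j assume i: "i \<in> {z \<in> {..<n}. (x, z) \<in> ?T\<^sup>*}" and ij: "touch i j"
        then have "(x, j) \<in> ?T\<^sup>*" by (auto intro: rtrancl_into_rtrancl)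
        then show "j \<in> {z \<in> {..<n}. (x, z) \<in> ?T\<^sup>*}" using ij by (simp add: touch_def)
      qed blast
      then have "(x, y) \<in> ?T\<^sup>*" using y by blast
      then show ?thesis using TR by blast
    qed
    have "card {..<n} \<le> Suc (card ?E)"
      by (rule connected_card_edges) (use finite_touching_pairs conn in auto)
    moreover have "card ?E = card touching_pairs - 1" and "card touching_pairs > 0"
      using uv finite_touching_pairs touching_pair_iff[of u v] by (auto simp: card_gt_0_iff)
    ultimately show False using card_touching_pairs by simp
  qed
qed

end

theorem theorem13:
  fixes G :: "complex graph" and \<gamma> :: "complex set \<Rightarrow> real \<Rightarrow> complex"
    and H :: "bool list graph" and n :: nat
  assumes "plane_graph G \<gamma>" and "bipartite G" and "elementary G"
    and "card (finite_faces G \<gamma>) = n" and "n \<ge> 1"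
    and "daisy_cube n H" and "isomorphic H (resonance_graph G \<gamma>)"
    and "card (maximal_vertices H) \<le> 5"
  shows "exactly_one [structure1 H, structure2 n H, structure3 n H,
           structure4 n H, structure5 n H, structure6 n H]"
proof -
  obtain A B where "A \<inter> B = {} \<and> A \<union> B = verts G \<and> (\<forall>e\<in>edges G. e \<inter> A \<noteq> {} \<and> e \<inter> B \<noteq> {})"
    using assms(2) unfolding bipartite_def by (elim exE) (rule that)
  then have AB: "A \<inter> B = {}" "A \<union> B = verts G" "\<And>e. e \<in> edges G \<Longrightarrow> e \<inter> A \<noteq> {} \<and> e \<inter> B \<noteq> {}"
    by simp_all
  obtain X where "X \<subseteq> binary_strings n \<and> X \<noteq> {} \<and>
      (\<forall>x\<in>X. \<forall>y\<in>binary_strings n. string_le y x \<longrightarrow> y \<in> X) \<and> H = induced_subgraph (hypercube n) X"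
    using assms(6) unfolding daisy_cube_def by (elim exE) (rule that)
  then have X: "X \<subseteq> binary_strings n" "X \<noteq> {}"
    "\<And>x y. x \<in> X \<Longrightarrow> y \<in> binary_strings n \<Longrightarrow> string_le y x \<Longrightarrow> y \<in> X"
    and H: "H = induced_subgraph (hypercube n) X"
    by simp_all
  obtain h where h: "bij_betw h (verts H) (verts (resonance_graph G \<gamma>))"
    "\<And>u v. u \<in> verts H \<Longrightarrow> v \<in> verts H \<Longrightarrow> {u, v} \<in> edges H \<longleftrightarrow> {h u, h v} \<in> edges (resonance_graph G \<gamma>)"
    using assms(7) unfolding isomorphic_def by blast
  define \<X> where "\<X> = {S. S \<subseteq> {..<n} \<and> string_of n S \<in> X}"
  have X_eq: "string_of n ` \<X> = X"
    using X(1) unfolding \<X>_def binary_strings_eq by blast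
  have vH: "verts H = X" and eH: "edges H = {e \<in> edges (hypercube n). e \<subseteq> X}"
    unfolding H induced_subgraph_def by simp_all
  define g where "g S = h (string_of n S)" for S
  have down: "T \<in> \<X>" if S: "S \<in> \<X>" and T: "T \<subseteq> S" for S T
  proof -
    have S': "S \<subseteq> {..<n}" "string_of n S \<in> X" using S unfolding \<X>_def by blast+
    have T': "T \<subseteq> {..<n}" using S'(1) T by blast
    have "string_of n T \<in> X"
      by (rule X(3)[OF S'(2) string_of_mem]) (simp add: string_le_iff[OF T' S'(1)] T)
    then show ?thesis using T' unfolding \<X>_def by blast
  qed
  interpret R: resonance_daisy G \<gamma> A B n \<X> g
  proof
    show "plane_graph G \<gamma>" by fact
    show "A \<inter> B = {}" "A \<union> B = verts G" by fact+
    show "e \<inter> A \<noteq> {} \<and> e \<inter> B \<noteq> {}" if "e \<in> edges G" for e by (rule AB(3)[OF that])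
    show "S \<subseteq> {..<n}" if "S \<in> \<X>" for S using that unfolding \<X>_def by blast
    obtain S where "S \<in> \<X>" using X(2) X_eq by blast
    then show "{} \<in> \<X>" by (rule down) simp
    show "T \<in> \<X>" if "S \<in> \<X>" "T \<subseteq> S" for S T by (rule down[OF that])
    have "bij_betw (string_of n) \<X> (verts H)"
      unfolding bij_betw_def vH X_eq
      by (rule conjI, rule inj_on_subset[OF inj_string_of]) (auto simp: \<X>_def)
    from bij_betw_trans[OF this h(1)] show "bij_betw g \<X> {M. perfect_matching G M}"
      by (simp add: comp_def g_def[abs_def] resonance_graph_def)
    show "card (sym_diff S T) = 1 \<longleftrightarrow> {g S, g T} \<in> edges (resonance_graph G \<gamma>)"
      if ST: "S \<in> \<X>" "T \<in> \<X>" for S T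
    proof -
      have s: "S \<subseteq> {..<n}" "T \<subseteq> {..<n}" "string_of n S \<in> X" "string_of n T \<in> X"
        using ST unfolding \<X>_def by blast+
      have "card (sym_diff S T) = 1 \<longleftrightarrow> {string_of n S, string_of n T} \<in> edges H"
        using hypercube_edge_iff[OF s(1,2)] s(3,4) unfolding eH by simp
      also have "\<dots> \<longleftrightarrow> {g S, g T} \<in> edges (resonance_graph G \<gamma>)"
        unfolding g_def by (rule h(2)) (use s vH in simp_all)
      finally show ?thesis .
    qed
    show "connected_graph \<lparr>verts = \<Union>(allowed_edges G), edges = allowed_edges G\<rparr>"
      using assms(3) unfolding elementary_def by blast
    show "card (finite_faces G \<gamma>) = n" "n \<ge> 1" by fact+
  qed
  interpret T: tree_graph "{..<n}" R.touch by (rule R.touch_tree)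
  have indep: "{S. T.indep S} = \<X>"
    using R.member_iff unfolding T.indep_def by blast
  interpret tree_daisy n R.touch H
  proof
    show "S \<subseteq> {..<n}" if "S \<in> {S. T.indep S}" for S using that R.X_sub unfolding indep by blast
    show "{} \<in> {S. T.indep S}" unfolding indep by (rule R.X_empty)
    show "T \<in> {S. T.indep S}" if "S \<in> {S. T.indep S}" "T \<subseteq> S" for S T
      using that unfolding indep by (rule R.X_down)
    show "H = induced_subgraph (hypercube n) (string_of n ` {S. T.indep S})"
      unfolding indep X_eq by (rule H)
  qed
  show ?thesis by (rule exactly_one_structure[OF assms(8)])
qed

end
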